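(* Let $\gamma\in\mathbb{R}_+\setminus\mathbb{N}$ and $2\le p<\infty$. Let $\mathcal{D}^\gamma_{p,2}$ be the Besov space of modelled distributions for the polynomial regularity structure on $\mathbb{R}^d$ with its polynomial model, and let $\mathcal{R}\colon\mathcal{D}^\gamma_{p,2}\to\mathcal{B}^\gamma_{p,2}$ be the reconstruction operator (a continuous linear isomorphism). Let $W=(W^1,\dots,W^n)$ be an $n$-dimensional Brownian motion on $[0,T]$. Let $(A,Z,(B^i)_{i=1,\dots,n})$ and $x_0$ be admissible data on $E=\mathcal{B}^\gamma_{p,2}$, i.e.: - $-A$ is the infinitesimal generator of an analytic semigroup $\exp(-tA)$ on $E$; there is $M>0$ such that for all $\lambda\ge0$ the inverse $(A+\lambda I)^{-1}$ exists and $\|(A+\lambda I)^{-1}\|\le M/(1+\lambda)$; for all $s\in\mathbb{R}$ the imaginary power $A^{\sqrt{-1}s}$ exists and is a bounded operator on $E$, $\{A^{\sqrt{-1}s}\}_{s\in\mathbb{R}}$ is a $C_0$-group on $E$, and $\|A^{\sqrt{-1}s}\|\le K\exp(\vartheta_A|s|)$ for all $s\in\mathbb{R}$, for some $K>0$ and $\vartheta_A<\pi/2$; - $B^1,\dots,B^n$ are linear (generally unbounded) operators on $E$ such that $\sum_{i=1}^n|B^ix|^2_{D_A(1/2,2)}\le C_1|x|^2_{D(A)}+C_2|x|^2_{D_A(1/2,2)}$ for all $x\in D(A)$, for some constants $C_1,C_2$; - $Z\in M^2(0,T;D_A(\tfrac12,2))$ and $x_0\in L^2(D_A(\tfrac12,2))$.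 Define on $\mathcal{D}^\gamma_{p,2}$: $\tilde A:=\mathcal{R}^{-1}\circ A\circ\mathcal{R}$, $\tilde Z_t:=\mathcal{R}^{-1}Z_t$, $\tilde B^i:=\mathcal{R}^{-1}\circ B^i\circ\mathcal{R}$. Then $X\in Z_T(A)$ is a strict solution to $$\mathrm{d}X_t=-AX_t\,\mathrm{d}t+Z_t\,\mathrm{d}t+\sum_{i=1}^nB^iX_t\,\mathrm{d}W^i_t,\qquad X_0=x_0,$$ on $\mathcal{B}^\gamma_{p,2}$ if and only if $Y:=\mathcal{R}^{-1}X\in Z_T(\tilde A)$ is a strict solution to $$\mathrm{d}Y_t=-\tilde AY_t\,\mathrm{d}t+\tilde Z_t\,\mathrm{d}t+\sum_{i=1}^n\tilde B^iY_t\,\mathrm{d}W^i_t,\qquad Y_0=\mathcal{R}^{-1}x_0,$$ on $\mathcal{D}^\gamma_{p,2}$.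
   Context: **Spaces attached to the generator.** Let $E$ be $\mathcal{B}^\gamma_{p,2}$ or $\mathcal{D}^\gamma_{p,2}$ (both UMD and of martingale type 2), and $-A$ the generator of an analytic semigroup on $E$ with domain $D(A)$. $D_A(\tfrac12,2):=\{x\in E:\int_0^\infty|t^{1/2}A\exp(-tA)x|_E^2\,\tfrac{\mathrm{d}t}{t}<\infty\}$ is the real interpolation space between $E$ and $D(A)$, with norm given by $|x|^2_{D_A(1/2,2)}:=\int_0^\infty|t^{1/2}A\exp(-tA)x|_E^2\,\tfrac{\mathrm{d}t}{t}$. For a Banach space $V$, $M^2(0,T;V)$ is the space of progressively measurable $V$-valued processes on $[0,T]$ that are square integrable over $\Omega\times[0,T]$; $L^2(V)$ is the space of square-integrable $V$-valued random variables (initial values being $\mathcal{F}_0$-measurable); $\mathcal{C}(0,T;L^2(V))$ is the space of continuous maps $[0,T]\to L^2(V)$. Put $$Z_T(A):=M^2(0,T;D(A))\cap\mathcal{C}\big(0,T;L^2(D_A(\tfrac12,2))\big).$$ **Strict solution.** A process $X\in Z_T(A)$ is a strict solution of the equation with data $(A,Z,(B^i))$ and initial value $x_0$ if $$X_t+\int_0^tAX_s\,\mathrm{d}s=x_0+\sum_{i=1}^n\int_0^tB^iX_s\,\mathrm{d}W^i_s+\int_0^tZ_s\,\mathrm{d}s,\qquad t\in[0,T].$$ The stochastic integral is the one in UMD/martingale-type-2 Banach spaces. The underlying filtered probability space $(\Omega,\mathcal{F},\mathbb{F},\mathbb{P})$ is complete. The conjugated operators have domains $D(\tilde A)=\mathcal{R}^{-1}(D(A))$,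 etc. **Test functions.** $B(0,1)$ is the unit ball for $\|x\|:=\sup_i|x_i|$. $\mathcal{B}^r$: compactly supported $\phi\in\mathcal{C}^r(\mathbb{R}^d)$ with $\|\phi\|_{\mathcal{C}^r}\le1$ and support in $B(0,1)$; $\mathcal{B}^r_m$: those $\phi\in\mathcal{B}^r$ annihilating all polynomials of degree at most $m$. $\eta^\lambda_x(y):=\lambda^{-d}\eta(\lambda^{-1}(y-x))$; $L^2_\lambda:=L^2((0,1),\lambda^{-1}\mathrm{d}\lambda)$. **Classical Besov space.** For an integer $r>\gamma$, $\mathcal{B}^\gamma_{p,2}=\mathcal{B}^\gamma_{p,2}(\mathbb{R}^d)$ is the space of distributions $\xi$ with $\|\sup_{\eta\in\mathcal{B}^r}|\langle\xi,\eta^1_x\rangle|\|_{L^p(\mathrm{d}x)}<\infty$ and $\big\|\,\|\sup_{\eta\in\mathcal{B}^r_{\lfloor\gamma\rfloor}}|\langle\xi,\eta^\lambda_x\rangle|/\lambda^\gamma\|_{L^p(\mathrm{d}x)}\big\|_{L^2_\lambda}<\infty$ (the usual Besov space). **Polynomial regularity structure, model and modelled distributions.** Model space $\mathbb{R}[X_1,\dots,X_d]=\bigoplus_{m\in\mathbb{N}}T_m$, $T_m=\mathrm{span}\{X^k:|k|=m\}$; $\Pi_xP(X)=P(\cdot-x)$, $\Gamma_{x,y}P(X)=P(X+(x-y))$. $\mathcal{D}^\gamma_{p,2}$ is the space of measurable $f\colon\mathbb{R}^d\to\bigoplus_{m<\gamma}T_m$ with $$|||f|||_{\gamma,p,2}:=\sum_{m<\gamma}\big\||f(x)|_m\big\|_{L^p(\mathrm{d}x)}+\sum_{m<\gamma}\bigg(\int_{B(0,1)}\Big\|\frac{|f(x+h)-\Gamma_{x+h,x}f(x)|_m}{\|h\|^{\gamma-m}}\Big\|_{L^p(\mathrm{d}x)}^2\frac{\mathrm{d}h}{\|h\|^d}\bigg)^{1/2}<\infty,$$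 where $|\cdot|_m$ is the norm of the component in $T_m$. **Reconstruction operator.** $\mathcal{R}$ is the unique continuous linear operator on $\mathcal{D}^\gamma_{p,2}$ with $\big\|\,\|\sup_{\eta\in\mathcal{B}^r}|\langle\mathcal{R}f-\Pi_xf(x),\eta^\lambda_x\rangle|/\lambda^\gamma\|_{L^p(\mathrm{d}x)}\big\|_{L^2_\lambda}\lesssim|||f|||_{\gamma,p,2}$; it is known to be a continuous isomorphism from $\mathcal{D}^\gamma_{p,2}$ onto $\mathcal{B}^\gamma_{p,2}$. *)

theory Defs
  imports "HOL-Probability.Probability" "HOL-Analysis.Finite_Function_Topology"
begin

section \<open>Normed spaces given by a carrier and a norm\<close>

text \<open>
  The spaces of this theory depend on real parameters, so they are not types but linear
  subspaces of a real vector space, each with a norm of its own.  The norm function is only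
  meaningful on the carrier.
\<close>

record 'v nspace =
  carr :: "'v set"
  nrm :: "'v \<Rightarrow> real"

definition nopen :: "'v::real_vector nspace \<Rightarrow> 'v set \<Rightarrow> bool" where
  "nopen V U \<longleftrightarrow> U \<subseteq> carr V \<and>
     (\<forall>x\<in>U. \<exists>e>0. \<forall>y\<in>carr V. nrm V (y - x) < e \<longrightarrow> y \<in> U)"

definition nborel :: "'v::real_vector nspace \<Rightarrow> 'v measure" where
  "nborel V = sigma (carr V) {U. nopen V U}"

definition bounded_op ::
    "'v::real_vector nspace \<Rightarrow> 'u::real_vector nspace \<Rightarrow> ('v \<Rightarrow> 'u) \<Rightarrow> bool" where
  "bounded_op V U R \<longleftrightarrow>
     (\<forall>x\<in>carr V. R x \<in> carr U) \<and>
     (\<forall>x\<in>carr V. \<forall>y\<in>carr V. R (x + y) = R x + R y) \<and>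
     (\<forall>c. \<forall>x\<in>carr V. R (c *\<^sub>R x) = c *\<^sub>R R x) \<and>
     (\<exists>C. \<forall>x\<in>carr V. nrm U (R x) \<le> C * nrm V x)"

definition isomorphism_op ::
    "'v::real_vector nspace \<Rightarrow> 'u::real_vector nspace \<Rightarrow> ('v \<Rightarrow> 'u) \<Rightarrow> bool" where
  "isomorphism_op V U R \<longleftrightarrow>
     bounded_op V U R \<and> bij_betw R (carr V) (carr U) \<and>
     bounded_op U V (inv_into (carr V) R)"

text \<open>
  Bochner integrability as in \<open>has_bochner_integral\<close>, whose target must be a normed
  type.  The integrand need only agree almost everywhere with a \<open>V\<close>-valued Borel function; the
  spaces used below are separable, so Borel and strong measurability coincide.
\<close>

definition has_bochner_integral_in ::
    "'v::real_vector nspace \<Rightarrow> 'a measure \<Rightarrow> ('a \<Rightarrow> 'v) \<Rightarrow> 'v \<Rightarrow> bool" where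
  "has_bochner_integral_in V M f I \<longleftrightarrow> I \<in> carr V \<and>
     (\<exists>g s. g \<in> M \<rightarrow>\<^sub>M nborel V \<and> (AE x in M. f x = g x) \<and>
        (\<forall>k. Bochner_Integration.simple_bochner_integrable M (s k) \<and> s k ` space M \<subseteq> carr V) \<and>
        (\<lambda>k. \<integral>\<^sup>+x. ennreal (nrm V (g x - s k x)) \<partial>M) \<longlonglongrightarrow> 0 \<and>
        (\<lambda>k. nrm V (Bochner_Integration.simple_bochner_integral M (s k) - I)) \<longlonglongrightarrow> 0)"

section \<open>Complexification\<close>

text \<open>
  The spaces below are real; analyticity of a semigroup and imaginary powers refer to the
  complexification, in which the pair \<open>(x, y)\<close> stands for \<open>x + \<i> y\<close>.
\<close>

definition cscale :: "complex \<Rightarrow> 'v::real_vector \<times> 'v \<Rightarrow> 'v \<times> 'v" where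
  "cscale c z = (Re c *\<^sub>R fst z - Im c *\<^sub>R snd z, Im c *\<^sub>R fst z + Re c *\<^sub>R snd z)"

text \<open>The norm is Taylor's: \<open>sup {|Re (exp (\<i> \<theta>) z)| | \<theta>}\<close>.\<close>

definition complexify :: "'v::real_vector nspace \<Rightarrow> ('v \<times> 'v) nspace" where
  "complexify E = \<lparr>carr = carr E \<times> carr E,
     nrm = (\<lambda>z. SUP \<theta>::real. nrm E (fst (cscale (cis \<theta>) z)))\<rparr>"

definition bounded_cop :: "'v::real_vector nspace \<Rightarrow> ('v \<times> 'v \<Rightarrow> 'v \<times> 'v) \<Rightarrow> bool" where
  "bounded_cop E U \<longleftrightarrow> bounded_op (complexify E) (complexify E) U \<and>
     (\<forall>c. \<forall>z\<in>carr (complexify E). U (cscale c z) = cscale c (U z))"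

section \<open>Unbounded operators, semigroups, imaginary powers\<close>

text \<open>The values of \<open>op_app A\<close> outside \<open>op_dom A\<close> carry no meaning.\<close>

record 'v unbounded_op =
  op_dom :: "'v set"
  op_app :: "'v \<Rightarrow> 'v"

definition linear_operator :: "'v::real_vector nspace \<Rightarrow> 'v unbounded_op \<Rightarrow> bool" where
  "linear_operator E A \<longleftrightarrow> subspace (op_dom A) \<and> op_dom A \<subseteq> carr E \<and>
     (\<forall>x\<in>op_dom A. op_app A x \<in> carr E) \<and>
     (\<forall>x\<in>op_dom A. \<forall>y\<in>op_dom A. op_app A (x + y) = op_app A x + op_app A y) \<and>
     (\<forall>c. \<forall>x\<in>op_dom A. op_app A (c *\<^sub>R x) = c *\<^sub>R op_app A x)"

definition neg_op :: "'v::real_vector unbounded_op \<Rightarrow> 'v unbounded_op" where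
  "neg_op A = \<lparr>op_dom = op_dom A, op_app = (\<lambda>x. - op_app A x)\<rparr>"

text \<open>\<open>conj_op D R A\<close> is \<open>R\<inverse> \<circ> A \<circ> R\<close> on \<open>D\<close>, with domain \<open>R\<inverse> (op_dom A)\<close>.\<close>

definition conj_op ::
    "'u nspace \<Rightarrow> ('u \<Rightarrow> 'v) \<Rightarrow> 'v unbounded_op \<Rightarrow> 'u unbounded_op" where
  "conj_op D R A = \<lparr>op_dom = {x\<in>carr D. R x \<in> op_dom A},
     op_app = (\<lambda>x. inv_into (carr D) R (op_app A (R x)))\<rparr>"

text \<open>
  On a Banach space the exponential bound follows from the other clauses by the uniform
  boundedness principle.
\<close>

definition c0_semigroup :: "'v::real_vector nspace \<Rightarrow> (real \<Rightarrow> 'v \<Rightarrow> 'v) \<Rightarrow> bool" where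
  "c0_semigroup E S \<longleftrightarrow>
     (\<forall>t\<ge>0. bounded_op E E (S t)) \<and>
     (\<forall>x\<in>carr E. S 0 x = x) \<and>
     (\<forall>s\<ge>0. \<forall>t\<ge>0. \<forall>x\<in>carr E. S (s + t) x = S s (S t x)) \<and>
     (\<forall>x\<in>carr E. ((\<lambda>t. nrm E (S t x - x)) \<longlongrightarrow> 0) (at_right 0)) \<and>
     (\<exists>M w. \<forall>t\<ge>0. \<forall>x\<in>carr E. nrm E (S t x) \<le> M * exp (w * t) * nrm E x)"

definition has_generator ::
    "'v::real_vector nspace \<Rightarrow> (real \<Rightarrow> 'v \<Rightarrow> 'v) \<Rightarrow> 'v unbounded_op \<Rightarrow> bool" where
  "has_generator E S G \<longleftrightarrow>
     (let is_lim = (\<lambda>x y. y \<in> carr E \<and>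
            ((\<lambda>h. nrm E ((S h x - x) /\<^sub>R h - y)) \<longlongrightarrow> 0) (at_right 0))
      in op_dom G = {x\<in>carr E. \<exists>y. is_lim x y} \<and> (\<forall>x\<in>op_dom G. is_lim x (op_app G x)))"

definition sector :: "real \<Rightarrow> complex set" where
  "sector \<delta> = {z. z \<noteq> 0 \<and> \<bar>Arg z\<bar> < \<delta>}"

definition analytic_semigroup :: "'v::real_vector nspace \<Rightarrow> (real \<Rightarrow> 'v \<Rightarrow> 'v) \<Rightarrow> bool" where
  "analytic_semigroup E S \<longleftrightarrow> c0_semigroup E S \<and>
     (\<exists>\<delta> H. 0 < \<delta> \<and> \<delta> \<le> pi / 2 \<and>
        (\<forall>z\<in>sector \<delta>. bounded_cop E (H z)) \<and>
        (\<forall>t>0. \<forall>x\<in>carr E. H (of_real t) (x, 0) = (S t x, 0)) \<and>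
        (\<forall>z\<in>sector \<delta>. \<forall>w\<in>sector \<delta>. \<forall>x\<in>carr (complexify E). H (z + w) x = H z (H w x)) \<and>
        (\<forall>z\<in>sector \<delta>. \<forall>x\<in>carr (complexify E). \<exists>y\<in>carr (complexify E).
           ((\<lambda>h. nrm (complexify E) (cscale (inverse h) (H (z + h) x - H z x) - y))
              \<longlongrightarrow> 0) (at 0)) \<and>
        (\<forall>x\<in>carr (complexify E).
           ((\<lambda>z. nrm (complexify E) (H z x - x)) \<longlongrightarrow> 0) (at 0 within sector \<delta>)))"

text \<open>\<open>exp_op E A t\<close> is \<open>exp (- t A)\<close>; a generator determines its semigroup on \<open>carr E\<close>.\<close>

definition exp_op :: "'v::real_vector nspace \<Rightarrow> 'v unbounded_op \<Rightarrow> real \<Rightarrow> 'v \<Rightarrow> 'v" where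
  "exp_op E A = (SOME S. c0_semigroup E S \<and> has_generator E S (neg_op A))"

text \<open>\<open>resolvent A l\<close> is \<open>(A + l I)\<inverse>\<close>.\<close>

definition resolvent :: "'v::real_vector unbounded_op \<Rightarrow> real \<Rightarrow> 'v \<Rightarrow> 'v" where
  "resolvent A l = inv_into (op_dom A) (\<lambda>x. op_app A x + l *\<^sub>R x)"

text \<open>
  The Balakrishnan formula
    \<open>A\<^sup>z x = (sin (\<pi> z) / (\<pi> z)) \<integral>\<^sub>0\<^sup>\<infinity> t\<^sup>z (A + t I)\<^sup>-\<^sup>2 A x dt\<close>,  \<open>x \<in> D(A)\<close>,
  at \<open>z = \<i> s\<close>, where \<open>sin (\<pi> z) / (\<pi> z) = sinh (\<pi> s) / (\<pi> s)\<close>, to be read as 1 at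
  \<open>s = 0\<close>.  The power \<open>A\<^sup>z\<close> is the closure of the operator given by the formula on
  \<open>D(A)\<close>.  As \<open>D(A)\<close> is dense, this closure is a bounded operator on the complexification of
  \<open>E\<close> iff some bounded complex linear \<open>U\<close> extends the formula, and then the closure is \<open>U\<close>;
  by linearity it suffices to look at real \<open>x\<close>.
\<close>

definition is_bounded_imaginary_power ::
    "'v::real_vector nspace \<Rightarrow> 'v unbounded_op \<Rightarrow> real \<Rightarrow> ('v \<times> 'v \<Rightarrow> 'v \<times> 'v) \<Rightarrow> bool" where
  "is_bounded_imaginary_power E A s U \<longleftrightarrow> bounded_cop E U \<and>
     (\<forall>x\<in>op_dom A. \<exists>I.
        has_bochner_integral_in (complexify E) (restrict_space lborel {0<..})
          (\<lambda>t. cscale (of_real t powr (\<i> * of_real s))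
                 (resolvent A t (resolvent A t (op_app A x)), 0)) I \<and>
        U (x, 0) = (if s = 0 then 1 else sinh (pi * s) / (pi * s)) *\<^sub>R I)"

definition bounded_imaginary_powers ::
    "'v::real_vector nspace \<Rightarrow> 'v unbounded_op \<Rightarrow> bool" where
  "bounded_imaginary_powers E A \<longleftrightarrow>
     (\<exists>U. (\<forall>s. is_bounded_imaginary_power E A s (U s)) \<and>
        (\<forall>x\<in>carr (complexify E). U 0 x = x) \<and>
        (\<forall>s t. \<forall>x\<in>carr (complexify E). U (s + t) x = U s (U t x)) \<and>
        (\<forall>x\<in>carr (complexify E). ((\<lambda>s. nrm (complexify E) (U s x - x)) \<longlongrightarrow> 0) (at 0)) \<and>
        (\<exists>K \<theta>. 0 < K \<and> \<theta> < pi / 2 \<and>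
           (\<forall>s. \<forall>x\<in>carr (complexify E).
              nrm (complexify E) (U s x) \<le> K * exp (\<theta> * \<bar>s\<bar>) * nrm (complexify E) x)))"

definition domain_space :: "'v::real_vector nspace \<Rightarrow> 'v unbounded_op \<Rightarrow> 'v nspace" where
  "domain_space E A = \<lparr>carr = op_dom A, nrm = (\<lambda>x. nrm E x + nrm E (op_app A x))\<rparr>"

definition DA_half_sq ::
    "'v::real_vector nspace \<Rightarrow> 'v unbounded_op \<Rightarrow> 'v \<Rightarrow> ennreal" where
  "DA_half_sq E A x =
     (\<integral>\<^sup>+t\<in>{0<..}. ennreal ((nrm E (t powr (1/2) *\<^sub>R op_app A (exp_op E A t x)))\<^sup>2 / t) \<partial>lborel)"

definition DA_half :: "'v::real_vector nspace \<Rightarrow> 'v unbounded_op \<Rightarrow> 'v nspace" where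
  "DA_half E A = \<lparr>carr = {x\<in>carr E. DA_half_sq E A x < \<infinity>},
     nrm = (\<lambda>x. sqrt (enn2real (DA_half_sq E A x)))\<rparr>"

section \<open>Stochastic processes\<close>

definition filtered_prob_space :: "'w measure \<Rightarrow> (real \<Rightarrow> 'w measure) \<Rightarrow> real \<Rightarrow> bool" where
  "filtered_prob_space P F T \<longleftrightarrow> prob_space P \<and> complete_measure P \<and>
     (\<forall>t\<in>{0..T}. subalgebra P (F t)) \<and>
     (\<forall>s\<in>{0..T}. \<forall>t\<in>{s..T}. subalgebra (F t) (F s)) \<and>
     null_sets P \<subseteq> sets (F 0)"

text \<open>
  The increments of \<open>W\<^sub>1, \<dots>, W\<^sub>n\<close> over \<open>[s, t]\<close> and the past \<open>F s\<close> (index 0 of the family)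
  are jointly independent.
\<close>

definition brownian_motion ::
    "'w measure \<Rightarrow> (real \<Rightarrow> 'w measure) \<Rightarrow> real \<Rightarrow> nat \<Rightarrow> (nat \<Rightarrow> real \<Rightarrow> 'w \<Rightarrow> real) \<Rightarrow> bool" where
  "brownian_motion P F T n W \<longleftrightarrow>
     (\<forall>i\<in>{1..n}.
        (AE \<omega> in P. W i 0 \<omega> = 0) \<and>
        (AE \<omega> in P. continuous_on {0..T} (\<lambda>t. W i t \<omega>)) \<and>
        (\<forall>t\<in>{0..T}. W i t \<in> borel_measurable (F t))) \<and>
     (\<forall>s t. 0 \<le> s \<and> s < t \<and> t \<le> T \<longrightarrow>
        (\<forall>i\<in>{1..n}. distributed P lborel (\<lambda>\<omega>. W i t \<omega> - W i s \<omega>)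
           (\<lambda>x. ennreal (normal_density 0 (sqrt (t - s)) x))) \<and>
        prob_space.indep_sets P
          (\<lambda>k. if k = 0 then sets (F s)
               else {(\<lambda>\<omega>. W k t \<omega> - W k s \<omega>) -` U \<inter> space P | U. U \<in> sets borel}) {0..n})"

text \<open>
  Elements of the spaces of random variables and processes below are taken up to almost sure
  (respectively \<open>dt \<otimes> P\<close>-almost everywhere) equality: membership means that some modification
  is everywhere \<open>V\<close>-valued and has the required properties.  For \<open>M\<^sup>2\<close> this matters, because a
  process in \<open>Z\<^sub>T(A)\<close> has values in \<open>D(A)\<close> only for almost every time; its initial value
  lies merely in \<open>D\<^sub>A(1/2, 2)\<close>.
\<close>

definition L2_rv ::
    "'v::real_vector nspace \<Rightarrow> 'w measure \<Rightarrow> 'w measure \<Rightarrow> ('w \<Rightarrow> 'v) set" where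
  "L2_rv V P G = {x. \<exists>y. y \<in> G \<rightarrow>\<^sub>M nborel V \<and> (AE \<omega> in P. x \<omega> = y \<omega>) \<and>
     (\<integral>\<^sup>+\<omega>. ennreal ((nrm V (y \<omega>))\<^sup>2) \<partial>P) < \<infinity>}"

definition progressive ::
    "'v::real_vector nspace \<Rightarrow> (real \<Rightarrow> 'w measure) \<Rightarrow> real \<Rightarrow> (real \<Rightarrow> 'w \<Rightarrow> 'v) \<Rightarrow> bool" where
  "progressive V F T X \<longleftrightarrow>
     (\<forall>t\<in>{0..T}. (\<lambda>(s, \<omega>). X s \<omega>) \<in> restrict_space borel {0..t} \<Otimes>\<^sub>M F t \<rightarrow>\<^sub>M nborel V)"

definition M2_proc ::
    "'v::real_vector nspace \<Rightarrow> 'w measure \<Rightarrow> (real \<Rightarrow> 'w measure) \<Rightarrow> real \<Rightarrow> (real \<Rightarrow> 'w \<Rightarrow> 'v) set" where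
  "M2_proc V P F T = {X. \<exists>Y. progressive V F T Y \<and>
     (AE (s, \<omega>) in restrict_space lborel {0..T} \<Otimes>\<^sub>M P. X s \<omega> = Y s \<omega>) \<and>
     (\<integral>\<^sup>+(s, \<omega>). ennreal ((nrm V (Y s \<omega>))\<^sup>2) \<partial>(restrict_space lborel {0..T} \<Otimes>\<^sub>M P)) < \<infinity>}"

definition C_L2_proc ::
    "'v::real_vector nspace \<Rightarrow> 'w measure \<Rightarrow> real \<Rightarrow> (real \<Rightarrow> 'w \<Rightarrow> 'v) set" where
  "C_L2_proc V P T = {X. (\<forall>t\<in>{0..T}. X t \<in> L2_rv V P P) \<and>
     (\<forall>t\<in>{0..T}. ((\<lambda>s. \<integral>\<^sup>+\<omega>. ennreal ((nrm V (X s \<omega> - X t \<omega>))\<^sup>2) \<partial>P) \<longlongrightarrow> 0)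
        (at t within {0..T}))}"

definition Z_space ::
    "'v::real_vector nspace \<Rightarrow> 'w measure \<Rightarrow> (real \<Rightarrow> 'w measure) \<Rightarrow> real \<Rightarrow> 'v unbounded_op
       \<Rightarrow> (real \<Rightarrow> 'w \<Rightarrow> 'v) set" where
  "Z_space E P F T A = M2_proc (domain_space E A) P F T \<inter> C_L2_proc (DA_half E A) P T"

text \<open>
  A step process on \<open>[0, t]\<close> is given by a partition \<open>\<tau> 0 \<le> \<dots> \<le> \<tau> m\<close> and coefficients
  \<open>a j\<close>, square integrable and measurable at time \<open>\<tau> j\<close>.
\<close>

definition step_data ::
    "'v::real_vector nspace \<Rightarrow> 'w measure \<Rightarrow> (real \<Rightarrow> 'w measure) \<Rightarrow> real
       \<Rightarrow> nat \<Rightarrow> (nat \<Rightarrow> real) \<Rightarrow> (nat \<Rightarrow> 'w \<Rightarrow> 'v) \<Rightarrow> bool" where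
  "step_data V P F t m \<tau> a \<longleftrightarrow>
     (\<forall>j\<le>m. \<tau> j \<in> {0..t}) \<and> (\<forall>j<m. \<tau> j \<le> \<tau> (Suc j)) \<and>
     (\<forall>j<m. a j \<in> F (\<tau> j) \<rightarrow>\<^sub>M nborel V \<and> (\<integral>\<^sup>+\<omega>. ennreal ((nrm V (a j \<omega>))\<^sup>2) \<partial>P) < \<infinity>)"

definition step_process ::
    "nat \<Rightarrow> (nat \<Rightarrow> real) \<Rightarrow> (nat \<Rightarrow> 'w \<Rightarrow> 'v::real_vector) \<Rightarrow> real \<Rightarrow> 'w \<Rightarrow> 'v" where
  "step_process m \<tau> a s \<omega> = (\<Sum>j<m. indicator {\<tau> j<..\<tau> (Suc j)} s *\<^sub>R a j \<omega>)"

definition step_integral ::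
    "(real \<Rightarrow> 'w \<Rightarrow> real) \<Rightarrow> nat \<Rightarrow> (nat \<Rightarrow> real) \<Rightarrow> (nat \<Rightarrow> 'w \<Rightarrow> 'v::real_vector) \<Rightarrow> 'w \<Rightarrow> 'v" where
  "step_integral w m \<tau> a \<omega> = (\<Sum>j<m. (w (\<tau> (Suc j)) \<omega> - w (\<tau> j) \<omega>) *\<^sub>R a j \<omega>)"

text \<open>
  \<open>J = \<integral>\<^sub>0\<^sup>t \<Phi> dw\<close> for \<open>\<Phi> \<in> M\<^sup>2(0, t; V)\<close>: the \<open>L\<^sup>2\<close>-limit of the integrals of step
  processes converging to \<open>\<Phi>\<close>.  In a space of martingale type 2, step integration is bounded
  from \<open>M\<^sup>2(0, t; V)\<close> to \<open>L\<^sup>2(V)\<close>, so that \<open>J\<close> exists and is almost surely unique.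
\<close>

definition has_stochastic_integral ::
    "'v::real_vector nspace \<Rightarrow> 'w measure \<Rightarrow> (real \<Rightarrow> 'w measure) \<Rightarrow> (real \<Rightarrow> 'w \<Rightarrow> real)
       \<Rightarrow> real \<Rightarrow> (real \<Rightarrow> 'w \<Rightarrow> 'v) \<Rightarrow> ('w \<Rightarrow> 'v) \<Rightarrow> bool" where
  "has_stochastic_integral V P F w t \<Phi> J \<longleftrightarrow>
     \<Phi> \<in> M2_proc V P F t \<and> J \<in> L2_rv V P (F t) \<and>
     (\<exists>m \<tau> a. (\<forall>k. step_data V P F t (m k) (\<tau> k) (a k)) \<and>
        (\<lambda>k::nat. \<integral>\<^sup>+(s, \<omega>). ennreal ((nrm V (step_process (m k) (\<tau> k) (a k) s \<omega> - \<Phi> s \<omega>))\<^sup>2)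
               \<partial>(restrict_space lborel {0..t} \<Otimes>\<^sub>M P)) \<longlonglongrightarrow> 0 \<and>
        (\<lambda>k. \<integral>\<^sup>+\<omega>. ennreal ((nrm V (step_integral w (m k) (\<tau> k) (a k) \<omega> - J \<omega>))\<^sup>2) \<partial>P)
          \<longlonglongrightarrow> 0)"

definition strict_solution ::
    "'v::real_vector nspace \<Rightarrow> 'w measure \<Rightarrow> (real \<Rightarrow> 'w measure) \<Rightarrow> real
       \<Rightarrow> nat \<Rightarrow> (nat \<Rightarrow> real \<Rightarrow> 'w \<Rightarrow> real)
       \<Rightarrow> 'v unbounded_op \<Rightarrow> (real \<Rightarrow> 'w \<Rightarrow> 'v) \<Rightarrow> (nat \<Rightarrow> 'v unbounded_op) \<Rightarrow> ('w \<Rightarrow> 'v)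
       \<Rightarrow> (real \<Rightarrow> 'w \<Rightarrow> 'v) \<Rightarrow> bool" where
  "strict_solution E P F T n W A Z B x0 X \<longleftrightarrow> X \<in> Z_space E P F T A \<and>
     (\<forall>t\<in>{0..T}. \<exists>IA IZ J.
        (AE \<omega> in P. has_bochner_integral_in E (restrict_space lborel {0..t})
                      (\<lambda>s. op_app A (X s \<omega>)) (IA \<omega>)) \<and>
        (AE \<omega> in P. has_bochner_integral_in E (restrict_space lborel {0..t})
                      (\<lambda>s. Z s \<omega>) (IZ \<omega>)) \<and>
        (\<forall>i\<in>{1..n}. has_stochastic_integral E P F (W i) t
                       (\<lambda>s \<omega>. op_app (B i) (X s \<omega>)) (J i)) \<and>
        (AE \<omega> in P. X t \<omega> + IA \<omega> = x0 \<omega> + (\<Sum>i=1..n. J i \<omega>) + IZ \<omega>))"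

definition admissible_data ::
    "'v::real_vector nspace \<Rightarrow> 'w measure \<Rightarrow> (real \<Rightarrow> 'w measure) \<Rightarrow> real \<Rightarrow> nat
       \<Rightarrow> 'v unbounded_op \<Rightarrow> (real \<Rightarrow> 'w \<Rightarrow> 'v) \<Rightarrow> (nat \<Rightarrow> 'v unbounded_op) \<Rightarrow> ('w \<Rightarrow> 'v) \<Rightarrow> bool" where
  "admissible_data E P F T n A Z B x0 \<longleftrightarrow>
     (\<exists>S. analytic_semigroup E S \<and> has_generator E S (neg_op A)) \<and>
     (\<exists>M>0. \<forall>l\<ge>0. bij_betw (\<lambda>x. op_app A x + l *\<^sub>R x) (op_dom A) (carr E) \<and>
        (\<forall>x\<in>carr E. nrm E (resolvent A l x) \<le> M / (1 + l) * nrm E x)) \<and>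
     bounded_imaginary_powers E A \<and>
     (\<forall>i\<in>{1..n}. linear_operator E (B i) \<and> op_dom A \<subseteq> op_dom (B i) \<and>
        (\<forall>x\<in>op_dom A. op_app (B i) x \<in> carr (DA_half E A))) \<and>
     (\<exists>C1 C2. \<forall>x\<in>op_dom A.
        (\<Sum>i=1..n. (nrm (DA_half E A) (op_app (B i) x))\<^sup>2)
          \<le> C1 * (nrm (domain_space E A) x)\<^sup>2 + C2 * (nrm (DA_half E A) x)\<^sup>2) \<and>
     Z \<in> M2_proc (DA_half E A) P F T \<and>
     x0 \<in> L2_rv (DA_half E A) P (F 0)"

section \<open>Test functions and distributions\<close>

definition partial_deriv :: "'d::finite \<Rightarrow> (real^'d \<Rightarrow> real) \<Rightarrow> real^'d \<Rightarrow> real" where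
  "partial_deriv i f x = deriv (\<lambda>t. f (x + t *\<^sub>R axis i 1)) 0"

fun iter_partial :: "'d::finite list \<Rightarrow> (real^'d \<Rightarrow> real) \<Rightarrow> real^'d \<Rightarrow> real" where
  "iter_partial [] f = f"
| "iter_partial (i # is) f = partial_deriv i (iter_partial is f)"

definition Cr :: "nat \<Rightarrow> (real^'d::finite \<Rightarrow> real) set" where
  "Cr r = {f. (\<forall>is. length is \<le> r \<longrightarrow> continuous_on UNIV (iter_partial is f)) \<and>
     (\<forall>is i x. length is < r \<longrightarrow>
        (\<lambda>t. iter_partial is f (x + t *\<^sub>R axis i 1)) differentiable (at 0))}"

definition supp :: "(real^'d::finite \<Rightarrow> real) \<Rightarrow> (real^'d) set" where
  "supp f = closure {x. f x \<noteq> 0}"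

definition Crc :: "nat \<Rightarrow> (real^'d::finite \<Rightarrow> real) set" where
  "Crc r = {f\<in>Cr r. compact (supp f)}"

definition Cr_norm :: "nat \<Rightarrow> (real^'d::finite \<Rightarrow> real) \<Rightarrow> real" where
  "Cr_norm r f = (SUP (is, x) \<in> {is. length is \<le> r} \<times> UNIV. \<bar>iter_partial is f x\<bar>)"

text \<open>\<open>infnorm\<close> is the supremum norm \<open>\<parallel>x\<parallel>\<close> of the coordinates.\<close>

definition sup_ball :: "(real^'d::finite) set" where
  "sup_ball = {x. infnorm x < 1}"

definition test_functions :: "nat \<Rightarrow> (real^'d::finite \<Rightarrow> real) set" where
  "test_functions r = {f\<in>Crc r. Cr_norm r f \<le> 1 \<and> supp f \<subseteq> sup_ball}"

text \<open>\<open>rescale l x \<eta>\<close> is \<open>\<eta>\<^sup>l\<^sub>x\<close>.\<close>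

definition rescale :: "real \<Rightarrow> real^'d \<Rightarrow> (real^'d \<Rightarrow> real) \<Rightarrow> real^'d::finite \<Rightarrow> real" where
  "rescale l x \<eta> y = \<eta> ((y - x) /\<^sub>R l) / l ^ CARD('d)"

typedef (overloaded) ('d::finite) functional = "UNIV :: ((real^'d \<Rightarrow> real) \<Rightarrow> real) set"
  morphisms pairing Functional by simp

setup_lifting type_definition_functional

instantiation functional :: (finite) real_vector
begin
lift_definition zero_functional :: "'a functional" is "\<lambda>_. 0" .
lift_definition plus_functional :: "'a functional \<Rightarrow> 'a functional \<Rightarrow> 'a functional"
  is "\<lambda>\<xi> \<zeta> \<phi>. \<xi> \<phi> + \<zeta> \<phi>" .
lift_definition minus_functional :: "'a functional \<Rightarrow> 'a functional \<Rightarrow> 'a functional"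
  is "\<lambda>\<xi> \<zeta> \<phi>. \<xi> \<phi> - \<zeta> \<phi>" .
lift_definition uminus_functional :: "'a functional \<Rightarrow> 'a functional"
  is "\<lambda>\<xi> \<phi>. - \<xi> \<phi>" .
lift_definition scaleR_functional :: "real \<Rightarrow> 'a functional \<Rightarrow> 'a functional"
  is "\<lambda>c \<xi> \<phi>. c * \<xi> \<phi>" .
instance
  by standard (transfer; simp add: fun_eq_iff algebra_simps)+
end

text \<open>
  Distributions of order at most \<open>r\<close>: these are the ones that can be tested against the
  functions in \<open>test_functions r\<close>, which are only \<open>r\<close> times differentiable.  A distribution of
  order at most \<open>r\<close> on \<open>C\<^sub>c\<^sup>\<infinity>\<close> extends uniquely to \<open>Crc r\<close>.  Values off \<open>Crc r\<close> are
  fixed as 0, so that equality of distributions is equality in \<open>functional\<close>.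
\<close>

definition distributions :: "nat \<Rightarrow> ('d::finite) functional set" where
  "distributions r = {\<xi>.
     (\<forall>\<phi>\<in>Crc r. \<forall>\<psi>\<in>Crc r. pairing \<xi> (\<lambda>x. \<phi> x + \<psi> x) = pairing \<xi> \<phi> + pairing \<xi> \<psi>) \<and>
     (\<forall>c. \<forall>\<phi>\<in>Crc r. pairing \<xi> (\<lambda>x. c * \<phi> x) = c * pairing \<xi> \<phi>) \<and>
     (\<forall>K. compact K \<longrightarrow>
        (\<exists>C. \<forall>\<phi>\<in>Crc r. supp \<phi> \<subseteq> K \<longrightarrow> \<bar>pairing \<xi> \<phi>\<bar> \<le> C * Cr_norm r \<phi>)) \<and>
     (\<forall>\<phi>. \<phi> \<notin> Crc r \<longrightarrow> pairing \<xi> \<phi> = 0)}"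

section \<open>The polynomial regularity structure\<close>

type_synonym 'd mpoly = "('d \<Rightarrow>\<^sub>0 nat) \<Rightarrow>\<^sub>0 real"

definition mdeg :: "('d::finite \<Rightarrow>\<^sub>0 nat) \<Rightarrow> nat" where
  "mdeg k = (\<Sum>i\<in>UNIV. Poly_Mapping.lookup k i)"

definition mp_eval :: "('d::finite) mpoly \<Rightarrow> real^'d \<Rightarrow> real" where
  "mp_eval Q x = (\<Sum>k\<in>Poly_Mapping.keys Q.
     Poly_Mapping.lookup Q k * (\<Prod>i\<in>UNIV. (x $ i) ^ Poly_Mapping.lookup k i))"

definition mp_const :: "real \<Rightarrow> ('d::finite) mpoly" where
  "mp_const c = Poly_Mapping.single 0 c"

definition mp_var :: "'d::finite \<Rightarrow> 'd mpoly" where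
  "mp_var i = Poly_Mapping.single (Poly_Mapping.single i 1) 1"

text \<open>\<open>mp_translate h Q\<close> is \<open>Q(X + h)\<close>.\<close>

definition mp_translate :: "real^'d \<Rightarrow> 'd mpoly \<Rightarrow> ('d::finite) mpoly" where
  "mp_translate h Q = (\<Sum>k\<in>Poly_Mapping.keys Q. mp_const (Poly_Mapping.lookup Q k) *
     (\<Prod>i\<in>UNIV. (mp_var i + mp_const (h $ i)) ^ Poly_Mapping.lookup k i))"

definition model_Pi :: "real^'d \<Rightarrow> 'd mpoly \<Rightarrow> real^'d::finite \<Rightarrow> real" where
  "model_Pi x Q y = mp_eval Q (y - x)"

definition model_Gamma :: "real^'d \<Rightarrow> real^'d \<Rightarrow> 'd mpoly \<Rightarrow> ('d::finite) mpoly" where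
  "model_Gamma x y Q = mp_translate (x - y) Q"

text \<open>The norm of the component in \<open>T\<^sub>m\<close>; all choices are equivalent, as \<open>T\<^sub>m\<close> has finite dimension.\<close>

definition comp_norm :: "nat \<Rightarrow> ('d::finite) mpoly \<Rightarrow> real" where
  "comp_norm m Q =
     (\<Sum>k\<in>{k\<in>Poly_Mapping.keys Q. mdeg k = m}. \<bar>Poly_Mapping.lookup Q k\<bar>)"

definition ann_test_functions :: "nat \<Rightarrow> nat \<Rightarrow> (real^'d::finite \<Rightarrow> real) set" where
  "ann_test_functions r m = {\<eta>\<in>test_functions r.
     \<forall>Q :: 'd mpoly. (\<forall>k\<in>Poly_Mapping.keys Q. mdeg k \<le> m) \<longrightarrow>
        (\<integral>y. mp_eval Q y * \<eta> y \<partial>lborel) = 0}"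

section \<open>Besov spaces\<close>

text \<open>Powers with exponent \<open>q > 0\<close>.\<close>

definition epowr :: "ennreal \<Rightarrow> real \<Rightarrow> ennreal" where
  "epowr a q = (if a = \<infinity> then \<infinity> else ennreal (enn2real a powr q))"

definition Lp_norm :: "real \<Rightarrow> 'a measure \<Rightarrow> ('a \<Rightarrow> ennreal) \<Rightarrow> ennreal" where
  "Lp_norm p M g = epowr (\<integral>\<^sup>+x. epowr (g x) p \<partial>M) (1 / p)"

lemma Lp_norm_cong_AE:
  "(AE x in M. g x = h x) \<Longrightarrow> Lp_norm p M g = Lp_norm p M h"
  unfolding Lp_norm_def by (rule arg_cong[where f = "\<lambda>a. epowr a (1 / p)"], rule nn_integral_cong_AE) auto

definition L2_scale :: "real measure" where
  "L2_scale = density lborel (\<lambda>l. indicator {0<..<1} l * ennreal (1 / l))"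

definition besov_norm :: "real \<Rightarrow> real \<Rightarrow> nat \<Rightarrow> ('d::finite) functional \<Rightarrow> ennreal" where
  "besov_norm \<gamma> p r \<xi> =
     Lp_norm p lborel (\<lambda>x. SUP \<eta>\<in>test_functions r. ennreal \<bar>pairing \<xi> (rescale 1 x \<eta>)\<bar>) +
     Lp_norm 2 L2_scale (\<lambda>l. Lp_norm p lborel (\<lambda>x.
       SUP \<eta>\<in>ann_test_functions r (nat \<lfloor>\<gamma>\<rfloor>).
         ennreal (\<bar>pairing \<xi> (rescale l x \<eta>)\<bar> / l powr \<gamma>)))"

definition besov :: "real \<Rightarrow> real \<Rightarrow> nat \<Rightarrow> ('d::finite) functional nspace" where
  "besov \<gamma> p r = \<lparr>carr = {\<xi>\<in>distributions r. besov_norm \<gamma> p r \<xi> < \<infinity>},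
     nrm = (\<lambda>\<xi>. enn2real (besov_norm \<gamma> p r \<xi>))\<rparr>"

section \<open>Modelled distributions\<close>

text \<open>Functions into the model space are identified when they agree almost everywhere.\<close>

quotient_type (overloaded) 'd mod_dist =
  "real^'d::finite \<Rightarrow> 'd mpoly" / "\<lambda>f g. AE x in lborel. f x = g x"
  by (intro equivpI reflpI sympI transpI) (auto elim: AE_mp)

instantiation mod_dist :: (finite) real_vector
begin
lift_definition zero_mod_dist :: "'a mod_dist" is "\<lambda>_. 0" .
lift_definition plus_mod_dist :: "'a mod_dist \<Rightarrow> 'a mod_dist \<Rightarrow> 'a mod_dist"
  is "\<lambda>f g x. f x + g x" by (auto elim: AE_mp)
lift_definition minus_mod_dist :: "'a mod_dist \<Rightarrow> 'a mod_dist \<Rightarrow> 'a mod_dist"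
  is "\<lambda>f g x. f x - g x" by (auto elim: AE_mp)
lift_definition uminus_mod_dist :: "'a mod_dist \<Rightarrow> 'a mod_dist"
  is "\<lambda>f x. - f x" by (auto elim: AE_mp)
lift_definition scaleR_mod_dist :: "real \<Rightarrow> 'a mod_dist \<Rightarrow> 'a mod_dist"
  is "\<lambda>c f x. c *\<^sub>R f x" by (auto elim: AE_mp)
instance
  by standard (transfer; simp add: algebra_simps)+
end

lemma AE_lborel_translate:
  fixes h :: "'a::euclidean_space"
  assumes "AE x in lborel. Q x"
  shows "AE x in lborel. Q (x + h)"
proof -
  have "AE x in distr lborel borel ((+) h). Q x"
    using assms by (subst lborel_distr_plus)
  then have "AE x in lborel. Q (h + x)"
    by (intro AE_distrD[where M' = borel and f = "(+) h"]) auto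
  then show ?thesis
    by (simp add: add.commute)
qed

definition mod_dist_fun_norm ::
    "real \<Rightarrow> real \<Rightarrow> (real^'d::finite \<Rightarrow> 'd mpoly) \<Rightarrow> ennreal" where
  "mod_dist_fun_norm \<gamma> p f =
     (\<Sum>m\<in>{m::nat. real m < \<gamma>}. Lp_norm p lborel (\<lambda>x. ennreal (comp_norm m (f x)))) +
     (\<Sum>m\<in>{m::nat. real m < \<gamma>}.
        Lp_norm 2 (density lborel (\<lambda>h. indicator sup_ball h * ennreal (1 / infnorm h ^ CARD('d))))
          (\<lambda>h. Lp_norm p lborel (\<lambda>x.
             ennreal (comp_norm m (f (x + h) - model_Gamma (x + h) x (f x))
               / infnorm h powr (\<gamma> - real m)))))"

lift_definition mod_dist_norm :: "real \<Rightarrow> real \<Rightarrow> ('d::finite) mod_dist \<Rightarrow> ennreal"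
  is mod_dist_fun_norm
proof -
  fix \<gamma> p :: real and f g :: "real^'d \<Rightarrow> 'd mpoly"
  assume fg: "AE x in lborel. f x = g x"
  have "AE x in lborel. f (x + h) = g (x + h)" for h
    using fg by (rule AE_lborel_translate)
  with fg have fgh: "AE x in lborel. f x = g x \<and> f (x + h) = g (x + h)" for h
    by (auto intro: AE_conjI)
  have "AE x in lborel. u (f x) (f (x + h)) x = u (g x) (g (x + h)) x"
    for u :: "'d mpoly \<Rightarrow> 'd mpoly \<Rightarrow> real^'d \<Rightarrow> ennreal" and h
    using fgh[of h] by (rule AE_mp) (rule AE_I2, simp)
  then have "Lp_norm p lborel (\<lambda>x. u (f x) (f (x + h)) x) = Lp_norm p lborel (\<lambda>x. u (g x) (g (x + h)) x)"
    for u :: "'d mpoly \<Rightarrow> 'd mpoly \<Rightarrow> real^'d \<Rightarrow> ennreal" and h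
    by (rule Lp_norm_cong_AE)
  note * = this[where u = "\<lambda>a b x. ennreal (comp_norm m a)" and h = 0 for m]
    this[where u = "\<lambda>a b x. ennreal (comp_norm m (b - model_Gamma (x + h) x a) / c)" and h = h for m h c]
  show "mod_dist_fun_norm \<gamma> p f = mod_dist_fun_norm \<gamma> p g"
    unfolding mod_dist_fun_norm_def * ..
qed

definition modelled_distributions :: "real \<Rightarrow> real \<Rightarrow> ('d::finite) mod_dist nspace" where
  "modelled_distributions \<gamma> p = \<lparr>carr = {abs_mod_dist f | f.
        (\<forall>k. (\<lambda>x. Poly_Mapping.lookup (f x) k) \<in> borel_measurable borel) \<and>
        (\<forall>x. \<forall>k\<in>Poly_Mapping.keys (f x). real (mdeg k) < \<gamma>) \<and>
        mod_dist_fun_norm \<gamma> p f < \<infinity>},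
     nrm = (\<lambda>f. enn2real (mod_dist_norm \<gamma> p f))\<rparr>"

section \<open>Reconstruction\<close>

text \<open>The norm of \<open>(x, l) \<mapsto> sup {|\<langle>\<xi> - \<Pi>\<^sub>x f(x), \<eta>\<^sup>l\<^sub>x\<rangle>| / l\<^sup>\<gamma> | \<eta> \<in> test_functions r}\<close>.\<close>

lift_definition reconstruction_error ::
    "real \<Rightarrow> real \<Rightarrow> nat \<Rightarrow> 'd functional \<Rightarrow> ('d::finite) mod_dist \<Rightarrow> ennreal"
  is "\<lambda>\<gamma> p r \<xi> f. Lp_norm 2 L2_scale (\<lambda>l. Lp_norm p lborel (\<lambda>x.
        SUP \<eta>\<in>test_functions r.
          ennreal (\<bar>pairing \<xi> (rescale l x \<eta>)
            - (\<integral>y. model_Pi x (f x) y * rescale l x \<eta> y \<partial>lborel)\<bar> / l powr \<gamma>)))"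
  by (rule Lp_norm_cong_AE, rule AE_I2, rule Lp_norm_cong_AE, erule AE_mp, rule AE_I2) simp

definition reconstruction_operator ::
    "real \<Rightarrow> real \<Rightarrow> nat \<Rightarrow> (('d::finite) mod_dist \<Rightarrow> 'd functional) \<Rightarrow> bool" where
  "reconstruction_operator \<gamma> p r R \<longleftrightarrow>
     bounded_op (modelled_distributions \<gamma> p) (besov \<gamma> p r) R \<and>
     (\<exists>C. \<forall>f\<in>carr (modelled_distributions \<gamma> p).
        reconstruction_error \<gamma> p r (R f) f
          \<le> ennreal (C * nrm (modelled_distributions \<gamma> p) f))"

end

theory Submission
  imports Defs
begin

text \<open>
  Every object in the definition of a strict solution is built from a normed space by means that
  a continuous linear isomorphism respects.  So the theorem is proved by pushing a solution
  forward along \<open>R\<inverse>\<close>, and along \<open>R\<close> for the converse, with one lemma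
  (\<open>strict_solution_map\<close>) for both directions: if \<open>f\<close> is linear, intertwines the operators,
  and is bounded for the three norms in play (the base space, \<open>D(A)\<close> and \<open>D\<^sub>A(1/2, 2)\<close>),
  then \<open>f\<close> maps strict solutions to strict solutions.  Such an \<open>f\<close> is Borel, hence maps
  progressive and square integrable processes to such processes; it commutes with integrals of
  simple functions and of step processes, and boundedness carries this over to the limits.

  What needs work is that \<open>R\<close> is bounded from \<open>D\<^sub>A(1/2, 2)\<close> of the conjugated operator to that
  of \<open>A\<close>.  Both norms are defined through the semigroup, and the semigroup is only known as
  some semigroup with the given generator.  One has to know that a generator determines its
  semigroup; then the semigroup of \<open>R\<inverse> A R\<close> is \<open>R\<inverse> exp (- t A) R\<close> and the norms
  compare pointwise under the integral.  Uniqueness (\<open>semigroup_unique\<close>) is the classical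
  argument that \<open>s \<mapsto> S (t - s) (T s x)\<close> is constant for \<open>x\<close> in the domain.  The domain is
  dense because the semigroup is analytic: \<open>S t x\<close> lies in it for \<open>t > 0\<close> and tends to
  \<open>x\<close>.

  The uniqueness argument uses a genuine norm.  For modelled distributions this is Minkowski's
  inequality, together with the joint measurability of the increments
  \<open>f (x + h) - \<Gamma> f (x)\<close> (\<open>normed_carrier_modelled_distributions\<close>).  The norm
  of the Besov space, which involves suprema over test functions, is only compared with the one
  transported by \<open>R\<close>; the arguments that rest on the triangle inequality are carried out on the
  side of the modelled distributions.
\<close>

section \<open>Estimates for integrals of non-measurable functions\<close>

text \<open>
  The integrands below involve norms of which measurability is not known, so \<open>nn_integral_cmult\<close>
  does not apply.  As \<open>nn_integral\<close> is a supremum over simple functions below the integrand,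
  scaling these functions gives the bound for arbitrary \<open>g\<close>.
\<close>

lemma nn_integral_cmult_le:
  assumes "0 < c"
  shows "(\<integral>\<^sup>+x. ennreal c * g x \<partial>M) \<le> ennreal c * (\<integral>\<^sup>+x. g x \<partial>M)"
  unfolding nn_integral_def[of M "\<lambda>x. ennreal c * g x"]
proof (safe intro!: SUP_least)
  fix u assume u: "simple_function M u" "u \<le> (\<lambda>x. ennreal c * g x)"
  have "simple_function M (\<lambda>x. ennreal (1 / c) * u x)"
    using u(1) by (intro simple_function_mult) auto
  moreover have "ennreal (1 / c) * u x \<le> g x" for x
  proof -
    have "ennreal (1 / c) * u x \<le> ennreal (1 / c) * (ennreal c * g x)"
      using u(2) by (intro mult_left_mono) (auto simp: le_fun_def)
    also have "\<dots> = g x"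
      using assms by (simp add: mult.assoc[symmetric] ennreal_mult[symmetric])
    finally show ?thesis .
  qed
  ultimately have "integral\<^sup>S M (\<lambda>x. ennreal (1 / c) * u x) \<le> integral\<^sup>N M g"
    unfolding nn_integral_def by (intro SUP_upper) (auto simp: le_fun_def)
  then have "ennreal c * (ennreal (1 / c) * integral\<^sup>S M u) \<le> ennreal c * integral\<^sup>N M g"
    using u(1) by (intro mult_left_mono) auto
  then show "integral\<^sup>S M u \<le> ennreal c * integral\<^sup>N M g"
    using assms by (simp add: mult.assoc[symmetric] ennreal_mult[symmetric])
qed

lemma nn_integral_square_le:
  assumes "0 < C" "AE x in M. \<bar>u x\<bar> \<le> C * v x"
  shows "(\<integral>\<^sup>+x. ennreal ((u x)\<^sup>2) \<partial>M) \<le> ennreal (C\<^sup>2) * (\<integral>\<^sup>+x. ennreal ((v x)\<^sup>2) \<partial>M)"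
proof -
  have "(\<integral>\<^sup>+x. ennreal ((u x)\<^sup>2) \<partial>M) \<le> (\<integral>\<^sup>+x. ennreal (C\<^sup>2) * ennreal ((v x)\<^sup>2) \<partial>M)"
    using assms(2)
  proof (intro nn_integral_mono_AE, eventually_elim)
    case (elim x)
    then have "\<bar>u x\<bar>\<^sup>2 \<le> (C * v x)\<^sup>2" by (intro power_mono) auto
    then show ?case by (simp add: ennreal_mult[symmetric] power_mult_distrib)
  qed
  also have "\<dots> \<le> ennreal (C\<^sup>2) * (\<integral>\<^sup>+x. ennreal ((v x)\<^sup>2) \<partial>M)"
    using assms(1) by (intro nn_integral_cmult_le) auto
  finally show ?thesis .
qed

lemma ennreal_mult_less_top_const:
  "x < \<infinity> \<Longrightarrow> y \<le> ennreal c * x \<Longrightarrow> y < (\<infinity>::ennreal)"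
  by (erule le_less_trans) (simp add: ennreal_mult_less_top)

lemma tendsto_0_of_le_cmult:
  assumes "\<And>k. g k \<le> ennreal c * f k" "(f \<longlongrightarrow> 0) \<F>"
  shows "((g :: 'a \<Rightarrow> ennreal) \<longlongrightarrow> 0) \<F>"
proof (rule tendsto_sandwich[of "\<lambda>_. 0"])
  show "((\<lambda>k. ennreal c * f k) \<longlongrightarrow> 0) \<F>"
    using ennreal_tendsto_cmult[OF _ assms(2), of "ennreal c"] by simp
qed (use assms in auto)

section \<open>Images under bounded linear maps\<close>

text \<open>
  The map is linear on the whole type, which makes commutation with finite sums unconditional.  The
  bound is required on the span because differences of elements of the carrier occur;
  for \<open>D\<^sub>A(1/2, 2)\<close>, defined by a finite integral, these need not obviously belong to the carrier.  The absolute value makes the norm of the source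
  nonnegative on the span.
\<close>

definition bounded_map ::
    "'v::real_vector nspace \<Rightarrow> 'u::real_vector nspace \<Rightarrow> ('v \<Rightarrow> 'u) \<Rightarrow> bool" where
  "bounded_map V U f \<longleftrightarrow> linear f \<and> (\<forall>x\<in>carr V. f x \<in> carr U) \<and>
     (\<exists>C>0. \<forall>x\<in>span (carr V). \<bar>nrm U (f x)\<bar> \<le> C * nrm V x)"

lemma bounded_mapD:
  assumes "bounded_map V U f"
  shows "linear f" "\<And>x. x \<in> carr V \<Longrightarrow> f x \<in> carr U"
  using assms by (auto simp: bounded_map_def)

lemma bounded_map_boundE:
  assumes "bounded_map V U f"
  obtains C where "0 < C" "\<And>x. x \<in> span (carr V) \<Longrightarrow> \<bar>nrm U (f x)\<bar> \<le> C * nrm V x"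
  using assms by (auto simp: bounded_map_def)

lemma space_nborel: "space (nborel V) = carr V"
  unfolding nborel_def by (rule space_measure_of) (auto simp: nopen_def)

lemma nopen_sets_nborel: "nopen V U \<Longrightarrow> U \<in> sets (nborel V)"
  unfolding nborel_def by (subst sets_measure_of) (auto simp: nopen_def)

lemma bounded_map_measurable:
  assumes "bounded_map V U f"
  shows "f \<in> nborel V \<rightarrow>\<^sub>M nborel U"
proof -
  obtain C where C: "0 < C" "\<And>x. x \<in> span (carr V) \<Longrightarrow> \<bar>nrm U (f x)\<bar> \<le> C * nrm V x"
    using assms by (rule bounded_map_boundE) (rule that)
  note f = bounded_mapD[OF assms]
  have "nopen V (f -` G \<inter> carr V)" if G: "nopen U G" for G
    unfolding nopen_def
  proof (intro conjI ballI)
    fix x assume x: "x \<in> f -` G \<inter> carr V"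
    then obtain e where e: "e > 0" "\<And>y. y \<in> carr U \<Longrightarrow> nrm U (y - f x) < e \<Longrightarrow> y \<in> G"
      using G unfolding nopen_def by auto
    show "\<exists>e>0. \<forall>y\<in>carr V. nrm V (y - x) < e \<longrightarrow> y \<in> f -` G \<inter> carr V"
    proof (intro exI[of _ "e / C"] conjI ballI impI)
      fix y assume y: "y \<in> carr V" "nrm V (y - x) < e / C"
      have "y - x \<in> span (carr V)"
        using x y by (auto intro: span_diff span_base)
      then have "\<bar>nrm U (f (y - x))\<bar> \<le> C * nrm V (y - x)" by (rule C(2))
      also have "\<dots> < e" using y C(1) by (simp add: field_simps)
      finally have "nrm U (f y - f x) < e"
        by (simp add: linear_diff[OF f(1)])
      with e(2)[of "f y"] f(2)[OF y(1)] y(1) show "y \<in> f -` G \<inter> carr V" by auto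
    qed (use e C in auto)
  qed auto
  then show ?thesis
    unfolding nborel_def[of U]
    by (intro measurable_measure_of) (auto simp: nopen_def space_nborel f intro: nopen_sets_nborel)
qed

lemma L2_rv_map:
  assumes f: "bounded_map V U f"
    and x: "x \<in> L2_rv V P G" and x': "AE \<omega> in P. x' \<omega> = f (x \<omega>)"
    and space: "space G = space P"
  shows "x' \<in> L2_rv U P G"
proof -
  obtain C where C: "0 < C" "\<And>x. x \<in> span (carr V) \<Longrightarrow> \<bar>nrm U (f x)\<bar> \<le> C * nrm V x"
    using f by (rule bounded_map_boundE) (rule that)
  obtain y where y: "y \<in> G \<rightarrow>\<^sub>M nborel V" "AE \<omega> in P. x \<omega> = y \<omega>"
    "(\<integral>\<^sup>+\<omega>. ennreal ((nrm V (y \<omega>))\<^sup>2) \<partial>P) < \<infinity>"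
    using x unfolding L2_rv_def by blast
  have mem: "y \<omega> \<in> carr V" if "\<omega> \<in> space P" for \<omega>
    using measurable_space[OF y(1)] that space by (auto simp: space_nborel)
  have "(\<integral>\<^sup>+\<omega>. ennreal ((nrm U (f (y \<omega>)))\<^sup>2) \<partial>P)
      \<le> ennreal (C\<^sup>2) * (\<integral>\<^sup>+\<omega>. ennreal ((nrm V (y \<omega>))\<^sup>2) \<partial>P)"
    by (intro nn_integral_square_le C AE_I2 span_base mem)
  then have "(\<integral>\<^sup>+\<omega>. ennreal ((nrm U (f (y \<omega>)))\<^sup>2) \<partial>P) < \<infinity>"
    using y(3) by (rule ennreal_mult_less_top_const[rotated])
  moreover have "(\<lambda>\<omega>. f (y \<omega>)) \<in> G \<rightarrow>\<^sub>M nborel U"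
    by (rule measurable_compose[OF y(1) bounded_map_measurable[OF f]])
  moreover have "AE \<omega> in P. x' \<omega> = f (y \<omega>)"
    using x' y(2) by eventually_elim simp
  ultimately show ?thesis by (auto simp: L2_rv_def)
qed

lemma L2_rv_AE_carr:
  assumes "x \<in> L2_rv V P G" "space G = space P"
  shows "AE \<omega> in P. x \<omega> \<in> carr V"
proof -
  obtain y where y: "y \<in> G \<rightarrow>\<^sub>M nborel V" "AE \<omega> in P. x \<omega> = y \<omega>"
    using assms unfolding L2_rv_def by blast
  from y(2) AE_space show ?thesis
    by eventually_elim (use measurable_space[OF y(1)] assms(2) in \<open>auto simp: space_nborel\<close>)
qed

lemma filtered_space:
  "filtered_prob_space P F T \<Longrightarrow> t \<in> {0..T} \<Longrightarrow> space (F t) = space P"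
  by (auto simp: filtered_prob_space_def subalgebra_def)

lemma progressive_carr:
  assumes "progressive V F T Y" "0 \<le> T" "s \<in> {0..T}" "\<omega> \<in> space (F T)"
  shows "Y s \<omega> \<in> carr V"
proof -
  have m: "(\<lambda>(s, \<omega>). Y s \<omega>) \<in> restrict_space borel {0..T} \<Otimes>\<^sub>M F T \<rightarrow>\<^sub>M nborel V"
    using assms by (auto simp: progressive_def)
  show ?thesis
    using measurable_space[OF m, of "(s, \<omega>)"] assms
    by (auto simp: space_nborel space_pair_measure space_restrict_space)
qed

lemma M2_proc_AE_carr:
  assumes "X \<in> M2_proc V P F T" "0 \<le> T" "space (F T) = space P"
  shows "AE (s, \<omega>) in restrict_space lborel {0..T} \<Otimes>\<^sub>M P. X s \<omega> \<in> carr V"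
proof -
  obtain Y where Y: "progressive V F T Y"
      "AE (s, \<omega>) in restrict_space lborel {0..T} \<Otimes>\<^sub>M P. X s \<omega> = Y s \<omega>"
    using assms unfolding M2_proc_def by blast
  from Y(2) AE_space show ?thesis
    by eventually_elim
      (use progressive_carr[OF Y(1) assms(2)] assms(3) in
        \<open>auto simp: space_pair_measure space_restrict_space\<close>)
qed

lemma M2_proc_map:
  assumes f: "bounded_map V U f"
    and X: "X \<in> M2_proc V P F T"
    and X': "AE (s, \<omega>) in restrict_space lborel {0..T} \<Otimes>\<^sub>M P. X' s \<omega> = f (X s \<omega>)"
    and T: "0 \<le> T" "space (F T) = space P"
  shows "X' \<in> M2_proc U P F T"
proof -
  obtain C where C: "0 < C" "\<And>x. x \<in> span (carr V) \<Longrightarrow> \<bar>nrm U (f x)\<bar> \<le> C * nrm V x"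
    using f by (rule bounded_map_boundE) (rule that)
  let ?M = "restrict_space lborel {0..T} \<Otimes>\<^sub>M P"
  obtain Y where Y: "progressive V F T Y" "AE (s, \<omega>) in ?M. X s \<omega> = Y s \<omega>"
      "(\<integral>\<^sup>+(s, \<omega>). ennreal ((nrm V (Y s \<omega>))\<^sup>2) \<partial>?M) < \<infinity>"
    using X unfolding M2_proc_def by blast
  have "(\<integral>\<^sup>+z. ennreal ((nrm U (f (Y (fst z) (snd z))))\<^sup>2) \<partial>?M)
      \<le> ennreal (C\<^sup>2) * (\<integral>\<^sup>+z. ennreal ((nrm V (Y (fst z) (snd z)))\<^sup>2) \<partial>?M)"
    by (intro nn_integral_square_le C AE_I2 span_base)
      (use progressive_carr[OF Y(1) T(1)] T(2) in
        \<open>auto simp: space_pair_measure space_restrict_space\<close>)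
  then have "(\<integral>\<^sup>+z. ennreal ((nrm U (f (Y (fst z) (snd z))))\<^sup>2) \<partial>?M) < \<infinity>"
    using Y(3)[unfolded case_prod_beta] by (rule ennreal_mult_less_top_const[rotated])
  moreover have "progressive U F T (\<lambda>s \<omega>. f (Y s \<omega>))"
    unfolding progressive_def
  proof
    fix t assume "t \<in> {0..T}"
    then have "(\<lambda>(s, \<omega>). Y s \<omega>) \<in> restrict_space borel {0..t} \<Otimes>\<^sub>M F t \<rightarrow>\<^sub>M nborel V"
      using Y(1) by (auto simp: progressive_def)
    from measurable_compose[OF this bounded_map_measurable[OF f]]
    show "(\<lambda>(s, \<omega>). f (Y s \<omega>)) \<in> restrict_space borel {0..t} \<Otimes>\<^sub>M F t \<rightarrow>\<^sub>M nborel U"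
      by (simp add: case_prod_beta)
  qed
  moreover have "AE (s, \<omega>) in ?M. X' s \<omega> = f (Y s \<omega>)"
    using X' Y(2) by eventually_elim auto
  ultimately show ?thesis
    unfolding M2_proc_def by (intro CollectI exI[of _ "\<lambda>s \<omega>. f (Y s \<omega>)"]) (auto simp: case_prod_unfold)
qed

lemma C_L2_proc_map:
  assumes f: "bounded_map V U f"
    and X: "X \<in> C_L2_proc V P T"
    and X': "\<And>t \<omega>. t \<in> {0..T} \<Longrightarrow> \<omega> \<in> space P \<Longrightarrow> X' t \<omega> = f (X t \<omega>)"
  shows "X' \<in> C_L2_proc U P T"
proof -
  obtain C where C: "0 < C" "\<And>x. x \<in> span (carr V) \<Longrightarrow> \<bar>nrm U (f x)\<bar> \<le> C * nrm V x"
    using f by (rule bounded_map_boundE) (rule that)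
  have L2: "X t \<in> L2_rv V P P" if "t \<in> {0..T}" for t
    using X that by (auto simp: C_L2_proc_def)
  have "X' t \<in> L2_rv U P P" if "t \<in> {0..T}" for t
    by (rule L2_rv_map[OF f L2[OF that]]) (use X'[OF that] in auto)
  moreover have "((\<lambda>s. \<integral>\<^sup>+\<omega>. ennreal ((nrm U (X' s \<omega> - X' t \<omega>))\<^sup>2) \<partial>P) \<longlongrightarrow> 0)
        (at t within {0..T})" if t: "t \<in> {0..T}" for t
  proof (rule tendsto_sandwich[of "\<lambda>_. 0"])
    show "((\<lambda>s. ennreal (C\<^sup>2) * (\<integral>\<^sup>+\<omega>. ennreal ((nrm V (X s \<omega> - X t \<omega>))\<^sup>2) \<partial>P)) \<longlongrightarrow> 0)
        (at t within {0..T})"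
      using ennreal_tendsto_cmult[of "ennreal (C\<^sup>2)"] X t unfolding C_L2_proc_def by fastforce
    show "\<forall>\<^sub>F s in at t within {0..T}. (\<integral>\<^sup>+\<omega>. ennreal ((nrm U (X' s \<omega> - X' t \<omega>))\<^sup>2) \<partial>P)
       \<le> ennreal (C\<^sup>2) * (\<integral>\<^sup>+\<omega>. ennreal ((nrm V (X s \<omega> - X t \<omega>))\<^sup>2) \<partial>P)"
    proof (rule eventually_at_topological[THEN iffD2], intro exI[of _ UNIV] conjI ballI impI)
      fix s assume s: "s \<in> {0..T}"
      have "AE \<omega> in P. X s \<omega> \<in> carr V" "AE \<omega> in P. X t \<omega> \<in> carr V"
        using L2_rv_AE_carr[OF L2] s t by auto
      with AE_space have "AE \<omega> in P. \<bar>nrm U (X' s \<omega> - X' t \<omega>)\<bar> \<le> C * nrm V (X s \<omega> - X t \<omega>)"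
      proof eventually_elim
        case (elim \<omega>)
        then have "X s \<omega> - X t \<omega> \<in> span (carr V)" by (intro span_diff span_base)
        from C(2)[OF this] elim s t show ?case
          by (simp add: X' linear_diff[OF bounded_mapD(1)[OF f]])
      qed
      with C(1) show "(\<integral>\<^sup>+\<omega>. ennreal ((nrm U (X' s \<omega> - X' t \<omega>))\<^sup>2) \<partial>P)
       \<le> ennreal (C\<^sup>2) * (\<integral>\<^sup>+\<omega>. ennreal ((nrm V (X s \<omega> - X t \<omega>))\<^sup>2) \<partial>P)"
        by (rule nn_integral_square_le)
    qed auto
  qed auto
  ultimately show ?thesis by (auto simp: C_L2_proc_def)
qed

text \<open>
  Simple functions approximating the integrand are mapped to simple functions, on which the integral
  commutes with \<open>f\<close> by linearity; boundedness passes to the limit.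
\<close>

lemma has_bochner_integral_in_map:
  assumes f: "bounded_map V U f" and V: "subspace (carr V)"
    and I: "has_bochner_integral_in V M g I" and g': "AE x in M. g' x = f (g x)"
  shows "has_bochner_integral_in U M g' (f I)"
proof -
  obtain C where C: "0 < C" "\<And>x. x \<in> span (carr V) \<Longrightarrow> \<bar>nrm U (f x)\<bar> \<le> C * nrm V x"
    using f by (rule bounded_map_boundE) (rule that)
  note lin = bounded_mapD(1)[OF f]
  obtain h s where h: "h \<in> M \<rightarrow>\<^sub>M nborel V" "AE x in M. g x = h x"
    and s: "\<And>k. Bochner_Integration.simple_bochner_integrable M (s k)"
      "\<And>k x. x \<in> space M \<Longrightarrow> s k x \<in> carr V"
    and lim: "(\<lambda>k. \<integral>\<^sup>+x. ennreal (nrm V (h x - s k x)) \<partial>M) \<longlonglongrightarrow> 0"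
      "(\<lambda>k. nrm V (Bochner_Integration.simple_bochner_integral M (s k) - I)) \<longlonglongrightarrow> 0"
    and I: "I \<in> carr V"
    using I unfolding has_bochner_integral_in_def by blast
  have hV: "h x \<in> carr V" if "x \<in> space M" for x
    using measurable_space[OF h(1) that] by (simp add: space_nborel)
  have int: "Bochner_Integration.simple_bochner_integrable M (\<lambda>x. f (s k x))" for k
    using simple_bochner_integrable_compose2[OF _ s(1) s(1), of "\<lambda>x y. f x"]
    by (simp add: linear_0[OF lin])
  have sI: "Bochner_Integration.simple_bochner_integral M (\<lambda>x. f (s k x))
      = f (Bochner_Integration.simple_bochner_integral M (s k))" for k
    by (rule simple_bochner_integral_linear[OF lin s(1)])
  have siV: "Bochner_Integration.simple_bochner_integral M (s k) \<in> carr V" for k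
    unfolding simple_bochner_integral_def
    using s(2) by (intro subspace_sum[OF V] subspace_scale[OF V]) auto
  have "(\<lambda>k. \<integral>\<^sup>+x. ennreal (nrm U (f (h x) - f (s k x))) \<partial>M) \<longlonglongrightarrow> 0"
  proof (rule tendsto_0_of_le_cmult[OF _ lim(1)])
    fix k
    have "(\<integral>\<^sup>+x. ennreal (nrm U (f (h x) - f (s k x))) \<partial>M)
        \<le> (\<integral>\<^sup>+x. ennreal C * ennreal (nrm V (h x - s k x)) \<partial>M)"
    proof (intro nn_integral_mono)
      fix x assume x: "x \<in> space M"
      have "\<bar>nrm U (f (h x - s k x))\<bar> \<le> C * nrm V (h x - s k x)"
        using hV[OF x] s(2)[OF x] by (intro C(2) span_diff span_base)
      then show "ennreal (nrm U (f (h x) - f (s k x))) \<le> ennreal C * ennreal (nrm V (h x - s k x))"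
        using C(1) by (subst ennreal_mult'[symmetric]) (auto simp: linear_diff[OF lin] intro!: ennreal_leI)
    qed
    also have "\<dots> \<le> ennreal C * (\<integral>\<^sup>+x. ennreal (nrm V (h x - s k x)) \<partial>M)"
      by (rule nn_integral_cmult_le[OF C(1)])
    finally show "(\<integral>\<^sup>+x. ennreal (nrm U (f (h x) - f (s k x))) \<partial>M)
        \<le> ennreal C * (\<integral>\<^sup>+x. ennreal (nrm V (h x - s k x)) \<partial>M)" .
  qed
  moreover have "(\<lambda>k. nrm U (Bochner_Integration.simple_bochner_integral M (\<lambda>x. f (s k x)) - f I)) \<longlonglongrightarrow> 0"
  proof (rule Lim_null_comparison)
    show "\<forall>\<^sub>F k in sequentially. norm (nrm U (Bochner_Integration.simple_bochner_integral M (\<lambda>x. f (s k x)) - f I))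
        \<le> C * nrm V (Bochner_Integration.simple_bochner_integral M (s k) - I)"
    proof (intro always_eventually allI)
      fix k
      have "\<bar>nrm U (f (Bochner_Integration.simple_bochner_integral M (s k) - I))\<bar>
        \<le> C * nrm V (Bochner_Integration.simple_bochner_integral M (s k) - I)"
        using siV I by (intro C(2) span_diff span_base)
      then show "norm (nrm U (Bochner_Integration.simple_bochner_integral M (\<lambda>x. f (s k x)) - f I))
        \<le> C * nrm V (Bochner_Integration.simple_bochner_integral M (s k) - I)"
        by (simp add: sI linear_diff[OF lin])
    qed
    show "(\<lambda>k. C * nrm V (Bochner_Integration.simple_bochner_integral M (s k) - I)) \<longlonglongrightarrow> 0"
      using tendsto_mult_left[OF lim(2), of C] by simp
  qed
  moreover have "(\<lambda>x. f (h x)) \<in> M \<rightarrow>\<^sub>M nborel U"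
    by (rule measurable_compose[OF h(1) bounded_map_measurable[OF f]])
  moreover have "AE x in M. g' x = f (h x)"
    using g' h(2) by eventually_elim simp
  ultimately show ?thesis
    unfolding has_bochner_integral_in_def using int s(2) I bounded_mapD(2)[OF f]
    by (intro conjI exI[of _ "\<lambda>x. f (h x)"] exI[of _ "\<lambda>k x. f (s k x)"]) auto
qed

text \<open>
  The images of the approximating step processes are step processes again, with image coefficients.
  The integrator \<open>w\<close> contributes scalar increments, which \<open>f\<close> passes over by linearity.
\<close>

lemma has_stochastic_integral_map:
  assumes f: "bounded_map V U f" and V: "subspace (carr V)"
    and J: "has_stochastic_integral V P F w t \<Phi> J"
    and \<Phi>': "AE (s, \<omega>) in restrict_space lborel {0..t} \<Otimes>\<^sub>M P. \<Phi>' s \<omega> = f (\<Phi> s \<omega>)"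
    and t: "0 \<le> t" "\<And>s. s \<in> {0..t} \<Longrightarrow> space (F s) = space P"
  shows "has_stochastic_integral U P F w t \<Phi>' (\<lambda>\<omega>. f (J \<omega>))"
proof -
  obtain C where C: "0 < C" "\<And>x. x \<in> span (carr V) \<Longrightarrow> \<bar>nrm U (f x)\<bar> \<le> C * nrm V x"
    using f by (rule bounded_map_boundE) (rule that)
  note lin = bounded_mapD(1)[OF f]
  let ?M = "restrict_space lborel {0..t} \<Otimes>\<^sub>M P"
  obtain m \<tau> a where \<Phi>: "\<Phi> \<in> M2_proc V P F t" and JL: "J \<in> L2_rv V P (F t)"
    and step: "\<And>k. step_data V P F t (m k) (\<tau> k) (a k)"
    and lim: "(\<lambda>k. \<integral>\<^sup>+(s, \<omega>). ennreal ((nrm V (step_process (m k) (\<tau> k) (a k) s \<omega> - \<Phi> s \<omega>))\<^sup>2) \<partial>?M) \<longlonglongrightarrow> 0"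
      "(\<lambda>k. \<integral>\<^sup>+\<omega>. ennreal ((nrm V (step_integral w (m k) (\<tau> k) (a k) \<omega> - J \<omega>))\<^sup>2) \<partial>P) \<longlonglongrightarrow> 0"
    using J unfolding has_stochastic_integral_def by blast
  let ?a = "\<lambda>k j \<omega>. f (a k j \<omega>)"
  have sp: "step_process (m k) (\<tau> k) (?a k) s \<omega> = f (step_process (m k) (\<tau> k) (a k) s \<omega>)" for k s \<omega>
    by (simp add: step_process_def linear_sum[OF lin] linear_cmul[OF lin])
  have si: "step_integral w (m k) (\<tau> k) (?a k) \<omega> = f (step_integral w (m k) (\<tau> k) (a k) \<omega>)" for k \<omega>
    by (simp add: step_integral_def linear_sum[OF lin] linear_cmul[OF lin])
  have aV: "a k j \<omega> \<in> carr V" if "j < m k" "\<omega> \<in> space P" for k j \<omega>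
  proof -
    have "a k j \<in> F (\<tau> k j) \<rightarrow>\<^sub>M nborel V" "\<tau> k j \<in> {0..t}"
      using step[of k] that by (auto simp: step_data_def)
    from measurable_space[OF this(1)] t(2)[OF this(2)] that show ?thesis
      by (auto simp: space_nborel)
  qed
  have "step_data U P F t (m k) (\<tau> k) (?a k)" for k
    unfolding step_data_def
  proof (intro conjI allI impI)
    fix j assume j: "j < m k"
    then have a: "a k j \<in> F (\<tau> k j) \<rightarrow>\<^sub>M nborel V"
        "(\<integral>\<^sup>+\<omega>. ennreal ((nrm V (a k j \<omega>))\<^sup>2) \<partial>P) < \<infinity>"
      using step[of k] by (auto simp: step_data_def)
    show "?a k j \<in> F (\<tau> k j) \<rightarrow>\<^sub>M nborel U"
      by (rule measurable_compose[OF a(1) bounded_map_measurable[OF f]])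
    have "(\<integral>\<^sup>+\<omega>. ennreal ((nrm U (?a k j \<omega>))\<^sup>2) \<partial>P)
        \<le> ennreal (C\<^sup>2) * (\<integral>\<^sup>+\<omega>. ennreal ((nrm V (a k j \<omega>))\<^sup>2) \<partial>P)"
      using aV[OF j] by (intro nn_integral_square_le C AE_I2 span_base)
    then show "(\<integral>\<^sup>+\<omega>. ennreal ((nrm U (?a k j \<omega>))\<^sup>2) \<partial>P) < \<infinity>"
      using a(2) by (rule ennreal_mult_less_top_const[rotated])
  qed (use step[of k] in \<open>auto simp: step_data_def\<close>)
  moreover have "(\<lambda>k. \<integral>\<^sup>+(s, \<omega>). ennreal ((nrm U (step_process (m k) (\<tau> k) (?a k) s \<omega> - \<Phi>' s \<omega>))\<^sup>2) \<partial>?M) \<longlonglongrightarrow> 0"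
  proof (rule tendsto_0_of_le_cmult[OF _ lim(1)])
    fix k
    have "AE (s, \<omega>) in ?M. \<Phi> s \<omega> \<in> carr V"
      by (rule M2_proc_AE_carr[OF \<Phi>]) (use t in auto)
    with \<Phi>' AE_space
    have "AE z in ?M. \<bar>nrm U (step_process (m k) (\<tau> k) (?a k) (fst z) (snd z) - \<Phi>' (fst z) (snd z))\<bar>
         \<le> C * nrm V (step_process (m k) (\<tau> k) (a k) (fst z) (snd z) - \<Phi> (fst z) (snd z))"
    proof eventually_elim
      case (elim z)
      then have z: "snd z \<in> space P" "\<Phi>' (fst z) (snd z) = f (\<Phi> (fst z) (snd z))"
          "\<Phi> (fst z) (snd z) \<in> carr V"
        by (auto simp: space_pair_measure)
      have "step_process (m k) (\<tau> k) (a k) (fst z) (snd z) \<in> carr V"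
        unfolding step_process_def using aV z(1)
        by (intro subspace_sum[OF V] subspace_scale[OF V]) auto
      then have "step_process (m k) (\<tau> k) (a k) (fst z) (snd z) - \<Phi> (fst z) (snd z) \<in> span (carr V)"
        using z(3) by (intro span_diff span_base)
      from C(2)[OF this] show ?case by (simp add: sp z(2) linear_diff[OF lin])
    qed
    from nn_integral_square_le[OF C(1) this]
    show "(\<integral>\<^sup>+(s, \<omega>). ennreal ((nrm U (step_process (m k) (\<tau> k) (?a k) s \<omega> - \<Phi>' s \<omega>))\<^sup>2) \<partial>?M)
       \<le> ennreal (C\<^sup>2) * (\<integral>\<^sup>+(s, \<omega>). ennreal ((nrm V (step_process (m k) (\<tau> k) (a k) s \<omega> - \<Phi> s \<omega>))\<^sup>2) \<partial>?M)"
      by (simp add: case_prod_unfold)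
  qed
  moreover have "(\<lambda>k. \<integral>\<^sup>+\<omega>. ennreal ((nrm U (step_integral w (m k) (\<tau> k) (?a k) \<omega> - f (J \<omega>)))\<^sup>2) \<partial>P) \<longlonglongrightarrow> 0"
  proof (rule tendsto_0_of_le_cmult[OF _ lim(2)])
    fix k
    have "AE \<omega> in P. J \<omega> \<in> carr V"
      by (rule L2_rv_AE_carr[OF JL]) (use t in auto)
    with AE_space
    have "AE \<omega> in P. \<bar>nrm U (step_integral w (m k) (\<tau> k) (?a k) \<omega> - f (J \<omega>))\<bar>
         \<le> C * nrm V (step_integral w (m k) (\<tau> k) (a k) \<omega> - J \<omega>)"
    proof eventually_elim
      case (elim \<omega>)
      have "step_integral w (m k) (\<tau> k) (a k) \<omega> \<in> carr V"
        unfolding step_integral_def using aV elim(1)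
        by (intro subspace_sum[OF V] subspace_scale[OF V]) auto
      then have "step_integral w (m k) (\<tau> k) (a k) \<omega> - J \<omega> \<in> span (carr V)"
        using elim(2) by (intro span_diff span_base)
      from C(2)[OF this] show ?case by (simp add: si linear_diff[OF lin])
    qed
    from nn_integral_square_le[OF C(1) this]
    show "(\<integral>\<^sup>+\<omega>. ennreal ((nrm U (step_integral w (m k) (\<tau> k) (?a k) \<omega> - f (J \<omega>)))\<^sup>2) \<partial>P)
       \<le> ennreal (C\<^sup>2) * (\<integral>\<^sup>+\<omega>. ennreal ((nrm V (step_integral w (m k) (\<tau> k) (a k) \<omega> - J \<omega>))\<^sup>2) \<partial>P)" .
  qed
  moreover have "\<Phi>' \<in> M2_proc U P F t"
    by (rule M2_proc_map[OF f \<Phi> \<Phi>']) (use t in auto)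
  moreover have "(\<lambda>\<omega>. f (J \<omega>)) \<in> L2_rv U P (F t)"
    by (rule L2_rv_map[OF f JL]) (use t in auto)
  ultimately show ?thesis
    unfolding has_stochastic_integral_def by (intro conjI exI[of _ m] exI[of _ \<tau>] exI[of _ ?a]) auto
qed


text \<open>
  Integrals in time are taken pathwise, whereas the exceptional sets live in the product of time and
  probability space.
\<close>

lemma AE_pair_section2:
  assumes "sigma_finite_measure M" "sigma_finite_measure N"
    and "AE (x, y) in M \<Otimes>\<^sub>M N. Q x y"
  shows "AE y in N. AE x in M. Q x y"
proof -
  interpret pair_sigma_finite M N using assms by (simp add: pair_sigma_finite_def)
  interpret swap: pair_sigma_finite N M ..
  have "AE z in distr (N \<Otimes>\<^sub>M M) (M \<Otimes>\<^sub>M N) (\<lambda>(x, y). (y, x)). Q (fst z) (snd z)"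
    using assms(3) by (subst distr_pair_swap[symmetric]) (simp add: case_prod_unfold)
  from AE_distrD[OF measurable_pair_swap' this]
  have "AE z in N \<Otimes>\<^sub>M M. Q (snd z) (fst z)"
    by (simp add: case_prod_unfold)
  from swap.AE_pair[OF this] show ?thesis by simp
qed

lemma sigma_finite_lborel_interval: "sigma_finite_measure (restrict_space lborel {0..t::real})"
  by (rule sigma_finite_measure_restrict_space) (auto intro: lborel.sigma_finite_measure_axioms)

lemma AE_lborel_interval_mono:
  assumes "t \<le> T" "AE s in restrict_space lborel {0..T::real}. Q s"
  shows "AE s in restrict_space lborel {0..t}. Q s"
  using assms(2) assms(1) by (subst (asm) AE_restrict_space_iff; simp add: AE_restrict_space_iff) (auto elim: AE_mp)

lemma AE_pair_interval_mono:
  assumes "t \<le> T" "sigma_finite_measure P"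
    and "AE (s, \<omega>) in restrict_space lborel {0..T::real} \<Otimes>\<^sub>M P. Q s \<omega>"
  shows "AE (s, \<omega>) in restrict_space lborel {0..t} \<Otimes>\<^sub>M P. Q s \<omega>"
proof -
  let ?L = "\<lambda>t. restrict_space lborel {0..t::real}"
  interpret T: pair_sigma_finite "?L T" P
    using assms(2) sigma_finite_lborel_interval by (simp add: pair_sigma_finite_def)
  interpret t: pair_sigma_finite "?L t" P
    using assms(2) sigma_finite_lborel_interval by (simp add: pair_sigma_finite_def)
  obtain N where N: "N \<in> null_sets (?L T \<Otimes>\<^sub>M P)"
      "{z \<in> space (?L T \<Otimes>\<^sub>M P). \<not> (case z of (s, \<omega>) \<Rightarrow> Q s \<omega>)} \<subseteq> N"
    using assms(3) by (auto simp: eventually_ae_filter)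
  have "AE z in ?L T \<Otimes>\<^sub>M P. z \<notin> N"
    using N(1) by (rule AE_not_in)
  then have "AE s in ?L T. AE \<omega> in P. (s, \<omega>) \<notin> N"
    by (rule T.AE_pair)
  \<comment> \<open>A null set of the product is null in almost every section, and sections restrict to \<open>{0..t}\<close>.\<close>
  then have sec: "AE s in ?L t. AE \<omega> in P. (s, \<omega>) \<notin> N"
    by (rule AE_lborel_interval_mono[OF assms(1)])
  have "(\<lambda>s. s) \<in> ?L t \<rightarrow>\<^sub>M ?L T"
    using assms(1) by (intro measurable_restrict_space2 measurable_restrict_space1) (auto simp: space_restrict_space)
  then have "(\<lambda>z. (fst z, snd z)) \<in> ?L t \<Otimes>\<^sub>M P \<rightarrow>\<^sub>M ?L T \<Otimes>\<^sub>M P"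
    by (intro measurable_Pair measurable_compose[OF measurable_fst]) auto
  from measurable_sets[OF this, of N] have "N \<inter> space (?L t \<Otimes>\<^sub>M P) \<in> sets (?L t \<Otimes>\<^sub>M P)"
    using N(1) by auto
  then have "space (?L t \<Otimes>\<^sub>M P) - N \<inter> space (?L t \<Otimes>\<^sub>M P) \<in> sets (?L t \<Otimes>\<^sub>M P)"
    by (rule sets.compl_sets)
  also have "space (?L t \<Otimes>\<^sub>M P) - N \<inter> space (?L t \<Otimes>\<^sub>M P) = {z \<in> space (?L t \<Otimes>\<^sub>M P). z \<notin> N}"
    by blast
  finally have "{z \<in> space (?L t \<Otimes>\<^sub>M P). z \<notin> N} \<in> sets (?L t \<Otimes>\<^sub>M P)" .
  from t.AE_pair_measure[OF this sec] AE_space show ?thesis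
  proof eventually_elim
    case (elim z)
    moreover from elim(2) assms(1) have "z \<in> space (?L T \<Otimes>\<^sub>M P)"
      by (auto simp: space_pair_measure space_restrict_space)
    ultimately show ?case using N(2) by auto
  qed
qed

text \<open>
  The intertwining relations are only required on \<open>op_dom A\<close>: this suffices because the process
  takes values there for almost every time and path.
\<close>

lemma strict_solution_map:
  assumes P: "filtered_prob_space P F T" "0 < T"
    and f: "bounded_map V U f" and V: "subspace (carr V)"
    and fD: "bounded_map (domain_space V A) (domain_space U A') f"
    and fH: "bounded_map (DA_half V A) (DA_half U A') f"
    and A': "\<And>x. x \<in> op_dom A \<Longrightarrow> op_app A' (f x) = f (op_app A x)"
    and B': "\<And>i x. i \<in> {1..n} \<Longrightarrow> x \<in> op_dom A \<Longrightarrow> op_app (B' i) (f x) = f (op_app (B i) x)"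
    and Z': "AE (s, \<omega>) in restrict_space lborel {0..T} \<Otimes>\<^sub>M P. Z' s \<omega> = f (Z s \<omega>)"
    and x0': "AE \<omega> in P. x0' \<omega> = f (x0 \<omega>)"
    and X': "\<And>t \<omega>. t \<in> {0..T} \<Longrightarrow> \<omega> \<in> space P \<Longrightarrow> X' t \<omega> = f (X t \<omega>)"
    and sol: "strict_solution V P F T n W A Z B x0 X"
  shows "strict_solution U P F T n W A' Z' B' x0' X'"
  unfolding strict_solution_def
proof (intro conjI ballI)
  let ?L = "\<lambda>t. restrict_space lborel {0..t::real}"
  note lin = bounded_mapD(1)[OF f]
  have sP: "sigma_finite_measure P"
    using P by (auto simp: filtered_prob_space_def intro: prob_space_imp_sigma_finite)
  note FP = filtered_space[OF P(1)]
  have X: "X \<in> M2_proc (domain_space V A) P F T" "X \<in> C_L2_proc (DA_half V A) P T"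
    using sol by (auto simp: strict_solution_def Z_space_def)
  have X'f: "AE (s, \<omega>) in ?L T \<Otimes>\<^sub>M P. X' s \<omega> = f (X s \<omega>)"
    by (rule AE_I2) (use X' in \<open>auto simp: space_pair_measure space_restrict_space\<close>)
  show "X' \<in> Z_space U P F T A'"
    unfolding Z_space_def
    using M2_proc_map[OF fD X(1) X'f] C_L2_proc_map[OF fH X(2) X'] P(2) FP by auto
  have dom: "AE (s, \<omega>) in ?L T \<Otimes>\<^sub>M P. X s \<omega> \<in> op_dom A"
    using M2_proc_AE_carr[OF X(1)] P(2) FP by (simp add: domain_space_def)
  fix t assume t: "t \<in> {0..T}"
  then have tT: "t \<le> T" by simp
  obtain IA IZ J where
    IA: "AE \<omega> in P. has_bochner_integral_in V (?L t) (\<lambda>s. op_app A (X s \<omega>)) (IA \<omega>)" and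
    IZ: "AE \<omega> in P. has_bochner_integral_in V (?L t) (\<lambda>s. Z s \<omega>) (IZ \<omega>)" and
    J: "\<And>i. i \<in> {1..n} \<Longrightarrow>
          has_stochastic_integral V P F (W i) t (\<lambda>s \<omega>. op_app (B i) (X s \<omega>)) (J i)" and
    eq: "AE \<omega> in P. X t \<omega> + IA \<omega> = x0 \<omega> + (\<Sum>i=1..n. J i \<omega>) + IZ \<omega>"
    using sol t unfolding strict_solution_def by blast
  have "AE (s, \<omega>) in ?L T \<Otimes>\<^sub>M P. op_app A' (X' s \<omega>) = f (op_app A (X s \<omega>))"
    using X'f dom by eventually_elim (auto simp: A')
  from AE_pair_section2[OF sigma_finite_lborel_interval sP AE_pair_interval_mono[OF tT sP this]] IA
  have "AE \<omega> in P. has_bochner_integral_in U (?L t) (\<lambda>s. op_app A' (X' s \<omega>)) (f (IA \<omega>))"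
    by eventually_elim (rule has_bochner_integral_in_map[OF f V])
  moreover
  from AE_pair_section2[OF sigma_finite_lborel_interval sP AE_pair_interval_mono[OF tT sP Z']] IZ
  have "AE \<omega> in P. has_bochner_integral_in U (?L t) (\<lambda>s. Z' s \<omega>) (f (IZ \<omega>))"
    by eventually_elim (rule has_bochner_integral_in_map[OF f V])
  moreover have "has_stochastic_integral U P F (W i) t (\<lambda>s \<omega>. op_app (B' i) (X' s \<omega>)) (\<lambda>\<omega>. f (J i \<omega>))"
    if i: "i \<in> {1..n}" for i
  proof (rule has_stochastic_integral_map[OF f V J[OF i]])
    have "AE (s, \<omega>) in ?L T \<Otimes>\<^sub>M P. op_app (B' i) (X' s \<omega>) = f (op_app (B i) (X s \<omega>))"
      using X'f dom by eventually_elim (use B'[OF i] in auto)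
    from AE_pair_interval_mono[OF tT sP this]
    show "AE (s, \<omega>) in ?L t \<Otimes>\<^sub>M P. op_app (B' i) (X' s \<omega>) = f (op_app (B i) (X s \<omega>))" .
  qed (use t FP in auto)
  moreover from eq x0' AE_space
  have "AE \<omega> in P. X' t \<omega> + f (IA \<omega>) = x0' \<omega> + (\<Sum>i=1..n. f (J i \<omega>)) + f (IZ \<omega>)"
  proof eventually_elim
    case (elim \<omega>)
    then have "f (X t \<omega> + IA \<omega>) = f (x0 \<omega> + (\<Sum>i=1..n. J i \<omega>) + IZ \<omega>)" by simp
    then have "f (X t \<omega>) + f (IA \<omega>) = f (x0 \<omega>) + (\<Sum>i=1..n. f (J i \<omega>)) + f (IZ \<omega>)"
      by (simp only: linear_add[OF lin] linear_sum[OF lin])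
    with elim t show ?case by (simp add: X')
  qed
  ultimately show "\<exists>IA IZ J.
        (AE \<omega> in P. has_bochner_integral_in U (?L t) (\<lambda>s. op_app A' (X' s \<omega>)) (IA \<omega>)) \<and>
        (AE \<omega> in P. has_bochner_integral_in U (?L t) (\<lambda>s. Z' s \<omega>) (IZ \<omega>)) \<and>
        (\<forall>i\<in>{1..n}. has_stochastic_integral U P F (W i) t (\<lambda>s \<omega>. op_app (B' i) (X' s \<omega>)) (J i)) \<and>
        (AE \<omega> in P. X' t \<omega> + IA \<omega> = x0' \<omega> + (\<Sum>i=1..n. J i \<omega>) + IZ \<omega>)"
    by (intro exI[of _ "\<lambda>\<omega>. f (IA \<omega>)"] exI[of _ "\<lambda>\<omega>. f (IZ \<omega>)"] exI[of _ "\<lambda>i \<omega>. f (J i \<omega>)"] conjI ballI)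
qed

section \<open>Semigroups and their generators\<close>

text \<open>
  The setting for the uniqueness of semigroups.  It is realised by the modelled distributions.
\<close>

locale normed_carrier =
  fixes V :: "'v::real_vector nspace"
  assumes subspace_carr: "subspace (carr V)"
    and nrm_nonneg: "x \<in> carr V \<Longrightarrow> 0 \<le> nrm V x"
    and nrm_triangle: "x \<in> carr V \<Longrightarrow> y \<in> carr V \<Longrightarrow> nrm V (x + y) \<le> nrm V x + nrm V y"
    and nrm_scaleR: "x \<in> carr V \<Longrightarrow> nrm V (c *\<^sub>R x) = \<bar>c\<bar> * nrm V x"
    and nrm_eq_0D: "x \<in> carr V \<Longrightarrow> nrm V x = 0 \<Longrightarrow> x = 0"
begin

lemmas carr_add = subspace_add[OF subspace_carr]
  and carr_diff = subspace_diff[OF subspace_carr]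
  and carr_scaleR = subspace_scale[OF subspace_carr]
  and carr_0 = subspace_0[OF subspace_carr]

lemma nrm_0: "nrm V 0 = 0"
  using nrm_scaleR[OF carr_0, of 0] by simp

lemma nrm_minus_commute: "x \<in> carr V \<Longrightarrow> y \<in> carr V \<Longrightarrow> nrm V (x - y) = nrm V (y - x)"
  using nrm_scaleR[of "x - y" "-1"] carr_diff by simp

lemma nrm_diff_triangle:
  "x \<in> carr V \<Longrightarrow> y \<in> carr V \<Longrightarrow> z \<in> carr V \<Longrightarrow> nrm V (x - z) \<le> nrm V (x - y) + nrm V (y - z)"
  using nrm_triangle[of "x - y" "y - z"] carr_diff by simp

lemma nrm_diff_abs:
  "x \<in> carr V \<Longrightarrow> y \<in> carr V \<Longrightarrow> \<bar>nrm V x - nrm V y\<bar> \<le> nrm V (x - y)"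
  using nrm_diff_triangle[of x y 0] nrm_diff_triangle[of y x 0] nrm_minus_commute[of x y] carr_0
  by auto

end

lemma bounded_op_diff:
  assumes "subspace (carr V)" "bounded_op V U f" "x \<in> carr V" "y \<in> carr V"
  shows "f (x - y) = f x - f y"
proof -
  have "f (x + (-1) *\<^sub>R y) = f x + f ((-1) *\<^sub>R y)" "f ((-1) *\<^sub>R y) = (-1) *\<^sub>R f y"
    using assms subspace_scale[OF assms(1) assms(4)] unfolding bounded_op_def by blast+
  then show ?thesis by simp
qed

lemma c0_semigroupD:
  assumes "c0_semigroup V S"
  shows "\<And>t. 0 \<le> t \<Longrightarrow> bounded_op V V (S t)"
    and "\<And>t x. 0 \<le> t \<Longrightarrow> x \<in> carr V \<Longrightarrow> S t x \<in> carr V"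
    and "\<And>x. x \<in> carr V \<Longrightarrow> S 0 x = x"
    and "\<And>s t x. 0 \<le> s \<Longrightarrow> 0 \<le> t \<Longrightarrow> x \<in> carr V \<Longrightarrow> S (s + t) x = S s (S t x)"
    and "\<And>x. x \<in> carr V \<Longrightarrow> ((\<lambda>t. nrm V (S t x - x)) \<longlongrightarrow> 0) (at_right 0)"
proof -
  show op: "\<And>t. 0 \<le> t \<Longrightarrow> bounded_op V V (S t)"
    and "\<And>x. x \<in> carr V \<Longrightarrow> S 0 x = x"
    and "\<And>s t x. 0 \<le> s \<Longrightarrow> 0 \<le> t \<Longrightarrow> x \<in> carr V \<Longrightarrow> S (s + t) x = S s (S t x)"
    and "\<And>x. x \<in> carr V \<Longrightarrow> ((\<lambda>t. nrm V (S t x - x)) \<longlongrightarrow> 0) (at_right 0)"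
    using assms by (simp_all add: c0_semigroup_def)
  show "S t x \<in> carr V" if "0 \<le> t" "x \<in> carr V" for t x
    using op[OF that(1)] that(2) by (simp add: bounded_op_def)
qed

lemma has_generatorD:
  assumes "has_generator V S G"
  shows "x \<in> op_dom G \<Longrightarrow> x \<in> carr V"
    and "x \<in> op_dom G \<Longrightarrow> op_app G x \<in> carr V"
    and "x \<in> op_dom G \<Longrightarrow> ((\<lambda>h. nrm V ((S h x - x) /\<^sub>R h - op_app G x)) \<longlongrightarrow> 0) (at_right 0)"
    and "x \<in> carr V \<Longrightarrow> y \<in> carr V \<Longrightarrow>
      ((\<lambda>h. nrm V ((S h x - x) /\<^sub>R h - y)) \<longlongrightarrow> 0) (at_right 0) \<Longrightarrow> x \<in> op_dom G"
  using assms by (auto simp: has_generator_def Let_def)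

context normed_carrier
begin

lemma c0_semigroup_locally_bounded:
  assumes "c0_semigroup V S"
  obtains K where "0 < K" "\<And>t x. t \<in> {0..b} \<Longrightarrow> x \<in> carr V \<Longrightarrow> nrm V (S t x) \<le> K * nrm V x"
proof -
  obtain M w where M: "\<And>t x. 0 \<le> t \<Longrightarrow> x \<in> carr V \<Longrightarrow> nrm V (S t x) \<le> M * exp (w * t) * nrm V x"
    using assms unfolding c0_semigroup_def by blast
  define K where "K = \<bar>M\<bar> * exp (\<bar>w\<bar> * \<bar>b\<bar>) + 1"
  have "nrm V (S t x) \<le> K * nrm V x" if t: "t \<in> {0..b}" and x: "x \<in> carr V" for t x
  proof -
    have "w * t \<le> \<bar>w\<bar> * t" using t by (intro mult_right_mono) auto
    also have "\<dots> \<le> \<bar>w\<bar> * \<bar>b\<bar>" using t by (intro mult_left_mono) auto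
    finally have "w * t \<le> \<bar>w\<bar> * \<bar>b\<bar>" .
    then have "M * exp (w * t) \<le> \<bar>M\<bar> * exp (\<bar>w\<bar> * \<bar>b\<bar>)"
      by (intro mult_mono) auto
    then have "M * exp (w * t) * nrm V x \<le> K * nrm V x"
      using nrm_nonneg[OF x] unfolding K_def by (intro mult_right_mono) auto
    with M[of t x] t x show ?thesis by auto
  qed
  moreover have "0 < K" unfolding K_def by (rule add_nonneg_pos) auto
  ultimately show ?thesis using that by blast
qed

text \<open>
  The definition of a semigroup only has continuity from the right at 0.  Two-sided continuity
  follows as \<open>S u x - S v x = S v (S (u - v) x - x)\<close> for \<open>v \<le> u\<close> and the operators are
  bounded uniformly on bounded intervals.
\<close>

lemma c0_semigroup_continuous:
  assumes S: "c0_semigroup V S" and x: "x \<in> carr V" and s: "s \<in> {0..b}"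
  shows "((\<lambda>u. nrm V (S u x - S s x)) \<longlongrightarrow> 0) (at s within {0..b})"
proof -
  note Sc = c0_semigroupD[OF S]
  obtain K where K: "0 < K" "\<And>t x. t \<in> {0..b} \<Longrightarrow> x \<in> carr V \<Longrightarrow> nrm V (S t x) \<le> K * nrm V x"
    using c0_semigroup_locally_bounded[OF S] by blast
  have one: "nrm V (S u x - S v x) \<le> K * nrm V (S (u - v) x - x)"
    if "v \<in> {0..b}" "v \<le> u" for u v
  proof -
    have "S u x - S v x = S v (S (u - v) x - x)"
      using Sc(4)[of v "u - v" x] that x Sc(2)[of "u - v" x]
        bounded_op_diff[OF subspace_carr Sc(1), of v "S (u - v) x" x] by simp
    moreover have "S (u - v) x - x \<in> carr V"
      using that x by (intro carr_diff Sc(2)) auto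
    ultimately show ?thesis using K(2)[OF that(1)] by simp
  qed
  have "filterlim (\<lambda>u. \<bar>u - s\<bar>) (at_right 0) (at s within {0..b})"
    unfolding filterlim_at
    by (auto simp: eventually_at_filter intro!: tendsto_eq_intros)
  from filterlim_compose[OF Sc(5)[OF x] this]
  have lim: "((\<lambda>u. nrm V (S \<bar>u - s\<bar> x - x)) \<longlongrightarrow> 0) (at s within {0..b})" .
  show ?thesis
  proof (rule Lim_null_comparison)
    show "((\<lambda>u. K * nrm V (S \<bar>u - s\<bar> x - x)) \<longlongrightarrow> 0) (at s within {0..b})"
      using tendsto_mult_left[OF lim, of K] by simp
    show "\<forall>\<^sub>F u in at s within {0..b}. norm (nrm V (S u x - S s x)) \<le> K * nrm V (S \<bar>u - s\<bar> x - x)"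
      unfolding eventually_at_filter
    proof (intro always_eventually allI impI)
      fix u assume u: "u \<in> {0..b}"
      have c: "S u x \<in> carr V" "S s x \<in> carr V" using u s x Sc(2) by auto
      show "norm (nrm V (S u x - S s x)) \<le> K * nrm V (S \<bar>u - s\<bar> x - x)"
        using one[of s u] one[of u s] u s nrm_minus_commute[OF c] nrm_nonneg[OF carr_diff[OF c]]
        by (cases "s \<le> u") auto
    qed
  qed
qed

end

text \<open>
  A mean value theorem for a function of which only the upper right Dini derivative is controlled.
  The last time at which \<open>\<psi> u \<le> e * u\<close> cannot lie before \<open>t\<close>.
\<close>

lemma nonpos_of_right_growth_bound:
  fixes \<psi> :: "real \<Rightarrow> real"
  assumes t: "0 \<le> t" and cont: "continuous_on {0..t} \<psi>" and "\<psi> 0 \<le> 0"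
    and growth: "\<And>s e. 0 \<le> s \<Longrightarrow> s < t \<Longrightarrow> 0 < e \<Longrightarrow> \<forall>\<^sub>F h in at_right 0. \<psi> (s + h) \<le> \<psi> s + e * h"
  shows "\<psi> t \<le> 0"
proof -
  have bound: "\<psi> t \<le> e * t" if e: "0 < e" for e
  proof (rule ccontr)
    assume neg: "\<not> \<psi> t \<le> e * t"
    define A where "A = {u\<in>{0..t}. \<psi> u - e * u \<le> 0}"
    have "closed A"
      unfolding A_def by (intro continuous_on_closed_Collect_le continuous_intros cont closed_atLeastAtMost)
    moreover have "bounded A" unfolding A_def by (rule bounded_subset[of "{0..t}"]) auto
    ultimately have "compact A" by (simp add: compact_eq_bounded_closed)
    moreover have "0 \<in> A" using assms by (auto simp: A_def)
    ultimately obtain s where s: "s \<in> A" "\<And>u. u \<in> A \<Longrightarrow> u \<le> s"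
      using compact_attains_sup[of A] by blast
    have st: "0 \<le> s" "s < t" "\<psi> s - e * s \<le> 0" using s(1) neg by (auto simp: A_def less_le)
    have "\<forall>\<^sub>F h in at_right 0. h < t - s"
      using st by (intro eventually_at_right_less order_tendstoD[OF tendsto_ident_at]) auto
    with growth[OF st(1,2) e] eventually_at_right_less[of "0::real"]
    have "\<forall>\<^sub>F h in at_right 0. s + h \<in> A \<and> 0 < h"
      by eventually_elim (use st in \<open>auto simp: A_def algebra_simps\<close>)
    then obtain h where "s + h \<in> A" "0 < h"
      using eventually_happens'[of "at_right (0::real)"] by auto
    with s(2) show False by force
  qed
  show ?thesis
  proof (rule field_le_epsilon)
    fix e :: real assume "0 < e"
    with bound[of "e / (t + 1)"] t have "\<psi> t \<le> e * (t / (t + 1))" by simp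
    also have "\<dots> \<le> e * 1" using t \<open>0 < e\<close> by (intro mult_left_mono) auto
    finally show "\<psi> t \<le> 0 + e" by simp
  qed
qed

context normed_carrier
begin

text \<open>
  For \<open>x\<close> in the domain the curve \<open>\<phi> s = S (t - s) (T s x)\<close> joins \<open>S t x\<close> to
  \<open>T t x\<close>.  Its right derivative vanishes: with \<open>y = T s x\<close>, which lies in the domain,
  \<open>\<phi> (s + h) - \<phi> s = S (t - s - h) (T h y - S h y)\<close>, and both \<open>T\<close> and \<open>S\<close> have derivative
  \<open>G y\<close> at 0.
\<close>

lemma semigroup_eq_on_generator_domain:
  assumes S: "c0_semigroup V S" "has_generator V S G"
    and T: "c0_semigroup V T" "has_generator V T G"
    and x: "x \<in> op_dom G" and t: "0 \<le> t"
  shows "S t x = T t x"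
proof -
  note Sc = c0_semigroupD[OF S(1)] and Tc = c0_semigroupD[OF T(1)]
  note Sg = has_generatorD[OF S(2)] and Tg = has_generatorD[OF T(2)]
  obtain K where K: "0 < K" "\<And>s x. s \<in> {0..t} \<Longrightarrow> x \<in> carr V \<Longrightarrow> nrm V (S s x) \<le> K * nrm V x"
    using c0_semigroup_locally_bounded[OF S(1)] by blast
  obtain K' where K': "0 < K'" "\<And>s x. s \<in> {0..t} \<Longrightarrow> x \<in> carr V \<Longrightarrow> nrm V (T s x) \<le> K' * nrm V x"
    using c0_semigroup_locally_bounded[OF T(1)] by blast
  have xV: "x \<in> carr V" by (rule Sg(1)[OF x])
  define \<phi> where "\<phi> s = S (t - s) (T s x)" for s
  have \<phi>V: "\<phi> s \<in> carr V" if "s \<in> {0..t}" for s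
    using that xV Sc(2) Tc(2) by (auto simp: \<phi>_def)
  \<comment> \<open>\<open>T s\<close> commutes with the difference quotients, so the orbit stays in the domain.\<close>
  have TG: "T s x \<in> op_dom G" if s: "s \<in> {0..t}" for s
  proof (rule Tg(4))
    show "T s x \<in> carr V" "T s (op_app G x) \<in> carr V" using s xV Sg(2)[OF x] Tc(2) by auto
    show "((\<lambda>h. nrm V ((T h (T s x) - T s x) /\<^sub>R h - T s (op_app G x))) \<longlongrightarrow> 0) (at_right 0)"
    proof (rule Lim_null_comparison)
      show "((\<lambda>h. K' * nrm V ((T h x - x) /\<^sub>R h - op_app G x)) \<longlongrightarrow> 0) (at_right 0)"
        using tendsto_mult_left[OF Tg(3)[OF x], of K'] by simp
      show "\<forall>\<^sub>F h in at_right 0. norm (nrm V ((T h (T s x) - T s x) /\<^sub>R h - T s (op_app G x)))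
           \<le> K' * nrm V ((T h x - x) /\<^sub>R h - op_app G x)"
        using eventually_at_right_less[of "0::real"]
      proof eventually_elim
        case (elim h)
        have 1: "T h x - x \<in> carr V" using elim xV by (intro carr_diff Tc(2)) auto
        have 2: "(T h x - x) /\<^sub>R h - op_app G x \<in> carr V"
          by (rule carr_diff[OF carr_scaleR[OF 1] Sg(2)[OF x]])
        have "T h (T s x) = T s (T h x)"
          using Tc(4)[of h s x] Tc(4)[of s h x] elim s xV by (simp add: add.commute)
        moreover have "T s ((T h x - x) /\<^sub>R h - op_app G x)
            = T s ((T h x - x) /\<^sub>R h) - T s (op_app G x)"
          using s 1 Sg(2)[OF x] by (intro bounded_op_diff[OF subspace_carr Tc(1)] carr_scaleR) auto
        moreover have "T s ((T h x - x) /\<^sub>R h) = (T s (T h x - x)) /\<^sub>R h"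
          using Tc(1)[of s] s 1 by (auto simp: bounded_op_def)
        moreover have "T s (T h x - x) = T s (T h x) - T s x"
          using s xV elim by (intro bounded_op_diff[OF subspace_carr Tc(1)] Tc(2)) auto
        ultimately have "(T h (T s x) - T s x) /\<^sub>R h - T s (op_app G x)
            = T s ((T h x - x) /\<^sub>R h - op_app G x)" by simp
        with K'(2)[OF s 2] nrm_nonneg[OF Tc(2)[OF _ 2, of s]] s show ?case by simp
      qed
    qed
  qed
  define \<psi> where "\<psi> s = nrm V (\<phi> s - \<phi> 0)" for s
  have \<psi>_lip: "\<bar>\<psi> u - \<psi> s\<bar> \<le> nrm V (\<phi> u - \<phi> s)" if "u \<in> {0..t}" "s \<in> {0..t}" for u s
    using nrm_diff_abs[OF carr_diff[OF \<phi>V \<phi>V] carr_diff[OF \<phi>V \<phi>V], of u 0 s 0] that t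
    by (simp add: \<psi>_def)
  have "continuous_on {0..t} \<psi>"
    unfolding continuous_on
  proof
    fix s assume s: "s \<in> {0..t}"
    let ?b = "\<lambda>u. K * nrm V (T u x - T s x) + nrm V (S (t - u) (T s x) - S (t - s) (T s x))"
    have "((\<lambda>v. nrm V (S v (T s x) - S (t - s) (T s x))) \<longlongrightarrow> 0) (at (t - s) within {0..t})"
      using s xV by (intro c0_semigroup_continuous[OF S(1)] Tc(2)) auto
    moreover have "filterlim (\<lambda>u. t - u) (at (t - s) within {0..t}) (at s within {0..t})"
      unfolding filterlim_at by (auto simp: eventually_at_filter intro!: tendsto_eq_intros)
    ultimately have "((\<lambda>u. nrm V (S (t - u) (T s x) - S (t - s) (T s x))) \<longlongrightarrow> 0) (at s within {0..t})"
      by (rule filterlim_compose)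
    with tendsto_mult_left[OF c0_semigroup_continuous[OF T(1) xV s], of K]
    have "(?b \<longlongrightarrow> 0) (at s within {0..t})"
      using tendsto_add by fastforce
    moreover have "\<bar>\<psi> u - \<psi> s\<bar> \<le> ?b u" if u: "u \<in> {0..t}" for u
    proof -
      have c: "T u x \<in> carr V" "T s x \<in> carr V" using u s xV Tc(2) by auto
      have "nrm V (\<phi> u - \<phi> s) \<le> nrm V (\<phi> u - S (t - u) (T s x)) + nrm V (S (t - u) (T s x) - \<phi> s)"
        using \<phi>V u s c Sc(2) by (intro nrm_diff_triangle) auto
      also have "\<phi> u - S (t - u) (T s x) = S (t - u) (T u x - T s x)"
        unfolding \<phi>_def using u c by (intro bounded_op_diff[symmetric, OF subspace_carr Sc(1)]) auto
      also have "nrm V (S (t - u) (T u x - T s x)) \<le> K * nrm V (T u x - T s x)"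
        using u c by (intro K(2) carr_diff) auto
      finally show ?thesis using \<psi>_lip[OF u s] by (simp add: \<phi>_def)
    qed
    then have "\<forall>\<^sub>F u in at s within {0..t}. norm (\<psi> u - \<psi> s) \<le> ?b u"
      unfolding eventually_at_filter real_norm_def by (intro always_eventually) blast
    ultimately have "((\<lambda>u. \<psi> u - \<psi> s) \<longlongrightarrow> 0) (at s within {0..t})"
      by (rule Lim_null_comparison[rotated])
    then show "(\<psi> \<longlongrightarrow> \<psi> s) (at s within {0..t})" by (simp add: LIM_zero_iff)
  qed
  moreover have "\<forall>\<^sub>F h in at_right 0. \<psi> (s + h) \<le> \<psi> s + e * h"
    if s: "0 \<le> s" "s < t" and e: "0 < e" for s e
  proof -
    define y where "y = T s x"
    have y: "y \<in> op_dom G" unfolding y_def using TG s by auto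
    note yV = Sg(1)[OF y]
    have "((\<lambda>h. nrm V ((T h y - y) /\<^sub>R h - op_app G y) + nrm V ((S h y - y) /\<^sub>R h - op_app G y)) \<longlongrightarrow> 0) (at_right 0)"
      using tendsto_add[OF Tg(3)[OF y] Sg(3)[OF y]] by simp
    then have "\<forall>\<^sub>F h in at_right 0.
        nrm V ((T h y - y) /\<^sub>R h - op_app G y) + nrm V ((S h y - y) /\<^sub>R h - op_app G y) < e / K"
      by (rule order_tendstoD) (use e K in auto)
    moreover have "\<forall>\<^sub>F h in at_right 0. h < t - s"
      using s by (intro order_tendstoD[OF tendsto_ident_at]) auto
    ultimately show ?thesis using eventually_at_right_less[of "0::real"]
    proof eventually_elim
      case (elim h)
      have c: "T h y \<in> carr V" "S h y \<in> carr V" using elim yV Sc(2) Tc(2) by auto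
      let ?a = "(T h y - y) /\<^sub>R h" and ?b = "(S h y - y) /\<^sub>R h"
      have ab: "?a \<in> carr V" "?b \<in> carr V" using c yV by (auto intro!: carr_scaleR carr_diff)
      have "nrm V (?a - ?b) \<le> nrm V (?a - op_app G y) + nrm V (op_app G y - ?b)"
        using ab Sg(2)[OF y] by (intro nrm_diff_triangle) auto
      also have "\<dots> < e / K" using elim nrm_minus_commute[OF Sg(2)[OF y] ab(2)] by simp
      also have "?a - ?b = (T h y - S h y) /\<^sub>R h" by (simp add: algebra_simps)
      also have "nrm V \<dots> = nrm V (T h y - S h y) / h"
        using elim c by (subst nrm_scaleR) (auto intro: carr_diff simp: field_simps)
      finally have 1: "K * nrm V (T h y - S h y) \<le> e * h"
        using elim K(1) by (simp add: field_simps)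
      have "T (s + h) x = T h y" using Tc(4)[of h s x] elim s xV by (simp add: y_def add.commute)
      moreover have "S (t - s) y = S (t - (s + h)) (S h y)"
        using Sc(4)[of "t - (s + h)" h y] elim yV by simp
      ultimately have "\<phi> (s + h) - \<phi> s = S (t - (s + h)) (T h y - S h y)"
        unfolding \<phi>_def y_def[symmetric]
        using elim c bounded_op_diff[OF subspace_carr Sc(1)] by simp
      then have "nrm V (\<phi> (s + h) - \<phi> s) \<le> K * nrm V (T h y - S h y)"
        using elim s c by (auto intro!: K(2) carr_diff)
      with 1 \<psi>_lip[of "s + h" s] elim s show ?case by auto
    qed
  qed
  ultimately have "\<psi> t \<le> 0"
    using t nrm_0 by (intro nonpos_of_right_growth_bound[of t \<psi>]) (auto simp: \<psi>_def)
  moreover have c: "\<phi> t - \<phi> 0 \<in> carr V" using \<phi>V t by (intro carr_diff) auto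
  ultimately have "\<phi> t - \<phi> 0 = 0"
    using nrm_nonneg[OF c] by (intro nrm_eq_0D) (auto simp: \<psi>_def)
  then show ?thesis using Sc Tc xV t by (simp add: \<phi>_def)
qed

lemma semigroup_unique:
  assumes S: "c0_semigroup V S" "has_generator V S G"
    and T: "c0_semigroup V T" "has_generator V T G"
    and dense: "\<And>x e. x \<in> carr V \<Longrightarrow> 0 < e \<Longrightarrow> \<exists>y\<in>op_dom G. nrm V (y - x) < e"
    and x: "x \<in> carr V" and t: "0 \<le> t"
  shows "S t x = T t x"
proof -
  note Sc = c0_semigroupD[OF S(1)] and Tc = c0_semigroupD[OF T(1)]
  obtain K where K: "0 < K" "\<And>s x. s \<in> {0..t} \<Longrightarrow> x \<in> carr V \<Longrightarrow> nrm V (S s x) \<le> K * nrm V x"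
    using c0_semigroup_locally_bounded[OF S(1)] by blast
  obtain K' where K': "0 < K'" "\<And>s x. s \<in> {0..t} \<Longrightarrow> x \<in> carr V \<Longrightarrow> nrm V (T s x) \<le> K' * nrm V x"
    using c0_semigroup_locally_bounded[OF T(1)] by blast
  have c: "S t x \<in> carr V" "T t x \<in> carr V" using Sc(2) Tc(2) t x by auto
  have "nrm V (S t x - T t x) \<le> 0"
  proof (rule field_le_epsilon)
    fix e :: real assume e: "0 < e"
    \<comment> \<open>The difference at \<open>x\<close> is at most \<open>K + K'\<close> times the distance to a point where the semigroups agree.\<close>
    obtain y where y: "y \<in> op_dom G" "nrm V (y - x) < e / (K + K')"
      using dense[OF x, of "e / (K + K')"] e K K' by auto
    have yV: "y \<in> carr V" by (rule has_generatorD(1)[OF S(2) y(1)])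
    have cy: "S t y \<in> carr V" "T t y \<in> carr V" using Sc(2) Tc(2) t yV by auto
    have eq: "S t y = T t y" by (rule semigroup_eq_on_generator_domain[OF S T y(1) t])
    have d: "nrm V (S t x - S t y) \<le> K * nrm V (y - x)" "nrm V (T t y - T t x) \<le> K' * nrm V (y - x)"
      using bounded_op_diff[OF subspace_carr Sc(1)[OF t] x yV] bounded_op_diff[OF subspace_carr Tc(1)[OF t] yV x]
        K(2)[of t "x - y"] K'(2)[of t "y - x"] t carr_diff[OF x yV] carr_diff[OF yV x]
        nrm_minus_commute[OF x yV] by auto
    have "nrm V (S t x - T t x) \<le> nrm V (S t x - S t y) + nrm V (T t y - T t x)"
      using nrm_diff_triangle[OF c(1) cy(1) c(2)] eq by simp
    also have "\<dots> \<le> (K + K') * nrm V (y - x)"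
      using d by (simp add: distrib_right)
    also have "\<dots> < e" using y(2) K K' by (simp add: field_simps)
    finally show "nrm V (S t x - T t x) \<le> 0 + e" by simp
  qed
  then have "S t x - T t x = 0"
    using nrm_nonneg[OF carr_diff[OF c]] by (intro nrm_eq_0D carr_diff c) auto
  then show ?thesis by simp
qed

lemma subspace_generator_domain:
  assumes S: "c0_semigroup V S" "has_generator V S G"
  shows "subspace (op_dom G)"
proof -
  note Sc = c0_semigroupD[OF S(1)] and Sg = has_generatorD[OF S(2)]
  let ?d = "\<lambda>x h. (S h x - x) /\<^sub>R h"
  have dV: "?d x h \<in> carr V" if "x \<in> carr V" "0 < h" for x h
    using that by (intro carr_scaleR carr_diff Sc(2)) auto
  have S_lin: "S h (x + y) = S h x + S h y" "S h (c *\<^sub>R x) = c *\<^sub>R S h x"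
    if "0 < h" "x \<in> carr V" "y \<in> carr V" for h c x y
    using Sc(1)[of h] that by (auto simp: bounded_op_def)
  show ?thesis
  proof (rule subspaceI)
    have "?d 0 h = 0" if "0 < h" for h
      using S_lin(2)[OF that carr_0 carr_0, of 0] by simp
    then have "\<forall>\<^sub>F h in at_right 0. nrm V (?d 0 h - 0) = 0"
      using eventually_at_right_less[of "0::real"] by (auto elim!: eventually_mono simp: nrm_0)
    then show "0 \<in> op_dom G"
      by (intro Sg(4)[of 0 0] carr_0 tendsto_eventually)
  next
    fix x y assume xy: "x \<in> op_dom G" "y \<in> op_dom G"
    note c = Sg(1)[OF xy(1)] Sg(1)[OF xy(2)] Sg(2)[OF xy(1)] Sg(2)[OF xy(2)]
    have "((\<lambda>h. nrm V (?d (x + y) h - (op_app G x + op_app G y))) \<longlongrightarrow> 0) (at_right 0)"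
    proof (rule Lim_null_comparison)
      show "((\<lambda>h. nrm V (?d x h - op_app G x) + nrm V (?d y h - op_app G y)) \<longlongrightarrow> 0) (at_right 0)"
        using tendsto_add[OF Sg(3)[OF xy(1)] Sg(3)[OF xy(2)]] by simp
      show "\<forall>\<^sub>F h in at_right 0. norm (nrm V (?d (x + y) h - (op_app G x + op_app G y)))
          \<le> nrm V (?d x h - op_app G x) + nrm V (?d y h - op_app G y)"
        using eventually_at_right_less[of "0::real"]
      proof eventually_elim
        case (elim h)
        have eq: "?d (x + y) h - (op_app G x + op_app G y) = (?d x h - op_app G x) + (?d y h - op_app G y)"
          using elim c by (simp add: S_lin algebra_simps)
        have d: "?d x h - op_app G x \<in> carr V" "?d y h - op_app G y \<in> carr V"
          using dV elim c by (simp_all add: carr_diff)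
        show ?case
          using nrm_triangle[OF d] nrm_nonneg[OF carr_add[OF d]]
          unfolding eq real_norm_def by (simp only: abs_of_nonneg)
      qed
    qed
    then show "x + y \<in> op_dom G" by (rule Sg(4)[OF carr_add[OF c(1,2)] carr_add[OF c(3,4)]])
  next
    fix a x assume x: "x \<in> op_dom G"
    note c = Sg(1)[OF x] Sg(2)[OF x]
    have "((\<lambda>h. nrm V (?d (a *\<^sub>R x) h - a *\<^sub>R op_app G x)) \<longlongrightarrow> 0) (at_right 0)"
    proof (rule Lim_transform_eventually)
      show "((\<lambda>h. \<bar>a\<bar> * nrm V (?d x h - op_app G x)) \<longlongrightarrow> 0) (at_right 0)"
        using tendsto_mult_left[OF Sg(3)[OF x], of "\<bar>a\<bar>"] by simp
      show "\<forall>\<^sub>F h in at_right 0. \<bar>a\<bar> * nrm V (?d x h - op_app G x)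
          = nrm V (?d (a *\<^sub>R x) h - a *\<^sub>R op_app G x)"
        using eventually_at_right_less[of "0::real"]
      proof eventually_elim
        case (elim h)
        have "?d (a *\<^sub>R x) h - a *\<^sub>R op_app G x = a *\<^sub>R (?d x h - op_app G x)"
          using elim c by (simp add: S_lin algebra_simps)
        then show ?case using nrm_scaleR[OF carr_diff[OF dV[OF c(1) elim] c(2)], of a] by simp
      qed
    qed
    then show "a *\<^sub>R x \<in> op_dom G" by (rule Sg(4)[OF carr_scaleR[OF c(1)] carr_scaleR[OF c(2)]])
  qed
qed

end

section \<open>Minkowski's inequality\<close>

lemma epowr_ennreal [simp]: "0 \<le> x \<Longrightarrow> epowr (ennreal x) q = ennreal (x powr q)"
  by (simp add: epowr_def)

lemma epowr_top [simp]: "epowr \<top> q = \<top>"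
  by (simp add: epowr_def)

lemma epowr_0 [simp]: "epowr 0 q = 0"
  by (simp add: epowr_def)

lemma epowr_1 [simp]: "epowr a 1 = a"
  by (cases a) auto

lemma epowr_epowr: "epowr (epowr a q) s = epowr a (q * s)"
  by (cases a) (auto simp: powr_powr)

lemma epowr_mono: "a \<le> b \<Longrightarrow> 0 \<le> q \<Longrightarrow> epowr a q \<le> epowr b q"
  by (cases a; cases b) (auto intro!: ennreal_leI powr_mono2 simp: top_unique)

lemma epowr_eq_0_iff: "epowr a q = 0 \<longleftrightarrow> a = 0"
  by (cases a) auto

lemma epowr_cmult: "0 \<le> c \<Longrightarrow> epowr (ennreal c * a) q = ennreal (c powr q) * epowr a q"
proof (cases a)
  case (real r)
  then show "0 \<le> c \<Longrightarrow> ?thesis"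
    by (simp add: ennreal_mult[symmetric] powr_mult)
next
  case top
  then show "0 \<le> c \<Longrightarrow> ?thesis"
    by (cases "c = 0") (auto simp: ennreal_mult_top)
qed

lemma measurable_epowr [measurable (raw)]:
  assumes [measurable]: "f \<in> borel_measurable M"
  shows "(\<lambda>x. epowr (f x) q) \<in> borel_measurable M"
  unfolding epowr_def by measurable

lemma Lp_norm_mono: "0 < p \<Longrightarrow> (\<And>x. g x \<le> h x) \<Longrightarrow> Lp_norm p M g \<le> Lp_norm p M h"
  unfolding Lp_norm_def by (intro epowr_mono nn_integral_mono) auto

lemma Lp_norm_0 [simp]: "Lp_norm p M (\<lambda>_. 0) = 0"
  by (simp add: Lp_norm_def)

lemma epowr_Lp_norm: "0 < p \<Longrightarrow> epowr (Lp_norm p M g) p = (\<integral>\<^sup>+x. epowr (g x) p \<partial>M)"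
  by (simp add: Lp_norm_def epowr_epowr)

lemma Lp_norm_cmult:
  assumes "0 < p" "0 \<le> c" "g \<in> borel_measurable M"
  shows "Lp_norm p M (\<lambda>x. ennreal c * g x) = ennreal c * Lp_norm p M g"
proof -
  have "(\<integral>\<^sup>+x. epowr (ennreal c * g x) p \<partial>M) = ennreal (c powr p) * (\<integral>\<^sup>+x. epowr (g x) p \<partial>M)"
    using assms by (simp add: epowr_cmult nn_integral_cmult)
  then show ?thesis
    using assms by (simp add: Lp_norm_def epowr_cmult powr_powr)
qed

lemma Lp_norm_eq_0D:
  assumes "g \<in> borel_measurable M" "Lp_norm p M g = 0"
  shows "AE x in M. g x = 0"
  using assms by (simp add: Lp_norm_def epowr_eq_0_iff nn_integral_0_iff_AE)

text \<open>
  Convexity of \<open>u \<mapsto> u powr p\<close> with the weights \<open>a / (a + b)\<close> and \<open>b / (a + b)\<close> at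
  \<open>x / a\<close> and \<open>y / b\<close>.  With \<open>a\<close>, \<open>b\<close> the two norms, integration gives Minkowski's
  inequality.
\<close>

lemma powr_add_le_weighted:
  fixes a b x y p :: real
  assumes ab: "0 < a" "0 < b" and xy: "0 \<le> x" "0 \<le> y" and p: "1 \<le> p"
  shows "(x + y) powr p
    \<le> (a + b) powr p * (a / (a + b)) / a powr p * x powr p
     + (a + b) powr p * (b / (a + b)) / b powr p * y powr p"
proof -
  have conv: "((a / (a + b)) * u + (b / (a + b)) * v) powr p
      \<le> (a / (a + b)) * u powr p + (b / (a + b)) * v powr p" if uv: "0 \<le> u" "0 \<le> v" for u v
  proof -
    define s where "s = b / (a + b)"
    have s: "0 \<le> s" "s \<le> 1" "1 - s = a / (a + b)"
      using ab by (auto simp: s_def field_simps)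
    have scale: "(r * z) powr p \<le> r * z powr p" if "0 \<le> r" "r \<le> 1" "0 \<le> z" for r z :: real
    proof (cases "r = 0")
      case False
      then have "r powr p \<le> r powr 1" using that p by (intro powr_mono') auto
      then have "r powr p * z powr p \<le> r * z powr p"
        using that by (intro mult_right_mono) auto
      then show ?thesis using that by (simp add: powr_mult)
    qed auto
    consider "u = 0" | "v = 0" | "0 < u" "0 < v" using uv by linarith
    then have "((1 - s) * u + s * v) powr p \<le> (1 - s) * u powr p + s * v powr p"
    proof cases
      case 1 then show ?thesis using scale[of s v] s uv p by simp
    next
      case 2 then show ?thesis using scale[of "1 - s" u] s uv p by simp
    next
      case 3 then show ?thesis
        using convex_onD[OF powr_convex[OF p], of s u v] s by simp
    qed
    then show ?thesis by (simp add: s(3)) (simp add: s_def)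
  qed
  have "(a / (a + b)) * (x / a) + (b / (a + b)) * (y / b) = (x + y) / (a + b)"
    using ab by (simp add: add_divide_distrib)
  then have "x + y = (a + b) * ((a / (a + b)) * (x / a) + (b / (a + b)) * (y / b))"
    using ab by simp
  then have "(x + y) powr p = (a + b) powr p * ((a / (a + b)) * (x / a) + (b / (a + b)) * (y / b)) powr p"
    using ab xy by (simp only: powr_mult)
  also have "\<dots> \<le> (a + b) powr p * ((a / (a + b)) * (x / a) powr p + (b / (a + b)) * (y / b) powr p)"
    using ab xy by (intro mult_left_mono conv) auto
  finally show ?thesis using ab xy by (simp add: powr_divide distrib_left)
qed

lemma Lp_norm_triangle:
  assumes p: "1 \<le> p" and [measurable]: "g \<in> borel_measurable M" "h \<in> borel_measurable M"
  shows "Lp_norm p M (\<lambda>x. g x + h x) \<le> Lp_norm p M g + Lp_norm p M h"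
proof -
  consider "Lp_norm p M g = \<top> \<or> Lp_norm p M h = \<top>" | "Lp_norm p M g = 0" | "Lp_norm p M h = 0"
    | a b where "0 < a" "0 < b" "Lp_norm p M g = ennreal a" "Lp_norm p M h = ennreal b"
    by (metis ennreal_cases ennreal_0 order_le_less infinity_ennreal_def)
  then show ?thesis
  proof cases
    case 2
    have "Lp_norm p M (\<lambda>x. g x + h x) = Lp_norm p M h"
      by (rule Lp_norm_cong_AE) (use Lp_norm_eq_0D[OF assms(2) 2] in eventually_elim, simp)
    then show ?thesis by simp
  next
    case 3
    have "Lp_norm p M (\<lambda>x. g x + h x) = Lp_norm p M g"
      by (rule Lp_norm_cong_AE) (use Lp_norm_eq_0D[OF assms(3) 3] in eventually_elim, simp)
    then show ?thesis by simp
  next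
    case (4 a b)
    \<comment> \<open>The weights of the convexity estimate, chosen so that the two integrals add up to \<open>(a + b) powr p\<close>.\<close>
    define ca where "ca = (a + b) powr p * (a / (a + b)) / a powr p"
    define cb where "cb = (a + b) powr p * (b / (a + b)) / b powr p"
    have c: "0 < ca" "0 < cb" using 4 by (auto simp: ca_def cb_def)
    have pw: "epowr (g x + h x) p \<le> ennreal ca * epowr (g x) p + ennreal cb * epowr (h x) p" for x
    proof (cases "g x = \<top> \<or> h x = \<top>")
      case True
      then show ?thesis using c by (auto simp: ennreal_mult_top)
    next
      case False
      then obtain u v where uv: "0 \<le> u" "0 \<le> v" "g x = ennreal u" "h x = ennreal v"
        by (cases "g x"; cases "h x") auto
      have "(u + v) powr p \<le> ca * u powr p + cb * v powr p"
        unfolding ca_def cb_def by (rule powr_add_le_weighted[OF 4(1,2) uv(1,2) p])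
      with uv c show ?thesis
        by (simp add: ennreal_plus[symmetric] ennreal_mult[symmetric] ennreal_leI del: ennreal_plus)
    qed
    have "(\<integral>\<^sup>+x. epowr (g x + h x) p \<partial>M)
        \<le> (\<integral>\<^sup>+x. ennreal ca * epowr (g x) p + ennreal cb * epowr (h x) p \<partial>M)"
      by (intro nn_integral_mono pw)
    also have "\<dots> = ennreal ca * epowr (Lp_norm p M g) p + ennreal cb * epowr (Lp_norm p M h) p"
      using p by (simp add: nn_integral_add nn_integral_cmult epowr_Lp_norm)
    also have "\<dots> = ennreal (ca * a powr p + cb * b powr p)"
      using 4 c by (simp add: ennreal_mult)
    also have "ca * a powr p + cb * b powr p = (a + b) powr p * (a / (a + b) + b / (a + b))"
      unfolding distrib_left using 4 by (simp add: ca_def cb_def)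
    also have "a / (a + b) + b / (a + b) = 1"
      using 4 by (simp add: add_divide_distrib[symmetric])
    finally have "(\<integral>\<^sup>+x. epowr (g x + h x) p \<partial>M) \<le> ennreal ((a + b) powr p)" by simp
    then have "Lp_norm p M (\<lambda>x. g x + h x) \<le> epowr (ennreal ((a + b) powr p)) (1 / p)"
      unfolding Lp_norm_def using p by (intro epowr_mono) auto
    also have "\<dots> = ennreal (a + b)"
      using 4 p by (simp add: powr_powr)
    finally show ?thesis using 4 by simp
  qed auto
qed

lemma Lp_norm_add_le:
  assumes "1 \<le> p" "g \<in> borel_measurable M" "h \<in> borel_measurable M"
    and "\<And>x. f x \<le> g x + h x"
  shows "Lp_norm p M f \<le> Lp_norm p M g + Lp_norm p M h"
  using Lp_norm_mono[of p f "\<lambda>x. g x + h x" M] Lp_norm_triangle[OF assms(1-3)] assms(1,4)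
  by (auto intro: order_trans)

lemma measurable_Lp_norm:
  assumes "sigma_finite_measure N" "(\<lambda>z. f (fst z) (snd z)) \<in> borel_measurable (M \<Otimes>\<^sub>M N)"
  shows "(\<lambda>h. Lp_norm p N (f h)) \<in> borel_measurable M"
proof -
  interpret sigma_finite_measure N by fact
  have "(\<lambda>h. \<integral>\<^sup>+x. epowr (f h x) p \<partial>N) \<in> borel_measurable M"
    using assms(2) by (intro borel_measurable_nn_integral) (simp add: case_prod_unfold measurable_epowr)
  then show ?thesis unfolding Lp_norm_def by (rule measurable_epowr)
qed

section \<open>Polynomials of the model space\<close>

lemma lookup_scaleR: "Poly_Mapping.lookup (c *\<^sub>R Q) k = c * (Poly_Mapping.lookup Q k :: real)"
proof -
  have "finite {k. c * Poly_Mapping.lookup Q k \<noteq> 0}"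
    by (rule finite_subset[OF _ finite_keys[of Q]]) (auto simp: in_keys_iff)
  then show ?thesis by (simp add: scaleR_poly_mapping_def Abs_poly_mapping_inverse)
qed

lemma lookup_mp_const_mult:
  "Poly_Mapping.lookup (mp_const a * P) j = a * Poly_Mapping.lookup P j"
  unfolding mp_const_def mult_map_scale_conv_mult[symmetric]
  by (simp add: Poly_Mapping.map.rep_eq when_def)

lemma finite_mdeg_le: "finite {k :: 'd::finite \<Rightarrow>\<^sub>0 nat. mdeg k \<le> N}"
proof (rule finite_imageD)
  have "Poly_Mapping.lookup k i \<le> mdeg k" for k :: "'d \<Rightarrow>\<^sub>0 nat" and i
    unfolding mdeg_def by (rule member_le_sum) auto
  then have "Poly_Mapping.lookup ` {k :: 'd \<Rightarrow>\<^sub>0 nat. mdeg k \<le> N} \<subseteq> PiE UNIV (\<lambda>_. {..N})"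
    by (auto intro: order_trans)
  then show "finite (Poly_Mapping.lookup ` {k :: 'd \<Rightarrow>\<^sub>0 nat. mdeg k \<le> N})"
    by (rule finite_subset) (intro finite_PiE; simp)
  show "inj_on Poly_Mapping.lookup {k :: 'd \<Rightarrow>\<^sub>0 nat. mdeg k \<le> N}"
    by (auto intro!: inj_onI poly_mapping_eqI)
qed

lemma comp_norm_eq:
  "comp_norm m Q = (\<Sum>k | mdeg k = m. \<bar>Poly_Mapping.lookup Q k\<bar>)"
  unfolding comp_norm_def
  by (rule sum.mono_neutral_left)
    (auto simp: in_keys_iff intro: finite_subset[OF _ finite_mdeg_le[of m]])

lemma comp_norm_nonneg: "0 \<le> comp_norm m Q"
  by (simp add: comp_norm_eq sum_nonneg)

lemma comp_norm_add: "comp_norm m (Q + Q') \<le> comp_norm m Q + comp_norm m Q'"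
  by (simp add: comp_norm_eq lookup_add sum.distrib[symmetric] sum_mono)

lemma comp_norm_scaleR: "comp_norm m (c *\<^sub>R Q) = \<bar>c\<bar> * comp_norm m Q"
  by (simp add: comp_norm_eq lookup_scaleR abs_mult sum_distrib_left)

lemma comp_norm_0 [simp]: "comp_norm m 0 = 0"
  by (simp add: comp_norm_eq)

lemma measurable_comp_norm:
  assumes "\<And>k. (\<lambda>x. Poly_Mapping.lookup (f x) k) \<in> borel_measurable M"
  shows "(\<lambda>x. comp_norm m (f x)) \<in> borel_measurable M"
  unfolding comp_norm_eq using assms by (intro borel_measurable_sum borel_measurable_abs)

definition translation_coeff ::
    "real^'d \<Rightarrow> ('d::finite \<Rightarrow>\<^sub>0 nat) \<Rightarrow> ('d \<Rightarrow>\<^sub>0 nat) \<Rightarrow> real" where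
  "translation_coeff h k j = Poly_Mapping.lookup
     (\<Prod>i\<in>UNIV. (mp_var i + mp_const (h $ i)) ^ Poly_Mapping.lookup k i) j"

lemma lookup_sum: "Poly_Mapping.lookup (sum f I) k = (\<Sum>i\<in>I. Poly_Mapping.lookup (f i) k)"
  by (induction I rule: infinite_finite_induct) (auto simp: lookup_add)

text \<open>
  Independence of the index set \<open>K\<close> from the polynomial gives linearity of \<open>model_Gamma x y\<close>, and
  measurability when the polynomial varies with the base point.
\<close>

lemma lookup_model_Gamma:
  assumes "finite K" "Poly_Mapping.keys Q \<subseteq> K"
  shows "Poly_Mapping.lookup (model_Gamma x y Q) j
    = (\<Sum>k\<in>K. Poly_Mapping.lookup Q k * translation_coeff (x - y) k j)"
proof -
  have "Poly_Mapping.lookup (model_Gamma x y Q) j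
      = (\<Sum>k\<in>Poly_Mapping.keys Q. Poly_Mapping.lookup Q k * translation_coeff (x - y) k j)"
    by (simp add: model_Gamma_def mp_translate_def lookup_sum lookup_mp_const_mult translation_coeff_def)
  also have "\<dots> = (\<Sum>k\<in>K. Poly_Mapping.lookup Q k * translation_coeff (x - y) k j)"
    using assms by (intro sum.mono_neutral_left) (auto simp: in_keys_iff)
  finally show ?thesis .
qed

lemma model_Gamma_add: "model_Gamma x y (Q + Q') = model_Gamma x y Q + model_Gamma x y Q'"
proof (rule poly_mapping_eqI)
  fix j
  let ?K = "Poly_Mapping.keys Q \<union> Poly_Mapping.keys Q'"
  have K: "finite ?K" "Poly_Mapping.keys (Q + Q') \<subseteq> ?K"
    "Poly_Mapping.keys Q \<subseteq> ?K" "Poly_Mapping.keys Q' \<subseteq> ?K"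
    using keys_add[of Q Q'] by auto
  show "Poly_Mapping.lookup (model_Gamma x y (Q + Q')) j
      = Poly_Mapping.lookup (model_Gamma x y Q + model_Gamma x y Q') j"
    by (simp add: lookup_add lookup_model_Gamma[OF K(1,2)] lookup_model_Gamma[OF K(1,3)]
        lookup_model_Gamma[OF K(1,4)] distrib_right sum.distrib)
qed

lemma keys_scaleR: "Poly_Mapping.keys (c *\<^sub>R Q) \<subseteq> Poly_Mapping.keys (Q :: 'a \<Rightarrow>\<^sub>0 real)"
  by (auto simp: in_keys_iff lookup_scaleR)

lemma model_Gamma_scaleR: "model_Gamma x y (c *\<^sub>R Q) = c *\<^sub>R model_Gamma x y Q"
  by (rule poly_mapping_eqI)
    (simp add: lookup_scaleR lookup_model_Gamma[OF finite_keys keys_scaleR[of c Q]]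
      lookup_model_Gamma[OF finite_keys order_refl, where Q = Q] sum_distrib_left mult.assoc)

text \<open>
  The coefficients of \<open>\<Prod>i. (X\<^sub>i + h\<^sub>i)^(k\<^sub>i)\<close> are polynomials in \<open>h\<close>.  To see their
  measurability without computing them, consider families built by addition from monomials with
  a measurable coefficient; these are closed under products.
\<close>

inductive coeff_measurable_family :: "('a::topological_space \<Rightarrow> 'd mpoly) \<Rightarrow> bool" where
  single: "c \<in> borel_measurable borel \<Longrightarrow> coeff_measurable_family (\<lambda>h. Poly_Mapping.single k (c h))"
| add: "coeff_measurable_family f \<Longrightarrow> coeff_measurable_family g \<Longrightarrow>
    coeff_measurable_family (\<lambda>h. f h + g h)"

lemma coeff_measurable_family_lookup:
  "coeff_measurable_family f \<Longrightarrow> (\<lambda>h. Poly_Mapping.lookup (f h) j) \<in> borel_measurable borel"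
  by (induction rule: coeff_measurable_family.induct) (auto simp: lookup_single lookup_add when_def)

lemma coeff_measurable_family_mult:
  assumes "coeff_measurable_family f" "coeff_measurable_family g"
  shows "coeff_measurable_family (\<lambda>h. f h * g h)"
  using assms(2)
proof (induction rule: coeff_measurable_family.induct)
  case (single d l)
  from assms(1) show ?case
  proof (induction rule: coeff_measurable_family.induct)
    case (single c k)
    then show ?case using \<open>d \<in> borel_measurable borel\<close>
      by (auto simp: mult_single intro!: coeff_measurable_family.intros)
  qed (auto simp: distrib_right intro: coeff_measurable_family.intros)
qed (auto simp: distrib_left intro: coeff_measurable_family.intros)

lemma coeff_measurable_family_1: "coeff_measurable_family (\<lambda>_. 1)"
  using coeff_measurable_family.single[of "\<lambda>_. 1" 0] by simp

lemma coeff_measurable_family_power: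
  "coeff_measurable_family f \<Longrightarrow> coeff_measurable_family (\<lambda>h. f h ^ n)"
  by (induction n) (auto intro: coeff_measurable_family_1 coeff_measurable_family_mult)

lemma coeff_measurable_family_prod:
  "(\<And>i. coeff_measurable_family (f i)) \<Longrightarrow> coeff_measurable_family (\<lambda>h. \<Prod>i\<in>I. f i h)"
  by (induction I rule: infinite_finite_induct)
    (auto intro: coeff_measurable_family_1 coeff_measurable_family_mult)

lemma measurable_translation_coeff:
  "(\<lambda>h. translation_coeff h k j) \<in> borel_measurable borel"
  unfolding translation_coeff_def mp_var_def mp_const_def
  by (intro coeff_measurable_family_lookup coeff_measurable_family_prod coeff_measurable_family_power
      coeff_measurable_family.intros) auto

section \<open>Modelled distributions form a normed space\<close>

definition mod_dist_rep :: "real \<Rightarrow> (real^'d::finite \<Rightarrow> 'd mpoly) \<Rightarrow> bool" where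
  "mod_dist_rep \<gamma> f \<longleftrightarrow>
     (\<forall>k. (\<lambda>x. Poly_Mapping.lookup (f x) k) \<in> borel_measurable borel) \<and>
     (\<forall>x. \<forall>k\<in>Poly_Mapping.keys (f x). real (mdeg k) < \<gamma>)"

definition increment :: "(real^'d \<Rightarrow> 'd mpoly) \<Rightarrow> real^'d \<Rightarrow> real^'d \<Rightarrow> ('d::finite) mpoly" where
  "increment f h x = f (x + h) - model_Gamma (x + h) x (f x)"

definition increment_ratio ::
    "real \<Rightarrow> nat \<Rightarrow> (real^'d::finite \<Rightarrow> 'd mpoly) \<Rightarrow> real^'d \<Rightarrow> real^'d \<Rightarrow> ennreal" where
  "increment_ratio \<gamma> m f h x = ennreal (comp_norm m (increment f h x) / infnorm h powr (\<gamma> - real m))"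

definition increment_measure :: "(real^'d::finite) measure" where
  "increment_measure = density lborel (\<lambda>h. indicator sup_ball h * ennreal (1 / infnorm h ^ CARD('d)))"

lemma mod_dist_fun_norm_eq:
  "mod_dist_fun_norm \<gamma> p f =
     (\<Sum>m | real m < \<gamma>. Lp_norm p lborel (\<lambda>x. ennreal (comp_norm m (f x)))) +
     (\<Sum>m | real m < \<gamma>. Lp_norm 2 increment_measure (\<lambda>h. Lp_norm p lborel (increment_ratio \<gamma> m f h)))"
  unfolding mod_dist_fun_norm_def increment_ratio_def[abs_def] increment_def increment_measure_def
  by (rule refl)

lemma measurable_mod_dist_comp_norm:
  "mod_dist_rep \<gamma> f \<Longrightarrow> (\<lambda>x. ennreal (comp_norm m (f x))) \<in> borel_measurable lborel"
  by (auto simp: mod_dist_rep_def intro!: measurable_compose[OF measurable_comp_norm measurable_ennreal])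

text \<open>
  The inner integral over \<open>x\<close> has to be a measurable function of \<open>h\<close>, which is why the increment
  is studied in both variables at once.
\<close>

lemma measurable_increment_ratio:
  assumes "mod_dist_rep \<gamma> f"
  shows "(\<lambda>z. increment_ratio \<gamma> m f (fst z) (snd z)) \<in> borel_measurable (increment_measure \<Otimes>\<^sub>M lborel)"
proof -
  have sets: "sets (increment_measure \<Otimes>\<^sub>M lborel) = sets (borel \<Otimes>\<^sub>M (borel :: (real^'a) measure))"
    by (intro sets_pair_measure_cong) (auto simp: increment_measure_def)
  have [measurable]: "(\<lambda>x. Poly_Mapping.lookup (f x) k) \<in> borel_measurable borel" for k
    using assms by (auto simp: mod_dist_rep_def)
  have [measurable]: "(\<lambda>h :: real^'a. infnorm h) \<in> borel_measurable borel"
    by (intro borel_measurable_continuous_onI continuous_intros)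
  note [measurable] = measurable_translation_coeff
  \<comment> \<open>One finite set of exponents for all base points, so that the coefficients are finite sums of products.\<close>
  let ?K = "{k :: 'a \<Rightarrow>\<^sub>0 nat. mdeg k \<le> nat \<lceil>\<gamma>\<rceil>}"
  have K: "Poly_Mapping.keys (f x) \<subseteq> ?K" for x
  proof
    fix k assume "k \<in> Poly_Mapping.keys (f x)"
    then have "real (mdeg k) < \<gamma>" using assms by (auto simp: mod_dist_rep_def)
    then show "k \<in> ?K" by simp linarith
  qed
  have "Poly_Mapping.lookup (increment f h x) j = Poly_Mapping.lookup (f (x + h)) j
      - (\<Sum>k\<in>?K. Poly_Mapping.lookup (f x) k * translation_coeff h k j)" for h x j
    by (simp add: increment_def lookup_minus lookup_model_Gamma[OF finite_mdeg_le K])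
  then have "(\<lambda>z. Poly_Mapping.lookup (increment f (fst z) (snd z)) j)
      \<in> borel_measurable (borel \<Otimes>\<^sub>M borel)" for j
    by simp
  then have [measurable]: "(\<lambda>z. comp_norm m (increment f (fst z) (snd z))) \<in> borel_measurable (borel \<Otimes>\<^sub>M borel)"
    by (rule measurable_comp_norm)
  have "(\<lambda>z. increment_ratio \<gamma> m f (fst z) (snd z)) \<in> borel_measurable (borel \<Otimes>\<^sub>M borel)"
    unfolding increment_ratio_def by measurable
  then show ?thesis by (simp add: measurable_cong_sets[OF sets refl])
qed

lemma measurable_increment_ratio_snd:
  assumes "mod_dist_rep \<gamma> f"
  shows "increment_ratio \<gamma> m f h \<in> borel_measurable lborel"
  using measurable_compose[OF measurable_Pair1' measurable_increment_ratio[OF assms], of h m]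
  by (simp add: increment_measure_def)

lemma measurable_Lp_norm_increment_ratio:
  "mod_dist_rep \<gamma> f \<Longrightarrow>
    (\<lambda>h. Lp_norm p lborel (increment_ratio \<gamma> m f h)) \<in> borel_measurable increment_measure"
  by (rule measurable_Lp_norm[OF lborel.sigma_finite_measure_axioms measurable_increment_ratio])

lemma increment_ratio_add:
  "increment_ratio \<gamma> m (\<lambda>x. f x + g x) h x \<le> increment_ratio \<gamma> m f h x + increment_ratio \<gamma> m g h x"
proof -
  let ?c = "infnorm h powr (\<gamma> - real m)"
  have "increment (\<lambda>x. f x + g x) h x = increment f h x + increment g h x"
    by (simp add: increment_def model_Gamma_add)
  then have "comp_norm m (increment (\<lambda>x. f x + g x) h x) / ?c
      \<le> comp_norm m (increment f h x) / ?c + comp_norm m (increment g h x) / ?c"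
    using comp_norm_add[of m "increment f h x" "increment g h x"]
    by (simp add: add_divide_distrib[symmetric] divide_right_mono)
  then have "increment_ratio \<gamma> m (\<lambda>x. f x + g x) h x
      \<le> ennreal (comp_norm m (increment f h x) / ?c + comp_norm m (increment g h x) / ?c)"
    unfolding increment_ratio_def by (rule ennreal_leI)
  also have "\<dots> = increment_ratio \<gamma> m f h x + increment_ratio \<gamma> m g h x"
    unfolding increment_ratio_def by (rule ennreal_plus) (simp_all add: comp_norm_nonneg)
  finally show ?thesis .
qed

lemma increment_ratio_scaleR:
  "increment_ratio \<gamma> m (\<lambda>x. c *\<^sub>R f x) h x = ennreal \<bar>c\<bar> * increment_ratio \<gamma> m f h x"
proof -
  have "increment (\<lambda>x. c *\<^sub>R f x) h x = c *\<^sub>R increment f h x"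
    by (simp add: increment_def model_Gamma_scaleR scaleR_diff_right)
  then show ?thesis
    by (simp add: increment_ratio_def comp_norm_scaleR ennreal_mult'[symmetric])
qed

text \<open>
  Minkowski's inequality, in \<open>x\<close> for fixed \<open>h\<close> and then in \<open>h\<close>.
\<close>

lemma mod_dist_fun_norm_add:
  assumes p: "1 \<le> p" and f: "mod_dist_rep \<gamma> f" and g: "mod_dist_rep \<gamma> g"
  shows "mod_dist_fun_norm \<gamma> p (\<lambda>x. f x + g x) \<le> mod_dist_fun_norm \<gamma> p f + mod_dist_fun_norm \<gamma> p g"
proof -
  have 1: "Lp_norm p lborel (\<lambda>x. ennreal (comp_norm m (f x + g x)))
      \<le> Lp_norm p lborel (\<lambda>x. ennreal (comp_norm m (f x))) + Lp_norm p lborel (\<lambda>x. ennreal (comp_norm m (g x)))" for m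
    using measurable_mod_dist_comp_norm[OF f] measurable_mod_dist_comp_norm[OF g]
    by (intro Lp_norm_add_le[OF p])
      (auto simp: ennreal_plus[symmetric] comp_norm_nonneg simp del: ennreal_plus intro!: ennreal_leI comp_norm_add)
  have 2: "Lp_norm p lborel (increment_ratio \<gamma> m (\<lambda>x. f x + g x) h)
      \<le> Lp_norm p lborel (increment_ratio \<gamma> m f h) + Lp_norm p lborel (increment_ratio \<gamma> m g h)" for m h
    by (intro Lp_norm_add_le[OF p] measurable_increment_ratio_snd f g increment_ratio_add)
  have 3: "Lp_norm 2 increment_measure (\<lambda>h. Lp_norm p lborel (increment_ratio \<gamma> m (\<lambda>x. f x + g x) h))
      \<le> Lp_norm 2 increment_measure (\<lambda>h. Lp_norm p lborel (increment_ratio \<gamma> m f h))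
       + Lp_norm 2 increment_measure (\<lambda>h. Lp_norm p lborel (increment_ratio \<gamma> m g h))" for m
    by (intro Lp_norm_add_le measurable_Lp_norm_increment_ratio f g 2) auto
  show ?thesis
    unfolding mod_dist_fun_norm_eq
    using add_mono[OF sum_mono[OF 1] sum_mono[OF 3]]
    by (simp add: sum.distrib add_ac)
qed

lemma mod_dist_fun_norm_scaleR:
  assumes p: "0 < p" and f: "mod_dist_rep \<gamma> f"
  shows "mod_dist_fun_norm \<gamma> p (\<lambda>x. c *\<^sub>R f x) = ennreal \<bar>c\<bar> * mod_dist_fun_norm \<gamma> p f"
proof -
  have 1: "Lp_norm p lborel (\<lambda>x. ennreal (comp_norm m (c *\<^sub>R f x)))
      = ennreal \<bar>c\<bar> * Lp_norm p lborel (\<lambda>x. ennreal (comp_norm m (f x)))" for m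
    using Lp_norm_cmult[OF p _ measurable_mod_dist_comp_norm[OF f], of "\<bar>c\<bar>" m]
    by (simp add: comp_norm_scaleR ennreal_mult')
  have 2: "Lp_norm p lborel (increment_ratio \<gamma> m (\<lambda>x. c *\<^sub>R f x) h)
      = ennreal \<bar>c\<bar> * Lp_norm p lborel (increment_ratio \<gamma> m f h)" for m h
    using Lp_norm_cmult[OF p _ measurable_increment_ratio_snd[OF f], of "\<bar>c\<bar>" m h]
    by (simp add: increment_ratio_scaleR[abs_def])
  show ?thesis
    unfolding mod_dist_fun_norm_eq 1 2
    by (subst Lp_norm_cmult) (auto intro: measurable_Lp_norm_increment_ratio[OF f]
        simp: distrib_left sum_distrib_left)
qed

text \<open>
  The components of degree below \<open>\<gamma>\<close>, which vanish almost everywhere, are all there is.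
\<close>

lemma mod_dist_fun_norm_eq_0D:
  assumes f: "mod_dist_rep \<gamma> f" and 0: "mod_dist_fun_norm \<gamma> p f = 0"
  shows "AE x in lborel. f x = 0"
proof -
  have fin: "finite {m. real m < \<gamma>}"
    by (rule finite_subset[of _ "{..nat \<lceil>\<gamma>\<rceil>}"]) (auto, linarith)
  have "AE x in lborel. \<forall>m\<in>{m. real m < \<gamma>}. comp_norm m (f x) = 0"
  proof (subst AE_finite_all[OF fin], intro ballI)
    fix m assume "m \<in> {m. real m < \<gamma>}"
    then have "Lp_norm p lborel (\<lambda>x. ennreal (comp_norm m (f x))) = 0"
      using 0 fin by (auto simp: mod_dist_fun_norm_eq)
    from Lp_norm_eq_0D[OF measurable_mod_dist_comp_norm[OF f] this]
    show "AE x in lborel. comp_norm m (f x) = 0"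
      by eventually_elim (simp add: comp_norm_nonneg order_antisym ennreal_eq_0_iff)
  qed
  then show ?thesis
  proof eventually_elim
    case (elim x)
    show "f x = 0"
    proof (rule poly_mapping_eqI)
      fix k
      show "Poly_Mapping.lookup (f x) k = Poly_Mapping.lookup 0 k"
      proof (cases "k \<in> Poly_Mapping.keys (f x)")
        case True
        with f have "real (mdeg k) < \<gamma>" by (auto simp: mod_dist_rep_def)
        with elim have "comp_norm (mdeg k) (f x) = 0" by simp
        with True show ?thesis
          unfolding comp_norm_def by (subst (asm) sum_nonneg_eq_0_iff) auto
      qed (simp add: in_keys_iff)
    qed
  qed
qed

lemma carr_modelled_distributions:
  "carr (modelled_distributions \<gamma> p)
    = {abs_mod_dist f | f. mod_dist_rep \<gamma> f \<and> mod_dist_fun_norm \<gamma> p f < \<infinity>}"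
  unfolding modelled_distributions_def mod_dist_rep_def by (simp only: nspace.simps conj_assoc)

lemma carr_modelled_distributionsE:
  assumes "u \<in> carr (modelled_distributions \<gamma> p)"
  obtains f where "u = abs_mod_dist f" "mod_dist_rep \<gamma> f" "mod_dist_fun_norm \<gamma> p f < \<infinity>"
  using assms unfolding carr_modelled_distributions mem_Collect_eq by (elim exE conjE) (rule that)

lemma abs_mod_dist_carr:
  "mod_dist_rep \<gamma> f \<Longrightarrow> mod_dist_fun_norm \<gamma> p f < \<infinity> \<Longrightarrow>
    abs_mod_dist f \<in> carr (modelled_distributions \<gamma> p)"
  unfolding carr_modelled_distributions mem_Collect_eq by (intro exI[of _ f] conjI refl)

lemma nrm_abs_mod_dist:
  "nrm (modelled_distributions \<gamma> p) (abs_mod_dist f) = enn2real (mod_dist_fun_norm \<gamma> p f)"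
  by (simp add: modelled_distributions_def mod_dist_norm.abs_eq)

lemma mod_dist_rep_0: "mod_dist_rep \<gamma> (\<lambda>_. 0)"
  by (simp add: mod_dist_rep_def)

lemma mod_dist_rep_add: "mod_dist_rep \<gamma> f \<Longrightarrow> mod_dist_rep \<gamma> g \<Longrightarrow> mod_dist_rep \<gamma> (\<lambda>x. f x + g x)"
  unfolding mod_dist_rep_def by (auto simp: lookup_add intro!: borel_measurable_add dest!: subsetD[OF keys_add])

lemma mod_dist_rep_scaleR: "mod_dist_rep \<gamma> f \<Longrightarrow> mod_dist_rep \<gamma> (\<lambda>x. c *\<^sub>R f x)"
  unfolding mod_dist_rep_def by (auto simp: lookup_scaleR intro!: borel_measurable_times dest!: subsetD[OF keys_scaleR])

lemma normed_carrier_modelled_distributions: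
  assumes p: "1 \<le> p"
  shows "normed_carrier (modelled_distributions \<gamma> p :: ('d::finite) mod_dist nspace)"
proof -
  let ?D = "modelled_distributions \<gamma> p :: 'd mod_dist nspace"
  have add: "u + v \<in> carr ?D \<and> nrm ?D (u + v) \<le> nrm ?D u + nrm ?D v"
    if uv: "u \<in> carr ?D" "v \<in> carr ?D" for u v
  proof -
    obtain f where f: "u = abs_mod_dist f" "mod_dist_rep \<gamma> f" "mod_dist_fun_norm \<gamma> p f < \<infinity>"
      using uv(1) by (rule carr_modelled_distributionsE)
    obtain g where g: "v = abs_mod_dist g" "mod_dist_rep \<gamma> g" "mod_dist_fun_norm \<gamma> p g < \<infinity>"
      using uv(2) by (rule carr_modelled_distributionsE)
    note le = mod_dist_fun_norm_add[OF p f(2) g(2)]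
    have fin: "mod_dist_fun_norm \<gamma> p f + mod_dist_fun_norm \<gamma> p g < \<infinity>" using f g by simp
    have "abs_mod_dist (\<lambda>x. f x + g x) \<in> carr ?D"
      using le_less_trans[OF le fin] by (intro abs_mod_dist_carr mod_dist_rep_add f g)
    moreover have "enn2real (mod_dist_fun_norm \<gamma> p (\<lambda>x. f x + g x))
        \<le> enn2real (mod_dist_fun_norm \<gamma> p f + mod_dist_fun_norm \<gamma> p g)"
      using le fin by (intro enn2real_mono) auto
    ultimately show ?thesis
      using f g by (simp add: plus_mod_dist.abs_eq nrm_abs_mod_dist enn2real_plus)
  qed
  have scale: "c *\<^sub>R u \<in> carr ?D \<and> nrm ?D (c *\<^sub>R u) = \<bar>c\<bar> * nrm ?D u" if u: "u \<in> carr ?D" for c u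
  proof -
    obtain f where f: "u = abs_mod_dist f" "mod_dist_rep \<gamma> f" "mod_dist_fun_norm \<gamma> p f < \<infinity>"
      using u by (rule carr_modelled_distributionsE)
    have eq: "mod_dist_fun_norm \<gamma> p (\<lambda>x. c *\<^sub>R f x) = ennreal \<bar>c\<bar> * mod_dist_fun_norm \<gamma> p f"
      using p by (intro mod_dist_fun_norm_scaleR f) auto
    have "abs_mod_dist (\<lambda>x. c *\<^sub>R f x) \<in> carr ?D"
      using f eq by (intro abs_mod_dist_carr mod_dist_rep_scaleR) (auto simp: ennreal_mult_less_top)
    then show ?thesis
      using f eq by (simp add: scaleR_mod_dist.abs_eq nrm_abs_mod_dist enn2real_mult)
  qed
  show ?thesis
  proof
    have "increment_ratio \<gamma> m (\<lambda>_. 0 :: 'd mpoly) = (\<lambda>_ _. 0)" for m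
      by (simp add: fun_eq_iff increment_ratio_def increment_def model_Gamma_def mp_translate_def)
    then have "mod_dist_fun_norm \<gamma> p (\<lambda>_. 0 :: 'd mpoly) = 0"
      by (simp add: mod_dist_fun_norm_eq)
    then have "(0 :: 'd mod_dist) \<in> carr ?D"
      unfolding zero_mod_dist.abs_eq by (intro abs_mod_dist_carr mod_dist_rep_0) simp
    then show "subspace (carr ?D)"
      using add scale by (auto intro: subspaceI)
    show "u = 0" if u: "u \<in> carr ?D" and 0: "nrm ?D u = 0" for u
    proof -
      obtain f where f: "u = abs_mod_dist f" "mod_dist_rep \<gamma> f" "mod_dist_fun_norm \<gamma> p f < \<infinity>"
        using u by (rule carr_modelled_distributionsE)
      then have "mod_dist_fun_norm \<gamma> p f = 0"
        using 0 by (auto simp: nrm_abs_mod_dist enn2real_eq_0_iff)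
      from mod_dist_fun_norm_eq_0D[OF f(2) this] show ?thesis
        unfolding f(1) zero_mod_dist.abs_eq by (simp add: mod_dist.abs_eq_iff)
    qed
  qed (use add scale in \<open>auto simp: modelled_distributions_def\<close>)
qed

section \<open>Conjugation of operators by an isomorphism\<close>

lemma nn_integral_interval_square_le:
  assumes C: "0 < C" and le: "\<And>t. 0 < t \<Longrightarrow> \<bar>u t\<bar> \<le> C * v t"
  shows "(\<integral>\<^sup>+t\<in>{0<..}. ennreal ((u t)\<^sup>2 / t) \<partial>lborel)
    \<le> ennreal (C\<^sup>2) * (\<integral>\<^sup>+t\<in>{0<..}. ennreal ((v t)\<^sup>2 / t) \<partial>lborel)"
proof -
  have "ennreal ((u t)\<^sup>2 / t) * indicator {0<..} t
      \<le> ennreal (C\<^sup>2) * (ennreal ((v t)\<^sup>2 / t) * indicator {0<..} t)" for t :: real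
  proof (cases "0 < t")
    case True
    from le[OF True] have "\<bar>u t\<bar>\<^sup>2 \<le> (C * v t)\<^sup>2" by (intro power_mono) auto
    then have "(u t)\<^sup>2 / t \<le> C\<^sup>2 * ((v t)\<^sup>2 / t)"
      using True by (simp add: power_mult_distrib divide_right_mono)
    then have "ennreal ((u t)\<^sup>2 / t) \<le> ennreal (C\<^sup>2 * ((v t)\<^sup>2 / t))" by (rule ennreal_leI)
    with True show ?thesis by (simp add: ennreal_mult[symmetric])
  qed auto
  then have "(\<integral>\<^sup>+t\<in>{0<..}. ennreal ((u t)\<^sup>2 / t) \<partial>lborel)
      \<le> (\<integral>\<^sup>+t. ennreal (C\<^sup>2) * (ennreal ((v t)\<^sup>2 / t) * indicator {0<..} t) \<partial>lborel)"
    by (intro nn_integral_mono)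
  also have "\<dots> \<le> ennreal (C\<^sup>2) * (\<integral>\<^sup>+t\<in>{0<..}. ennreal ((v t)\<^sup>2 / t) \<partial>lborel)"
    using C by (intro nn_integral_cmult_le) auto
  finally show ?thesis .
qed

text \<open>
  The norm of \<open>D\<^sub>A(1/2, 2)\<close> has the value 0 where the integral is infinite.  The two-sided
  comparison makes both integrals infinite at once, so the bound holds on all of \<open>carr V\<close>, and in
  particular on the span of \<open>D\<^sub>A(1/2, 2)\<close>.
\<close>

lemma DA_half_bounded_map:
  assumes lin: "linear f" and V: "subspace (carr V)" "\<And>x. x \<in> carr V \<Longrightarrow> f x \<in> carr U"
    and c: "0 < c" "\<And>x. x \<in> carr V \<Longrightarrow> DA_half_sq U A' (f x) \<le> ennreal (c\<^sup>2) * DA_half_sq V A x"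
    and d: "\<And>x. x \<in> carr V \<Longrightarrow> DA_half_sq V A x \<le> ennreal (d\<^sup>2) * DA_half_sq U A' (f x)"
  shows "bounded_map (DA_half V A) (DA_half U A') f"
  unfolding bounded_map_def
proof (intro conjI ballI exI[of _ c])
  show "f x \<in> carr (DA_half U A')" if "x \<in> carr (DA_half V A)" for x
    using that V(2) ennreal_mult_less_top_const[OF _ c(2)] by (auto simp: DA_half_def)
  fix x assume "x \<in> span (carr (DA_half V A))"
  moreover have "span (carr (DA_half V A)) \<subseteq> carr V"
    using V(1) by (intro span_minimal) (auto simp: DA_half_def)
  ultimately have x: "x \<in> carr V" by auto
  show "\<bar>nrm (DA_half U A') (f x)\<bar> \<le> c * nrm (DA_half V A) x"
  proof (cases "DA_half_sq V A x < \<infinity>")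
    case True
    have "enn2real (DA_half_sq U A' (f x)) \<le> enn2real (ennreal (c\<^sup>2) * DA_half_sq V A x)"
      using c(2)[OF x] True by (intro enn2real_mono) (auto simp: ennreal_mult_less_top)
    also have "\<dots> = c\<^sup>2 * enn2real (DA_half_sq V A x)" by (simp add: enn2real_mult)
    finally have "sqrt (enn2real (DA_half_sq U A' (f x))) \<le> sqrt (c\<^sup>2 * enn2real (DA_half_sq V A x))"
      by (rule real_sqrt_le_mono)
    then show ?thesis using c(1) by (simp add: DA_half_def real_sqrt_mult)
  next
    case False
    then have "DA_half_sq U A' (f x) = \<infinity>"
      using ennreal_mult_less_top_const[OF _ d[OF x]] by (metis infinity_ennreal_def less_top)
    then show ?thesis using False c(1) by (simp add: DA_half_def less_top[symmetric])
  qed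
qed (use lin c(1) in auto)

text \<open>
  Boundedness of \<open>R\<close> and of its inverse \<open>Q\<close> says that the norm of \<open>E\<close> is equivalent to the
  one transported from \<open>D\<close>.  Limits in \<open>E\<close> are therefore limits in \<open>D\<close>, where the triangle
  inequality is at hand.
\<close>

locale normed_isomorphism = D: normed_carrier D
  for D :: "'u::real_vector nspace" +
  fixes E :: "'v::real_vector nspace" and R :: "'u \<Rightarrow> 'v" and Q :: "'v \<Rightarrow> 'u"
  assumes R: "bounded_map D E R" and Q: "bounded_map E D Q"
    and QR: "x \<in> carr D \<Longrightarrow> Q (R x) = x" and RQ: "y \<in> carr E \<Longrightarrow> R (Q y) = y"
begin

lemmas linR = bounded_mapD(1)[OF R] and R_carr = bounded_mapD(2)[OF R]
  and linQ = bounded_mapD(1)[OF Q] and Q_carr = bounded_mapD(2)[OF Q]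

lemma subspace_E: "subspace (carr E)"
proof -
  have "carr E = R ` carr D"
    using R_carr Q_carr RQ by force
  then show ?thesis using linear_subspace_image[OF linR D.subspace_carr] by simp
qed

lemmas E_diff = subspace_diff[OF subspace_E] and E_scaleR = subspace_scale[OF subspace_E]
  and E_0 = subspace_0[OF subspace_E]

lemma R_bound:
  obtains C where "0 < C" "\<And>x. x \<in> carr D \<Longrightarrow> \<bar>nrm E (R x)\<bar> \<le> C * nrm D x"
  using R unfolding bounded_map_def by (metis span_base)

lemma Q_bound:
  obtains C where "0 < C" "\<And>y. y \<in> carr E \<Longrightarrow> nrm D (Q y) \<le> C * nrm E y"
  using Q unfolding bounded_map_def by (metis span_base abs_le_D1)

lemma nrm_E_le:
  obtains C where "0 < C" "\<And>y. y \<in> carr E \<Longrightarrow> \<bar>nrm E y\<bar> \<le> C * nrm D (Q y)"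
  using R_bound Q_carr RQ by metis

lemma tendsto_nrm_iff:
  assumes "\<And>k. u k \<in> carr E"
  shows "((\<lambda>k. nrm D (Q (u k))) \<longlongrightarrow> 0) \<F> \<longleftrightarrow> ((\<lambda>k. nrm E (u k)) \<longlongrightarrow> 0) \<F>"
proof
  obtain C where C: "0 < C" "\<And>y. y \<in> carr E \<Longrightarrow> \<bar>nrm E y\<bar> \<le> C * nrm D (Q y)"
    by (rule nrm_E_le) (rule that)
  assume "((\<lambda>k. nrm D (Q (u k))) \<longlongrightarrow> 0) \<F>"
  from tendsto_mult_left[OF this, of C]
  have "((\<lambda>k. C * nrm D (Q (u k))) \<longlongrightarrow> 0) \<F>" by simp
  then show "((\<lambda>k. nrm E (u k)) \<longlongrightarrow> 0) \<F>"
    by (rule Lim_null_comparison[OF always_eventually, rotated]) (simp add: C(2)[OF assms])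
next
  obtain C where C: "0 < C" "\<And>y. y \<in> carr E \<Longrightarrow> nrm D (Q y) \<le> C * nrm E y"
    by (rule Q_bound) (rule that)
  assume "((\<lambda>k. nrm E (u k)) \<longlongrightarrow> 0) \<F>"
  from tendsto_mult_left[OF this, of C]
  have "((\<lambda>k. C * nrm E (u k)) \<longlongrightarrow> 0) \<F>" by simp
  then show "((\<lambda>k. nrm D (Q (u k))) \<longlongrightarrow> 0) \<F>"
    by (rule Lim_null_comparison[OF always_eventually, rotated])
      (simp add: C(2)[OF assms] D.nrm_nonneg[OF Q_carr[OF assms]])
qed

lemma c0_semigroup_conj:
  assumes S: "c0_semigroup E S"
  shows "c0_semigroup D (\<lambda>t x. Q (S t (R x)))"
proof -
  note Sc = c0_semigroupD[OF S]
  obtain C where C: "0 < C" "\<And>x. x \<in> carr D \<Longrightarrow> \<bar>nrm E (R x)\<bar> \<le> C * nrm D x"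
    by (rule R_bound) (rule that)
  obtain C' where C': "0 < C'" "\<And>y. y \<in> carr E \<Longrightarrow> nrm D (Q y) \<le> C' * nrm E y"
    by (rule Q_bound) (rule that)
  obtain M w where M: "\<And>t x. 0 \<le> t \<Longrightarrow> x \<in> carr E \<Longrightarrow> nrm E (S t x) \<le> M * exp (w * t) * nrm E x"
    using S unfolding c0_semigroup_def by blast
  have bound: "nrm D (Q (S t (R x))) \<le> (C' * \<bar>M\<bar> * C) * exp (w * t) * nrm D x"
    if t: "0 \<le> t" and x: "x \<in> carr D" for t x
  proof -
    have "nrm D (Q (S t (R x))) \<le> C' * nrm E (S t (R x))"
      using t x R_carr Sc(2) by (intro C'(2)) auto
    also have "nrm E (S t (R x)) \<le> M * exp (w * t) * nrm E (R x)"
      using t x R_carr by (intro M) auto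
    also have "\<dots> \<le> \<bar>M * exp (w * t) * nrm E (R x)\<bar>" by (rule abs_ge_self)
    also have "\<dots> = \<bar>M\<bar> * exp (w * t) * \<bar>nrm E (R x)\<bar>" by (simp add: abs_mult)
    also have "\<dots> \<le> \<bar>M\<bar> * exp (w * t) * (C * nrm D x)"
      by (intro mult_left_mono C(2) x) auto
    finally show ?thesis using C'(1) by (simp add: mult_ac)
  qed
  show ?thesis
    unfolding c0_semigroup_def
  proof (intro conjI allI impI ballI)
    fix t :: real assume t: "0 \<le> t"
    show "bounded_op D D (\<lambda>x. Q (S t (R x)))"
      unfolding bounded_op_def
    proof (intro conjI allI ballI exI)
      show "nrm D (Q (S t (R x))) \<le> ((C' * \<bar>M\<bar> * C) * exp (w * t)) * nrm D x" if "x \<in> carr D" for x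
        by (rule bound[OF t that])
    qed (use t Sc(1)[OF t] R_carr Q_carr in
        \<open>auto simp: bounded_op_def linear_add[OF linR] linear_add[OF linQ] linear_cmul[OF linR] linear_cmul[OF linQ]\<close>)
  next
    fix x assume x: "x \<in> carr D"
    have "((\<lambda>t. nrm E (S t (R x) - R x)) \<longlongrightarrow> 0) (at_right 0)"
      by (rule Sc(5)[OF R_carr[OF x]])
    then have "((\<lambda>t. nrm E (S \<bar>t\<bar> (R x) - R x)) \<longlongrightarrow> 0) (at_right 0)"
      by (rule Lim_transform_eventually) (auto simp: eventually_at_filter)
    then have "((\<lambda>t. nrm D (Q (S \<bar>t\<bar> (R x) - R x))) \<longlongrightarrow> 0) (at_right 0)"
      using x R_carr Sc(2) by (subst tendsto_nrm_iff) (auto intro: E_diff)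
    then show "((\<lambda>t. nrm D (Q (S t (R x)) - x)) \<longlongrightarrow> 0) (at_right 0)"
      by (rule Lim_transform_eventually)
        (use x in \<open>auto simp: eventually_at_filter linear_diff[OF linQ] QR\<close>)
  next
    show "\<exists>M w. \<forall>t\<ge>0. \<forall>x\<in>carr D. nrm D (Q (S t (R x))) \<le> M * exp (w * t) * nrm D x"
      using bound by blast
  qed (use Sc R_carr in \<open>auto simp: QR RQ\<close>)
qed

lemma has_generator_conj:
  assumes S: "c0_semigroup E S" "has_generator E S G"
    and dom: "op_dom G' = {x\<in>carr D. R x \<in> op_dom G}"
    and app: "\<And>x. x \<in> op_dom G' \<Longrightarrow> op_app G' x = Q (op_app G (R x))"
  shows "has_generator D (\<lambda>t x. Q (S t (R x))) G'"
proof -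
  note Sc = c0_semigroupD[OF S(1)] and Sg = has_generatorD[OF S(2)]
  \<comment> \<open>The absolute value keeps the quotient in \<open>E\<close> for negative \<open>h\<close> too, where \<open>S h\<close> is arbitrary.\<close>
  have lim_iff: "((\<lambda>h. nrm D ((Q (S h (R x)) - x) /\<^sub>R h - y)) \<longlongrightarrow> 0) (at_right 0) \<longleftrightarrow>
      ((\<lambda>h. nrm E ((S h (R x) - R x) /\<^sub>R h - R y)) \<longlongrightarrow> 0) (at_right 0)"
    if x: "x \<in> carr D" and y: "y \<in> carr D" for x y
  proof -
    have "((\<lambda>h. nrm D ((Q (S h (R x)) - x) /\<^sub>R h - y)) \<longlongrightarrow> 0) (at_right 0) \<longleftrightarrow>
        ((\<lambda>h. nrm D (Q ((S \<bar>h\<bar> (R x) - R x) /\<^sub>R h - R y))) \<longlongrightarrow> 0) (at_right 0)"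
      by (rule tendsto_cong)
        (use x y in \<open>auto simp: eventually_at_filter linear_diff[OF linQ] linear_cmul[OF linQ] QR\<close>)
    also have "\<dots> \<longleftrightarrow> ((\<lambda>h. nrm E ((S \<bar>h\<bar> (R x) - R x) /\<^sub>R h - R y)) \<longlongrightarrow> 0) (at_right 0)"
      using x y R_carr Sc(2) by (intro tendsto_nrm_iff E_diff E_scaleR) auto
    also have "\<dots> \<longleftrightarrow> ((\<lambda>h. nrm E ((S h (R x) - R x) /\<^sub>R h - R y)) \<longlongrightarrow> 0) (at_right 0)"
      by (rule tendsto_cong) (auto simp: eventually_at_filter)
    finally show ?thesis .
  qed
  show ?thesis
    unfolding has_generator_def Let_def
  proof (intro conjI set_eqI iffI ballI)
    fix x assume x: "x \<in> op_dom G'"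
    then have xD: "x \<in> carr D" "R x \<in> op_dom G" by (auto simp: dom)
    then have "Q (op_app G (R x)) \<in> carr D" using Sg(2) Q_carr by auto
    moreover have "((\<lambda>h. nrm D ((Q (S h (R x)) - x) /\<^sub>R h - Q (op_app G (R x)))) \<longlongrightarrow> 0) (at_right 0)"
      using xD calculation Sg(2,3)[OF xD(2)] by (subst lim_iff) (auto simp: RQ)
    ultimately show "op_app G' x \<in> carr D"
      "((\<lambda>h. nrm D ((Q (S h (R x)) - x) /\<^sub>R h - op_app G' x)) \<longlongrightarrow> 0) (at_right 0)"
      by (auto simp: app[OF x])
    then show "x \<in> {x \<in> carr D. \<exists>y. y \<in> carr D \<and>
        ((\<lambda>h. nrm D ((Q (S h (R x)) - x) /\<^sub>R h - y)) \<longlongrightarrow> 0) (at_right 0)}"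
      using xD by blast
  next
    fix x assume "x \<in> {x \<in> carr D. \<exists>y. y \<in> carr D \<and>
        ((\<lambda>h. nrm D ((Q (S h (R x)) - x) /\<^sub>R h - y)) \<longlongrightarrow> 0) (at_right 0)}"
    then obtain y where xy: "x \<in> carr D" "y \<in> carr D"
      "((\<lambda>h. nrm D ((Q (S h (R x)) - x) /\<^sub>R h - y)) \<longlongrightarrow> 0) (at_right 0)" by blast
    then have "R x \<in> op_dom G"
      using lim_iff[OF xy(1,2)] by (intro Sg(4)[of "R x" "R y"] R_carr) auto
    with xy(1) show "x \<in> op_dom G'" by (simp add: dom)
  qed
qed

text \<open>
  The norm of the complexification is a supremum, which bounds its terms only if they are bounded
  above.  Comparison with the norm of \<open>D\<close> shows that they are.
\<close>

lemma complexify_fst_le: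
  assumes "z \<in> carr (complexify E)"
  shows "nrm E (fst z) \<le> nrm (complexify E) z"
proof -
  obtain C where C: "0 < C" "\<And>y. y \<in> carr E \<Longrightarrow> \<bar>nrm E y\<bar> \<le> C * nrm D (Q y)"
    by (rule nrm_E_le) (rule that)
  obtain a b where z: "z = (a, b)" and ab: "a \<in> carr E" "b \<in> carr E"
    using assms by (auto simp: complexify_def)
  have "nrm E (fst (cscale (cis \<theta>) z)) \<le> C * (nrm D (Q a) + nrm D (Q b))" for \<theta>
  proof -
    have "\<bar>nrm E (cos \<theta> *\<^sub>R a - sin \<theta> *\<^sub>R b)\<bar> \<le> C * nrm D (Q (cos \<theta> *\<^sub>R a - sin \<theta> *\<^sub>R b))"
      using ab by (intro C(2) E_diff E_scaleR)
    also have "Q (cos \<theta> *\<^sub>R a - sin \<theta> *\<^sub>R b) = cos \<theta> *\<^sub>R Q a + (- sin \<theta>) *\<^sub>R Q b"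
      by (simp add: linear_diff[OF linQ] linear_cmul[OF linQ])
    also have "nrm D \<dots> \<le> nrm D (cos \<theta> *\<^sub>R Q a) + nrm D ((- sin \<theta>) *\<^sub>R Q b)"
      using ab Q_carr by (intro D.nrm_triangle D.carr_scaleR) auto
    also have "\<dots> = \<bar>cos \<theta>\<bar> * nrm D (Q a) + \<bar>sin \<theta>\<bar> * nrm D (Q b)"
      using ab Q_carr by (simp only: D.nrm_scaleR abs_minus_cancel)
    also have "\<dots> \<le> 1 * nrm D (Q a) + 1 * nrm D (Q b)"
      using ab Q_carr D.nrm_nonneg by (intro add_mono mult_right_mono) auto
    finally show ?thesis using C(1) by (simp add: z cscale_def)
  qed
  then have "bdd_above (range (\<lambda>\<theta>. nrm E (fst (cscale (cis \<theta>) z))))"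
    by (intro bdd_aboveI) auto
  from cSUP_upper[OF _ this, of 0] show ?thesis
    by (simp add: complexify_def cscale_def)
qed

text \<open>
  Complex differentiability at \<open>t > 0\<close>, restricted to real increments, is differentiability of the
  orbit at \<open>t\<close>.
\<close>

lemma analytic_semigroup_in_domain:
  assumes S: "analytic_semigroup E S" "has_generator E S G"
    and t: "0 < t" and x: "x \<in> carr E"
  shows "S t x \<in> op_dom G"
proof -
  obtain \<delta> H where \<delta>: "0 < \<delta>"
    and Hr: "\<And>t x. 0 < t \<Longrightarrow> x \<in> carr E \<Longrightarrow> H (of_real t) (x, 0) = (S t x, 0)"
    and Hd: "\<And>z x. z \<in> sector \<delta> \<Longrightarrow> x \<in> carr (complexify E) \<Longrightarrow> \<exists>y\<in>carr (complexify E).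
           ((\<lambda>h. nrm (complexify E) (cscale (inverse h) (H (z + h) x - H z x) - y)) \<longlongrightarrow> 0) (at 0)"
    using S(1) unfolding analytic_semigroup_def by blast
  have c0: "c0_semigroup E S" using S(1) by (simp add: analytic_semigroup_def)
  note Sc = c0_semigroupD[OF c0]
  have "complex_of_real t \<in> sector \<delta>" using t \<delta> by (simp add: sector_def Arg_of_real)
  moreover have x0: "(x, 0) \<in> carr (complexify E)" using x E_0 by (simp add: complexify_def)
  ultimately obtain y where y: "y \<in> carr (complexify E)" and lim:
      "((\<lambda>h. nrm (complexify E) (cscale (inverse h) (H (of_real t + h) (x, 0) - H (of_real t) (x, 0)) - y)) \<longlongrightarrow> 0) (at 0)"
    using Hd by blast
  have "filterlim complex_of_real (at 0) (at_right 0)"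
    unfolding filterlim_at by (auto simp: eventually_at_filter intro!: tendsto_eq_intros)
  from filterlim_compose[OF lim this]
  have lim': "((\<lambda>h. nrm (complexify E)
      (cscale (inverse (of_real h)) (H (of_real t + of_real h) (x, 0) - H (of_real t) (x, 0)) - y)) \<longlongrightarrow> 0) (at_right 0)" .
  obtain C' where C': "0 < C'" "\<And>y. y \<in> carr E \<Longrightarrow> nrm D (Q y) \<le> C' * nrm E y"
    by (rule Q_bound) (rule that)
  have nonneg: "0 \<le> nrm E u" if u: "u \<in> carr E" for u
    using C'(2)[OF u] D.nrm_nonneg[OF Q_carr[OF u]] C'(1) by (auto simp: zero_le_mult_iff dest: order_trans)
  have "((\<lambda>h. nrm E ((S h (S t x) - S t x) /\<^sub>R h - fst y)) \<longlongrightarrow> 0) (at_right 0)"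
  proof (rule Lim_null_comparison[OF _ lim'])
    show "\<forall>\<^sub>F h in at_right 0. norm (nrm E ((S h (S t x) - S t x) /\<^sub>R h - fst y))
      \<le> nrm (complexify E)
      (cscale (inverse (of_real h)) (H (of_real t + of_real h) (x, 0) - H (of_real t) (x, 0)) - y)"
      using eventually_at_right_less[of "0::real"]
    proof eventually_elim
      case (elim h)
      let ?u = "((S h (S t x) - S t x) /\<^sub>R h, 0) - y"
      have "S (t + h) x = S h (S t x)" using Sc(4)[of h t x] elim t x by (simp add: add.commute)
      then have "cscale (inverse (of_real h)) (H (of_real t + of_real h) (x, 0) - H (of_real t) (x, 0)) - y = ?u"
        using Hr[of "t + h" x] Hr[of t x] elim t x
        by (simp add: cscale_def of_real_inverse[symmetric] del: of_real_inverse)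
      moreover have u: "?u \<in> carr (complexify E)"
        using y elim t x Sc(2) E_0 by (cases y) (auto simp: complexify_def intro!: E_diff E_scaleR subspace_neg[OF subspace_E])
      moreover have "0 \<le> nrm E (fst ?u)"
      proof (rule nonneg)
        show "fst ?u \<in> carr E"
          using u by (simp add: complexify_def mem_Times_iff)
      qed
      ultimately show ?case using complexify_fst_le[OF u] by simp
    qed
  qed
  with y show ?thesis
    by (intro has_generatorD(4)[OF S(2), of _ "fst y"]) (use t x Sc(2) in \<open>auto simp: complexify_def\<close>)
qed

end

text \<open>
  \<open>A'\<close> is \<open>Q \<circ> A \<circ> R\<close>, and \<open>S\<close> is some analytic semigroup generated by \<open>- A\<close>.  The
  operators \<open>exp (- t A)\<close> are chosen among the semigroups with that generator and may, before
  uniqueness is applied, be different from \<open>S\<close>.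
\<close>

locale conjugate_generators = normed_isomorphism D E R Q
  for D :: "'u::real_vector nspace" and E :: "'v::real_vector nspace" and R Q +
  fixes A :: "'v unbounded_op" and A' :: "'u unbounded_op" and S :: "real \<Rightarrow> 'v \<Rightarrow> 'v"
  assumes S: "analytic_semigroup E S" "has_generator E S (neg_op A)"
    and A'_dom: "op_dom A' = {x\<in>carr D. R x \<in> op_dom A}"
    and A'_app: "x \<in> op_dom A' \<Longrightarrow> op_app A' x = Q (op_app A (R x))"
begin

lemma A_carr: "x \<in> op_dom A \<Longrightarrow> op_app A x \<in> carr E"
  using has_generatorD(2)[OF S(2), of x] E_scaleR[of "- op_app A x" "-1"] by (simp add: neg_op_def)

lemma A_dom_carr: "x \<in> op_dom A \<Longrightarrow> x \<in> carr E"
  using has_generatorD(1)[OF S(2), of x] by (simp add: neg_op_def)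

lemma c0_S: "c0_semigroup E S"
  using S(1) by (simp add: analytic_semigroup_def)

lemma exp_op_semigroup:
  "c0_semigroup E (exp_op E A)" "has_generator E (exp_op E A) (neg_op A)"
  using someI[of "\<lambda>S. c0_semigroup E S \<and> has_generator E S (neg_op A)" S] c0_S S(2)
  unfolding exp_op_def by auto

lemma conj_semigroup:
  assumes "c0_semigroup E S'" "has_generator E S' (neg_op A)"
  shows "c0_semigroup D (\<lambda>t x. Q (S' t (R x)))" "has_generator D (\<lambda>t x. Q (S' t (R x))) (neg_op A')"
  by (rule c0_semigroup_conj[OF assms(1)])
    (rule has_generator_conj[OF assms]; simp add: neg_op_def A'_dom A'_app linear_neg[OF linQ])

lemma exp_op_conj_semigroup:
  "c0_semigroup D (exp_op D A')" "has_generator D (exp_op D A') (neg_op A')"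
  using someI[of "\<lambda>S. c0_semigroup D S \<and> has_generator D S (neg_op A')", OF conjI[OF conj_semigroup[OF c0_S S(2)]]]
  unfolding exp_op_def by auto

lemma dense_domain:
  assumes x: "x \<in> carr D" and e: "0 < e"
  shows "\<exists>y\<in>op_dom (neg_op A'). nrm D (y - x) < e"
proof -
  note Sc = c0_semigroupD[OF c0_S]
  have "((\<lambda>t. nrm D (Q (S t (R x)) - x)) \<longlongrightarrow> 0) (at_right 0)"
    using c0_semigroupD(5)[OF c0_semigroup_conj[OF c0_S] x] .
  then have "\<forall>\<^sub>F t in at_right 0. nrm D (Q (S t (R x)) - x) < e"
    by (rule order_tendstoD) (use e in auto)
  with eventually_at_right_less[of "0::real"]
  have "\<forall>\<^sub>F t in at_right 0. 0 < t \<and> nrm D (Q (S t (R x)) - x) < e"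
    by eventually_elim simp
  then obtain t where t: "0 < t" "nrm D (Q (S t (R x)) - x) < e"
    using eventually_happens'[of "at_right (0::real)"] by auto
  have "S t (R x) \<in> op_dom A"
    using analytic_semigroup_in_domain[OF S t(1) R_carr[OF x]] by (simp add: neg_op_def)
  then have "Q (S t (R x)) \<in> op_dom (neg_op A')"
    using Q_carr A_dom_carr by (simp add: neg_op_def A'_dom RQ)
  with t show ?thesis by blast
qed

lemma exp_op_conj:
  assumes t: "0 \<le> t" and x: "x \<in> carr D"
  shows "exp_op D A' t x = Q (exp_op E A t (R x))"
  by (rule D.semigroup_unique[OF exp_op_conj_semigroup conj_semigroup[OF exp_op_semigroup] dense_domain x t])

text \<open>
  \<open>S\<close> and \<open>exp_op E A\<close> have the same generator on \<open>E\<close>; conjugated to \<open>D\<close>, where uniqueness is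
  available, they agree.  So the smoothing of \<open>S\<close> is inherited.
\<close>

lemma exp_op_in_domain:
  assumes t: "0 < t" and x: "x \<in> carr E"
  shows "exp_op E A t x \<in> op_dom A"
proof -
  note Sc = c0_semigroupD[OF c0_S] and Ec = c0_semigroupD[OF exp_op_semigroup(1)]
  have "Q (S t (R (Q x))) = Q (exp_op E A t (R (Q x)))"
    by (rule D.semigroup_unique[OF conj_semigroup[OF c0_S S(2)] conj_semigroup[OF exp_op_semigroup] dense_domain])
      (use t x Q_carr in auto)
  then have "R (Q (S t x)) = R (Q (exp_op E A t x))" using x by (simp add: RQ)
  then have "S t x = exp_op E A t x" using t x Sc(2) Ec(2) by (simp add: RQ)
  with analytic_semigroup_in_domain[OF S t x] show ?thesis by (simp add: neg_op_def)
qed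

lemma DA_half_integrand_conj:
  assumes t: "0 < t" and y: "y \<in> carr E"
  shows "c *\<^sub>R op_app A (exp_op E A t y) \<in> carr E"
    and "c *\<^sub>R op_app A' (exp_op D A' t (Q y)) = Q (c *\<^sub>R op_app A (exp_op E A t y))"
proof -
  have y': "exp_op E A t y \<in> op_dom A" by (rule exp_op_in_domain[OF t y])
  show "c *\<^sub>R op_app A (exp_op E A t y) \<in> carr E"
    by (intro E_scaleR A_carr y')
  have "exp_op D A' t (Q y) = Q (exp_op E A t y)"
    using t y Q_carr by (simp add: exp_op_conj RQ)
  moreover have "Q (exp_op E A t y) \<in> op_dom A'"
    using y' A_dom_carr Q_carr by (simp add: A'_dom RQ)
  ultimately show "c *\<^sub>R op_app A' (exp_op D A' t (Q y)) = Q (c *\<^sub>R op_app A (exp_op E A t y))"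
    using y' A_dom_carr by (simp add: A'_app RQ linear_cmul[OF linQ])
qed

lemma DA_half_sq_conj_le:
  obtains c where "0 < c" "\<And>y. y \<in> carr E \<Longrightarrow> DA_half_sq D A' (Q y) \<le> ennreal (c\<^sup>2) * DA_half_sq E A y"
proof -
  obtain C where C: "0 < C" "\<And>y. y \<in> carr E \<Longrightarrow> nrm D (Q y) \<le> C * nrm E y"
    by (rule Q_bound) (rule that)
  have "DA_half_sq D A' (Q y) \<le> ennreal (C\<^sup>2) * DA_half_sq E A y" if y: "y \<in> carr E" for y
    unfolding DA_half_sq_def
  proof (rule nn_integral_interval_square_le[OF C(1)])
    fix t :: real assume t: "0 < t"
    note i = DA_half_integrand_conj[OF t y, of "t powr (1/2)"]
    show "\<bar>nrm D (t powr (1/2) *\<^sub>R op_app A' (exp_op D A' t (Q y)))\<bar>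
        \<le> C * nrm E (t powr (1/2) *\<^sub>R op_app A (exp_op E A t y))"
      unfolding i(2) using C(2)[OF i(1)] D.nrm_nonneg[OF Q_carr[OF i(1)]] by simp
  qed
  with C(1) show ?thesis by (rule that)
qed

lemma DA_half_sq_le_conj:
  obtains c where "0 < c" "\<And>y. y \<in> carr E \<Longrightarrow> DA_half_sq E A y \<le> ennreal (c\<^sup>2) * DA_half_sq D A' (Q y)"
proof -
  obtain C where C: "0 < C" "\<And>y. y \<in> carr E \<Longrightarrow> \<bar>nrm E y\<bar> \<le> C * nrm D (Q y)"
    by (rule nrm_E_le) (rule that)
  have "DA_half_sq E A y \<le> ennreal (C\<^sup>2) * DA_half_sq D A' (Q y)" if y: "y \<in> carr E" for y
    unfolding DA_half_sq_def
  proof (rule nn_integral_interval_square_le[OF C(1)])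
    fix t :: real assume t: "0 < t"
    note i = DA_half_integrand_conj[OF t y, of "t powr (1/2)"]
    show "\<bar>nrm E (t powr (1/2) *\<^sub>R op_app A (exp_op E A t y))\<bar>
        \<le> C * nrm D (t powr (1/2) *\<^sub>R op_app A' (exp_op D A' t (Q y)))"
      unfolding i(2) by (rule C(2)[OF i(1)])
  qed
  with C(1) show ?thesis by (rule that)
qed

lemma bounded_map_DA_half_Q: "bounded_map (DA_half E A) (DA_half D A') Q"
proof -
  obtain c where "0 < c" "\<And>y. y \<in> carr E \<Longrightarrow> DA_half_sq D A' (Q y) \<le> ennreal (c\<^sup>2) * DA_half_sq E A y"
    by (rule DA_half_sq_conj_le) (rule that)
  moreover obtain d where "0 < d" "\<And>y. y \<in> carr E \<Longrightarrow> DA_half_sq E A y \<le> ennreal (d\<^sup>2) * DA_half_sq D A' (Q y)"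
    by (rule DA_half_sq_le_conj) (rule that)
  ultimately show ?thesis
    by (intro DA_half_bounded_map[of Q E D c A' A d] linQ subspace_E Q_carr)
qed

lemma bounded_map_DA_half_R: "bounded_map (DA_half D A') (DA_half E A) R"
proof -
  obtain c where "0 < c" "\<And>y. y \<in> carr E \<Longrightarrow> DA_half_sq D A' (Q y) \<le> ennreal (c\<^sup>2) * DA_half_sq E A y"
    by (rule DA_half_sq_conj_le) (rule that)
  moreover obtain d where "0 < d" "\<And>y. y \<in> carr E \<Longrightarrow> DA_half_sq E A y \<le> ennreal (d\<^sup>2) * DA_half_sq D A' (Q y)"
    by (rule DA_half_sq_le_conj) (rule that)
  ultimately show ?thesis
    using R_carr QR
    by (intro DA_half_bounded_map[of R D E d A A' c] linR D.subspace_carr R_carr) (metis R_carr QR)+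
qed

lemma A'_Q:
  assumes x: "x \<in> op_dom A"
  shows "Q x \<in> op_dom A'" and "op_app A' (Q x) = Q (op_app A x)"
proof -
  note c = A_dom_carr[OF x]
  show dom: "Q x \<in> op_dom A'" using x c Q_carr by (simp add: A'_dom RQ)
  show "op_app A' (Q x) = Q (op_app A x)" using A'_app[OF dom] c by (simp add: RQ)
qed

lemma subspace_dom_A': "subspace (op_dom A')"
  using D.subspace_generator_domain[OF exp_op_conj_semigroup] by (simp add: neg_op_def)

lemma subspace_dom_A: "subspace (op_dom A)"
proof -
  have "op_dom A = R ` op_dom A'"
  proof (intro equalityI subsetI)
    fix x assume "x \<in> op_dom A"
    with A'_Q[OF this] A_dom_carr show "x \<in> R ` op_dom A'"
      by (intro image_eqI[of _ _ "Q x"]) (auto simp: RQ)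
  qed (auto simp: A'_dom)
  then show ?thesis using linear_subspace_image[OF linR subspace_dom_A'] by simp
qed

lemma bounded_map_domain_Q: "bounded_map (domain_space E A) (domain_space D A') Q"
proof -
  obtain C where C: "0 < C" "\<And>y. y \<in> carr E \<Longrightarrow> nrm D (Q y) \<le> C * nrm E y"
    by (rule Q_bound) (rule that)
  have "\<bar>nrm D (Q x) + nrm D (op_app A' (Q x))\<bar> \<le> C * (nrm E x + nrm E (op_app A x))"
    if x: "x \<in> op_dom A" for x
  proof -
    note c = A_dom_carr[OF x] A_carr[OF x]
    show ?thesis
      using C(2)[OF c(1)] C(2)[OF c(2)] D.nrm_nonneg[OF Q_carr[OF c(1)]] D.nrm_nonneg[OF Q_carr[OF c(2)]]
        A'_Q[OF x] by (simp add: distrib_left)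
  qed
  with C(1) show ?thesis
    unfolding bounded_map_def domain_space_def
    using A'_Q linQ by (auto simp: span_eq_iff[THEN iffD2, OF subspace_dom_A])
qed

lemma bounded_map_domain_R: "bounded_map (domain_space D A') (domain_space E A) R"
proof -
  obtain C where C: "0 < C" "\<And>y. y \<in> carr E \<Longrightarrow> \<bar>nrm E y\<bar> \<le> C * nrm D (Q y)"
    by (rule nrm_E_le) (rule that)
  have "\<bar>nrm E (R x) + nrm E (op_app A (R x))\<bar> \<le> C * (nrm D x + nrm D (op_app A' x))"
    if x: "x \<in> op_dom A'" for x
  proof -
    have x': "x \<in> carr D" "R x \<in> op_dom A" using x by (auto simp: A'_dom)
    show ?thesis
      using C(2)[OF A_dom_carr[OF x'(2)]] C(2)[OF A_carr[OF x'(2)]] x'(1)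
      by (simp add: distrib_left QR A'_app[OF x])
  qed
  moreover have dom: "R x \<in> op_dom A" if "x \<in> op_dom A'" for x
    using that by (simp add: A'_dom)
  ultimately show ?thesis
    using C(1) unfolding bounded_map_def domain_space_def
    using linR dom by (auto simp: span_eq_iff[THEN iffD2, OF subspace_dom_A'])
qed

end

section \<open>Strict solutions and reconstruction\<close>

text \<open>
  The reconstruction operator is linear on its carrier only; a linear map on the whole type is
  obtained by extending a basis of the carrier.
\<close>

lemma linear_extension_from_subspace:
  fixes f :: "'a::real_vector \<Rightarrow> 'b::real_vector"
  assumes S: "subspace S"
    and add: "\<And>x y. x \<in> S \<Longrightarrow> y \<in> S \<Longrightarrow> f (x + y) = f x + f y"
    and scale: "\<And>c x. x \<in> S \<Longrightarrow> f (c *\<^sub>R x) = c *\<^sub>R f x"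
  obtains g where "linear g" "\<And>x. x \<in> S \<Longrightarrow> g x = f x"
proof -
  obtain B where B: "B \<subseteq> S" "independent B" "S \<subseteq> span B"
    by (rule maximal_independent_subset[of S])
  obtain g where g: "linear g" "\<forall>x\<in>B. g x = f x"
    using linear_independent_extend[OF B(2)] by blast
  have "x \<in> S \<and> g x = f x" if "x \<in> span B" for x
    using that
  proof (induction rule: span_induct_alt)
    case base
    show ?case using scale[OF subspace_0[OF S], of 0] subspace_0[OF S] linear_0[OF g(1)] by simp
  next
    case (step c x y)
    then have "x \<in> S" "g x = f x" "y \<in> S" "g y = f y" using B(1) g(2) by auto
    then show ?case
      by (simp add: linear_add[OF g(1)] linear_cmul[OF g(1)] add scale
          subspace_add[OF S] subspace_scale[OF S])
  qed
  with B(3) g(1) show ?thesis by (intro that[of g]) auto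
qed

lemma bounded_op_extension:
  assumes f: "bounded_op V U f" and V: "subspace (carr V)"
    and nonneg: "\<And>x. 0 \<le> nrm V x" "\<And>x. 0 \<le> nrm U x"
  obtains g where "bounded_map V U g" "\<And>x. x \<in> carr V \<Longrightarrow> g x = f x"
proof -
  obtain g where g: "linear g" "\<And>x. x \<in> carr V \<Longrightarrow> g x = f x"
    using f linear_extension_from_subspace[OF V, of f] unfolding bounded_op_def by metis
  obtain C where C: "\<And>x. x \<in> carr V \<Longrightarrow> nrm U (f x) \<le> C * nrm V x"
    using f unfolding bounded_op_def by blast
  have "\<bar>nrm U (g x)\<bar> \<le> (\<bar>C\<bar> + 1) * nrm V x" if x: "x \<in> carr V" for x
  proof -
    have "nrm U (f x) \<le> (\<bar>C\<bar> + 1) * nrm V x"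
      by (rule order_trans[OF C[OF x]]) (intro mult_right_mono nonneg; simp)
    then show ?thesis using nonneg(2) g(2)[OF x] by simp
  qed
  moreover have "f x \<in> carr U" if "x \<in> carr V" for x
    using f that by (simp add: bounded_op_def)
  moreover have "0 < \<bar>C\<bar> + 1" by linarith
  ultimately have "bounded_map V U g"
    unfolding bounded_map_def span_eq_iff[THEN iffD2, OF V] using g by auto
  with g(2) show ?thesis using that by blast
qed

theorem proposition4p5:
  fixes \<gamma> p T :: real and r n :: nat
    and R :: "'d::finite mod_dist \<Rightarrow> 'd functional"
    and P :: "'w measure" and F :: "real \<Rightarrow> 'w measure"
    and W :: "nat \<Rightarrow> real \<Rightarrow> 'w \<Rightarrow> real"
    and A :: "'d functional unbounded_op" and B :: "nat \<Rightarrow> 'd functional unbounded_op"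
    and Z X :: "real \<Rightarrow> 'w \<Rightarrow> 'd functional" and x0 :: "'w \<Rightarrow> 'd functional"
  defines "E \<equiv> besov \<gamma> p r"
    and "D \<equiv> modelled_distributions \<gamma> p"
  defines "Rinv \<equiv> inv_into (carr D) R"
  assumes "0 < \<gamma>" and "\<gamma> \<notin> \<nat>" and "2 \<le> p" and "\<gamma> < real r"
    and "reconstruction_operator \<gamma> p r R" and "isomorphism_op D E R"
    and "0 < T" and "1 \<le> n"
    and "filtered_prob_space P F T" and "brownian_motion P F T n W"
    and "admissible_data E P F T n A Z B x0"
    and "\<And>t \<omega>. t \<in> {0..T} \<Longrightarrow> \<omega> \<in> space P \<Longrightarrow> X t \<omega> \<in> carr E"
  shows "strict_solution E P F T n W A Z B x0 X \<longleftrightarrow>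
         strict_solution D P F T n W
           (conj_op D R A) (\<lambda>t \<omega>. Rinv (Z t \<omega>)) (\<lambda>i. conj_op D R (B i))
           (\<lambda>\<omega>. Rinv (x0 \<omega>)) (\<lambda>t \<omega>. Rinv (X t \<omega>))"
proof -
  note iso = \<open>isomorphism_op D E R\<close>
  note adm = \<open>admissible_data E P F T n A Z B x0\<close>
  note P = \<open>filtered_prob_space P F T\<close>
  note X = \<open>\<And>t \<omega>. t \<in> {0..T} \<Longrightarrow> \<omega> \<in> space P \<Longrightarrow> X t \<omega> \<in> carr E\<close>
  interpret D: normed_carrier D
    unfolding D_def using \<open>2 \<le> p\<close> by (intro normed_carrier_modelled_distributions) simp
  have nonneg: "0 \<le> nrm D u" "0 \<le> nrm E v" for u v
    by (simp_all add: D_def E_def modelled_distributions_def besov_def)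
  have bij: "bij_betw R (carr D) (carr E)" and R_op: "bounded_op D E R" and Rinv_op: "bounded_op E D Rinv"
    using iso by (auto simp: isomorphism_op_def Rinv_def)
  obtain R' where R': "bounded_map D E R'" "\<And>x. x \<in> carr D \<Longrightarrow> R' x = R x"
    by (rule bounded_op_extension[OF R_op D.subspace_carr nonneg]) (rule that)
  have "carr E = R' ` carr D"
    using bij R'(2) by (auto simp: bij_betw_def)
  then have E: "subspace (carr E)"
    using linear_subspace_image[OF bounded_mapD(1)[OF R'(1)] D.subspace_carr] by simp
  obtain Q where Rinv: "bounded_map E D Q" "\<And>y. y \<in> carr E \<Longrightarrow> Q y = Rinv y"
    by (rule bounded_op_extension[OF Rinv_op E nonneg(2,1)]) (rule that)
  interpret normed_isomorphism D E R' Q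
  proof
    show "Q (R' x) = x" if "x \<in> carr D" for x
      using that bij R' Rinv bounded_mapD(2)[OF R'(1)] by (simp add: Rinv_def bij_betw_inv_into_left)
    show "R' (Q y) = y" if "y \<in> carr E" for y
      using that bij R' Rinv bounded_mapD(2)[OF Rinv(1)] by (simp add: Rinv_def bij_betw_inv_into_right)
  qed (use R' Rinv in auto)
  obtain S where S: "analytic_semigroup E S" "has_generator E S (neg_op A)"
    using adm by (auto simp: admissible_data_def)
  have A_carr: "op_app A x \<in> carr E" if "x \<in> op_dom A" for x
    using has_generatorD(2)[OF S(2), of x] that subspace_neg[OF E, of "- op_app A x"]
    by (simp add: neg_op_def)
  have B_carr: "op_app (B i) x \<in> carr E" if "i \<in> {1..n}" "x \<in> op_dom A" for i x
    using adm that unfolding admissible_data_def linear_operator_def by blast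
  let ?A' = "conj_op D R A"
  interpret conjugate_generators D E R' Q A ?A' S
    by unfold_locales (use S R'(2) Rinv(2) A_carr in \<open>auto simp: conj_op_def Rinv_def\<close>)
  have conj_dom: "x \<in> carr D" "R' x = R x" "R x \<in> op_dom A" if "x \<in> op_dom ?A'" for x
    using that R'(2) by (auto simp: conj_op_def)
  have B': "op_app (conj_op D R (B i)) x = Q (op_app (B i) (R' x))" if "i \<in> {1..n}" "x \<in> op_dom ?A'" for i x
    using conj_dom[OF that(2)] B_carr[OF that(1)] Rinv(2) by (simp add: conj_op_def Rinv_def)
  have Z_carr: "AE (s, \<omega>) in restrict_space lborel {0..T} \<Otimes>\<^sub>M P. Z s \<omega> \<in> carr E"
  proof -
    have "Z \<in> M2_proc (DA_half E A) P F T" using adm by (simp add: admissible_data_def)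
    from M2_proc_AE_carr[OF this] have "AE (s, \<omega>) in restrict_space lborel {0..T} \<Otimes>\<^sub>M P. Z s \<omega> \<in> carr (DA_half E A)"
      using filtered_space[OF P] \<open>0 < T\<close> by simp
    then show ?thesis by eventually_elim (auto simp: DA_half_def)
  qed
  have x0_carr: "AE \<omega> in P. x0 \<omega> \<in> carr E"
  proof -
    have "x0 \<in> L2_rv (DA_half E A) P (F 0)" using adm by (simp add: admissible_data_def)
    from L2_rv_AE_carr[OF this] have "AE \<omega> in P. x0 \<omega> \<in> carr (DA_half E A)"
      using filtered_space[OF P] \<open>0 < T\<close> by simp
    then show ?thesis by eventually_elim (simp add: DA_half_def)
  qed
  show ?thesis
  proof
    assume "strict_solution E P F T n W A Z B x0 X"
    then show "strict_solution D P F T n W ?A' (\<lambda>t \<omega>. Rinv (Z t \<omega>)) (\<lambda>i. conj_op D R (B i))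
        (\<lambda>\<omega>. Rinv (x0 \<omega>)) (\<lambda>t \<omega>. Rinv (X t \<omega>))"
    proof (rule strict_solution_map[OF P \<open>0 < T\<close> Rinv(1) E bounded_map_domain_Q bounded_map_DA_half_Q, rotated -1])
      show "AE (s, \<omega>) in restrict_space lborel {0..T} \<Otimes>\<^sub>M P. Rinv (Z s \<omega>) = Q (Z s \<omega>)"
        using Z_carr by eventually_elim (auto simp: Rinv(2))
      show "AE \<omega> in P. Rinv (x0 \<omega>) = Q (x0 \<omega>)"
        using x0_carr by eventually_elim (simp add: Rinv(2))
    qed (use A'_Q B' A_dom_carr X in \<open>simp_all add: RQ Rinv(2)[symmetric]\<close>)
  next
    assume "strict_solution D P F T n W ?A' (\<lambda>t \<omega>. Rinv (Z t \<omega>)) (\<lambda>i. conj_op D R (B i))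
        (\<lambda>\<omega>. Rinv (x0 \<omega>)) (\<lambda>t \<omega>. Rinv (X t \<omega>))"
    then show "strict_solution E P F T n W A Z B x0 X"
    proof (rule strict_solution_map[OF P \<open>0 < T\<close> R'(1) D.subspace_carr bounded_map_domain_R
          bounded_map_DA_half_R, rotated -1])
      show "AE (s, \<omega>) in restrict_space lborel {0..T} \<Otimes>\<^sub>M P. Z s \<omega> = R' (Rinv (Z s \<omega>))"
        using Z_carr by eventually_elim (auto simp: Rinv(2)[symmetric] RQ)
      show "AE \<omega> in P. x0 \<omega> = R' (Rinv (x0 \<omega>))"
        using x0_carr by eventually_elim (simp add: Rinv(2)[symmetric] RQ)
      show "op_app A (R' x) = R' (op_app ?A' x)" if "x \<in> op_dom ?A'" for x
        using A'_app[OF that] conj_dom[OF that] A_carr by (simp add: RQ)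
      show "op_app (B i) (R' x) = R' (op_app (conj_op D R (B i)) x)"
        if "i \<in> {1..n}" "x \<in> op_dom ?A'" for i x
        using B'[OF that] conj_dom[OF that(2)] B_carr[OF that(1)] by (simp add: RQ)
      show "X t \<omega> = R' (Rinv (X t \<omega>))" if "t \<in> {0..T}" "\<omega> \<in> space P" for t \<omega>
        using X[OF that] by (simp add: Rinv(2)[symmetric] RQ)
    qed
  qed
qed

end
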